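(* Let $S=K[t_1,\ldots,t_s]$ be a polynomial ring over a field $K$ with the standard grading, let $\prec$ be a monomial order on $S$, and let $I\subset S$ be a nonzero unmixed graded ideal with $\dim(S/I)\geq 1$ such that $t_i$ is a zero-divisor of $S/I$ for every $i=1,\ldots,s$. Then: (i) $\mathcal{F}_d\neq\emptyset$ for all $d\geq 1$; (ii) $\delta_I(d)\geq \mathrm{fp}_I(d)$ for all $d\geq 1$; (iii) $\deg(S/(I,t^a))\leq \deg(S/(\mathrm{in}_\prec(I),t^a))\leq \deg(S/I)$ for every standard monomial $t^a\in\Delta_\prec(I)\cap S_d$; (iv) $\mathrm{fp}_I(d)\geq 0$ for all $d\geq 1$; (v) $\delta_I(d)\geq\delta_I(d+1)\geq 0$ for all $d\geq 1$; (vi) if moreover $I$ is a radical ideal whose associated primes are generated by linear forms, then there is an integer $r\geq 1$ such that $\delta_I(1)>\delta_I(2)>\cdots>\delta_I(r)=\delta_I(d)=1$ for all $d\geq r$.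
   Context: $S_d$ denotes the homogeneous component of degree $d$, $I_d=I\cap S_d$, and $H_I(d)=\dim_K(S_d/I_d)$ is the Hilbert function; for $d\gg0$ it agrees with a polynomial of degree $k-1$ where $k=\dim(S/I)$. The degree of $S/I$ is $\deg(S/I)=(k-1)!\lim_{d\to\infty}H_I(d)/d^{k-1}$ if $k\geq1$ and $\deg(S/I)=\dim_K(S/I)$ if $k=0$. An ideal is unmixed if all its associated primes have the same height. For $f\in S$, $(I\colon f)=\{h\in S: hf\in I\}$; $f$ is a zero-divisor of $S/I$ iff $(I\colon f)\neq I$. Let $\mathcal{F}_d=\{f\in S_d: f\notin I,\ (I\colon f)\neq I\}$. The minimum distance function is $\delta_I(d)=\deg(S/I)-\max\{\deg(S/(I,f)): f\in\mathcal{F}_d\}$ if $\mathcal{F}_d\neq\emptyset$ and $\delta_I(d)=\deg(S/I)$ otherwise. For a monomial order $\prec$, $\mathrm{in}_\prec(I)$ is the initial ideal of $I$, and $\Delta_\prec(I)$ (the footprint) is the set of standard monomials, i.e. monomials not in $\mathrm{in}_\prec(I)$; $\Delta_\prec(I)_d=\Delta_\prec(I)\cap S_d$. The footprint function is $\mathrm{fp}_I(d)=\deg(S/I)-\max\{\deg(S/(\mathrm{in}_\prec(I),t^a)): t^a\in\Delta_\prec(I)_d\}$ if $\Delta_\prec(I)_d\neq\emptyset$, and $\mathrm{fp}_I(d)=\deg(S/I)$ otherwise. *)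

theory Defs
  imports Complex_Main "HOL-Library.Poly_Mapping"
begin

text \<open>Polynomial ring S = K[t_v : v in 'v] over a field K, variables indexed by a
  finite type 'v (s = CARD('v)). Monomials t^a are exponent vectors a :: 'v =>0 nat.\<close>

type_synonym ('v, 'a) mpoly = "('v \<Rightarrow>\<^sub>0 nat) \<Rightarrow>\<^sub>0 'a"

definition mdeg :: "('v::finite \<Rightarrow>\<^sub>0 nat) \<Rightarrow> nat" where
  "mdeg a = (\<Sum>v\<in>UNIV. Poly_Mapping.lookup a v)"

definition monom :: "('v \<Rightarrow>\<^sub>0 nat) \<Rightarrow> ('v, 'a::field) mpoly" where
  "monom a = Poly_Mapping.single a 1"

definition var :: "'v \<Rightarrow> ('v, 'a::field) mpoly" where
  "var v = monom (Poly_Mapping.single v 1)"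

definition kscale :: "'a::field \<Rightarrow> ('v, 'a) mpoly \<Rightarrow> ('v, 'a) mpoly" where
  "kscale c f = Poly_Mapping.map (\<lambda>x. c * x) f"

definition homog :: "nat \<Rightarrow> ('v::finite, 'a::field) mpoly set" where
  "homog d = {f. \<forall>a\<in>Poly_Mapping.keys f. mdeg a = d}"

definition hcomp :: "nat \<Rightarrow> ('v::finite, 'a::field) mpoly \<Rightarrow> ('v, 'a) mpoly" where
  "hcomp d f = Poly_Mapping.mapp (\<lambda>a c. if mdeg a = d then c else 0) f"

definition is_ideal :: "('v, 'a::field) mpoly set \<Rightarrow> bool" where
  "is_ideal I \<longleftrightarrow> 0 \<in> I \<and> (\<forall>f\<in>I. \<forall>g\<in>I. f + g \<in> I) \<and> (\<forall>f\<in>I. \<forall>h. h * f \<in> I)"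

definition graded_ideal :: "('v::finite, 'a::field) mpoly set \<Rightarrow> bool" where
  "graded_ideal I \<longleftrightarrow> is_ideal I \<and> (\<forall>f\<in>I. \<forall>d. hcomp d f \<in> I)"

definition ideal_gen :: "('v, 'a::field) mpoly set \<Rightarrow> ('v, 'a) mpoly set" where
  "ideal_gen G = \<Inter>{J. is_ideal J \<and> G \<subseteq> J}"

definition colon :: "('v, 'a::field) mpoly set \<Rightarrow> ('v, 'a) mpoly \<Rightarrow> ('v, 'a) mpoly set" where
  "colon I f = {h. h * f \<in> I}"

definition prime_ideal :: "('v, 'a::field) mpoly set \<Rightarrow> bool" where
  "prime_ideal P \<longleftrightarrow> is_ideal P \<and> 1 \<notin> P \<and> (\<forall>f g. f * g \<in> P \<longrightarrow> f \<in> P \<or> g \<in> P)"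

definition radical_ideal :: "('v, 'a::field) mpoly set \<Rightarrow> bool" where
  "radical_ideal I \<longleftrightarrow> is_ideal I \<and> (\<forall>f n. f ^ n \<in> I \<longrightarrow> f \<in> I)"

definition prime_chain :: "nat \<Rightarrow> (nat \<Rightarrow> ('v, 'a::field) mpoly set) \<Rightarrow> bool" where
  "prime_chain n P \<longleftrightarrow> (\<forall>i\<le>n. prime_ideal (P i)) \<and> (\<forall>i<n. P i \<subset> P (Suc i))"

definition height :: "('v, 'a::field) mpoly set \<Rightarrow> nat" where
  "height p = Sup {n. \<exists>P. prime_chain n P \<and> P n = p}"

definition krull_dim :: "('v, 'a::field) mpoly set \<Rightarrow> nat" where
  "krull_dim I = Sup {n. \<exists>P. prime_chain n P \<and> I \<subseteq> P 0}"

definition ass_primes :: "('v, 'a::field) mpoly set \<Rightarrow> ('v, 'a) mpoly set set" where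
  "ass_primes I = {p. prime_ideal p \<and> (\<exists>f. p = colon I f)}"

definition unmixed :: "('v, 'a::field) mpoly set \<Rightarrow> bool" where
  "unmixed I \<longleftrightarrow> (\<forall>p\<in>ass_primes I. \<forall>q\<in>ass_primes I. height p = height q)"

text \<open>Hilbert function H_I(d) = dim_K (S_d / I_d) = dim_K S_d - dim_K I_d.\<close>
definition kdim :: "('v, 'a::field) mpoly set \<Rightarrow> nat" where
  "kdim V = vector_space.dim kscale V"

definition hilbert_fun :: "('v::finite, 'a::field) mpoly set \<Rightarrow> nat \<Rightarrow> nat" where
  "hilbert_fun I d = kdim (homog d :: ('v, 'a) mpoly set) - kdim (I \<inter> homog d)"

text \<open>Degree of S/I (for graded I). If dim(S/I) = 0, dim_K(S/I) = sum_d H_I(d).\<close>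
definition degree_quot :: "('v::finite, 'a::field) mpoly set \<Rightarrow> real" where
  "degree_quot I =
     (let k = krull_dim I in
      if k = 0 then suminf (\<lambda>d. real (hilbert_fun I d))
      else fact (k - 1) * lim (\<lambda>d. real (hilbert_fun I d) / real d ^ (k - 1)))"

definition zero_divs_d :: "('v::finite, 'a::field) mpoly set \<Rightarrow> nat \<Rightarrow> ('v, 'a) mpoly set" where
  "zero_divs_d I d = {f \<in> homog d. f \<notin> I \<and> colon I f \<noteq> I}"

definition min_dist :: "('v::finite, 'a::field) mpoly set \<Rightarrow> nat \<Rightarrow> real" where
  "min_dist I d =
     (if zero_divs_d I d \<noteq> {}
      then degree_quot I - Max ((\<lambda>f. degree_quot (ideal_gen (insert f I))) ` zero_divs_d I d)
      else degree_quot I)"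

definition monomial_order :: "(('v \<Rightarrow>\<^sub>0 nat) \<Rightarrow> ('v \<Rightarrow>\<^sub>0 nat) \<Rightarrow> bool) \<Rightarrow> bool" where
  "monomial_order le \<longleftrightarrow>
     (\<forall>a. le a a) \<and> (\<forall>a b. le a b \<and> le b a \<longrightarrow> a = b) \<and>
     (\<forall>a b c. le a b \<and> le b c \<longrightarrow> le a c) \<and> (\<forall>a b. le a b \<or> le b a) \<and>
     (\<forall>a. le 0 a) \<and> (\<forall>a b c. le a b \<longrightarrow> le (a + c) (b + c))"

definition lead_monom :: "(('v \<Rightarrow>\<^sub>0 nat) \<Rightarrow> ('v \<Rightarrow>\<^sub>0 nat) \<Rightarrow> bool) \<Rightarrow> ('v, 'a::field) mpoly \<Rightarrow> ('v \<Rightarrow>\<^sub>0 nat)" where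
  "lead_monom le f = (THE a. a \<in> Poly_Mapping.keys f \<and> (\<forall>b\<in>Poly_Mapping.keys f. le b a))"

definition init_ideal :: "(('v \<Rightarrow>\<^sub>0 nat) \<Rightarrow> ('v \<Rightarrow>\<^sub>0 nat) \<Rightarrow> bool) \<Rightarrow> ('v, 'a::field) mpoly set \<Rightarrow> ('v, 'a) mpoly set" where
  "init_ideal le I = ideal_gen {monom (lead_monom le f) | f. f \<in> I \<and> f \<noteq> 0}"

definition footprint_d :: "(('v::finite \<Rightarrow>\<^sub>0 nat) \<Rightarrow> ('v \<Rightarrow>\<^sub>0 nat) \<Rightarrow> bool) \<Rightarrow> ('v, 'a::field) mpoly set \<Rightarrow> nat \<Rightarrow> ('v \<Rightarrow>\<^sub>0 nat) set" where
  "footprint_d le I d = {a. mdeg a = d \<and> (monom a :: ('v, 'a) mpoly) \<notin> init_ideal le I}"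

definition footprint_fun :: "(('v::finite \<Rightarrow>\<^sub>0 nat) \<Rightarrow> ('v \<Rightarrow>\<^sub>0 nat) \<Rightarrow> bool) \<Rightarrow> ('v, 'a::field) mpoly set \<Rightarrow> nat \<Rightarrow> real" where
  "footprint_fun le I d =
     (if footprint_d le I d \<noteq> {}
      then degree_quot I - Max ((\<lambda>a. degree_quot (ideal_gen (insert (monom a) (init_ideal le I)))) ` footprint_d le I d)
      else degree_quot I)"

end

theory Submission
  imports Defs "HOL-Library.FuncSet"
begin

text \<open>Dimension theory is reduced to counting. Leading monomials with respect to an order that refines
  the degree turn every ideal J into an upward closed set of exponents with the same (affine) Hilbert
  function. The complement of such a set is a finite disjoint union of cones b + N^A, so the Hilbert
  function grows like N d^(k-1) / (k-1)!, where k is the largest |A| and N the number of cones with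
  |A| = k; moreover k is the largest size of a set A of variables with J \<inter> K[A] = 0. Comparing
  growth rates shows that k drops strictly along chains of primes, and k is both the Krull dimension
  (for graded J) and the number of variables minus the height (for prime J).

  For unmixed I all associated primes therefore have the dimension of I. Any ideal between I and an
  associated prime has that dimension too, hence deg(S/I) = deg(S/(I,f)) + deg(S/(I:f)) for
  zero-divisors f outside I, and the minimum distance is the least value of deg(S/(I:f)). The footprint
  bound compares leading monomials of (I,f), after reducing f modulo I, with (in(I),in(f)).\<close>

text \<open>Krull dimension and height range over all chains of primes, graded or not, so growth is
  compared through the cumulative counts \<open>ccount\<close>, which make sense for every ideal;
  degrees are read off the exact counts \<open>scount\<close>, which need gradedness. No Hilbert
  polynomial is constructed: crude bounds by powers of d + 1 determine the dimension, and one limit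
  determines the degree. That this limit yields an integer matters twice: the \<open>Max\<close> in
  the minimum distance runs over possibly infinitely many forms but only finitely many values, and
  the strict descent in the last claim has to stop. Noetherianity is drawn from monomials as well:
  increasing up-sets stabilise by Dickson, and nested ideals with the same leading monomials
  coincide.\<close>

abbreviation "lookup \<equiv> Poly_Mapping.lookup"
abbreviation "keys \<equiv> Poly_Mapping.keys"

section \<open>Polynomials\<close>

lemma kscale_eq: "kscale c f = Poly_Mapping.single 0 c * f"
  unfolding kscale_def by (rule mult_map_scale_conv_mult)

lemma lookup_kscale: "lookup (kscale c f) a = c * lookup f a"
  by (auto simp: kscale_def Poly_Mapping.map.rep_eq when_def)

lemma keys_kscale: "keys (kscale c f) \<subseteq> keys f"
  by (auto simp: in_keys_iff lookup_kscale)

interpretation kv: vector_space "kscale :: 'a::field \<Rightarrow> ('v, 'a) mpoly \<Rightarrow> ('v, 'a) mpoly"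
  by unfold_locales
    (auto intro!: poly_mapping_eqI simp: lookup_kscale lookup_add algebra_simps)

lemma poly_expand: "f = (\<Sum>a\<in>keys f. Poly_Mapping.single a (lookup f a))"
proof (rule poly_mapping_eqI)
  fix k
  have "lookup (\<Sum>a\<in>keys f. Poly_Mapping.single a (lookup f a)) k
      = (\<Sum>a\<in>keys f. if a = k then lookup f a else 0)"
    by (simp add: lookup_sum lookup_single when_def)
  also have "\<dots> = lookup f k"
    by (simp add: sum.delta in_keys_iff)
  finally show "lookup f k = lookup (\<Sum>a\<in>keys f. Poly_Mapping.single a (lookup f a)) k" by simp
qed

lemma poly_expand_monom: "f = (\<Sum>a\<in>keys f. kscale (lookup f a) (monom a))"
proof -
  have *: "kscale (lookup f a) (monom a) = Poly_Mapping.single a (lookup f a)" for a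
    by (simp add: kscale_def monom_def map_single)
  show ?thesis unfolding * by (rule poly_expand)
qed

lemma keys_monom [simp]: "keys (monom a :: ('v, 'a::field) mpoly) = {a}"
  by (simp add: monom_def)

lemma monom_nz [simp]: "(monom a :: ('v, 'a::field) mpoly) \<noteq> 0"
  by (metis keys_monom keys_zero insert_not_empty)

lemma monom_mult: "monom (a + b) = (monom a * monom b :: ('v, 'a::field) mpoly)"
  by (simp add: monom_def mult_single)

lemma monom_0 [simp]: "monom 0 = (1 :: ('v, 'a::field) mpoly)"
  by (simp add: monom_def)

text \<open>For finite M these are the windows in which dimensions are taken; for upward closed M
  they are the monomial ideals.\<close>

definition polys_on :: "('v \<Rightarrow>\<^sub>0 nat) set \<Rightarrow> ('v, 'a::field) mpoly set" where
  "polys_on M = {f. keys f \<subseteq> M}"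

lemma polys_on_subspace: "kv.subspace (polys_on M)"
  unfolding kv.subspace_def polys_on_def
  using keys_kscale keys_add[where ?'a = "'v \<Rightarrow>\<^sub>0 nat" and ?'b = 'a] by (simp, blast)

lemma monom_polys_on [simp]: "monom a \<in> polys_on M \<longleftrightarrow> a \<in> M"
  by (simp add: polys_on_def)

lemma polys_on_mono: "M \<subseteq> N \<Longrightarrow> polys_on M \<subseteq> polys_on N"
  by (auto simp: polys_on_def)

lemma homog_eq: "homog d = polys_on {a. mdeg a = d}"
  by (auto simp: homog_def polys_on_def)

lemma homogD: "f \<in> homog d \<Longrightarrow> a \<in> keys f \<Longrightarrow> mdeg a = d"
  by (simp add: homog_def)

lemma polys_on_mult:
  "f \<in> polys_on M \<Longrightarrow> g \<in> polys_on N \<Longrightarrow> (\<And>a b. a \<in> M \<Longrightarrow> b \<in> N \<Longrightarrow> a + b \<in> K)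
    \<Longrightarrow> f * g \<in> polys_on K"
  using keys_mult[of f g] by (force simp: polys_on_def)

lemma ideal_props:
  assumes "is_ideal J"
  shows ideal_zero: "0 \<in> J" and ideal_add: "f \<in> J \<Longrightarrow> g \<in> J \<Longrightarrow> f + g \<in> J"
    and ideal_mult: "f \<in> J \<Longrightarrow> h * f \<in> J" and ideal_mult': "f \<in> J \<Longrightarrow> f * h \<in> J"
    and ideal_kscale: "f \<in> J \<Longrightarrow> kscale c f \<in> J"
    and ideal_diff: "f \<in> J \<Longrightarrow> g \<in> J \<Longrightarrow> f - g \<in> J"
proof -
  show m: "f \<in> J \<Longrightarrow> h * f \<in> J" for f h using assms by (simp add: is_ideal_def)
  show a: "f \<in> J \<Longrightarrow> g \<in> J \<Longrightarrow> f + g \<in> J" for f g using assms by (simp add: is_ideal_def)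
  show "0 \<in> J" using assms by (simp add: is_ideal_def)
  show "f \<in> J \<Longrightarrow> f * h \<in> J" using m[of f h] by (simp add: mult.commute)
  show "f \<in> J \<Longrightarrow> kscale c f \<in> J" by (simp add: kscale_eq m)
  have u: "f \<in> J \<Longrightarrow> - f \<in> J" for f using m[of f "-1"] by simp
  show "f \<in> J \<Longrightarrow> g \<in> J \<Longrightarrow> f - g \<in> J" using a[of f "- g"] u[of g] by simp
qed

lemma ideal_sum: "is_ideal J \<Longrightarrow> (\<And>x. x \<in> X \<Longrightarrow> f x \<in> J) \<Longrightarrow> sum f X \<in> J"
  by (induction X rule: infinite_finite_induct) (auto simp: ideal_zero ideal_add)

lemma ideal_subspace: "is_ideal J \<Longrightarrow> kv.subspace J"
  by (simp add: kv.subspace_def ideal_zero ideal_add ideal_kscale)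

lemma ideal_one: "is_ideal J \<Longrightarrow> 1 \<in> J \<longleftrightarrow> J = UNIV"
  using ideal_mult[of J 1] by auto

lemma colon_ideal: "is_ideal J \<Longrightarrow> is_ideal (colon J f)"
  by (simp add: is_ideal_def colon_def distrib_right mult.assoc)

lemma colon_superset: "is_ideal J \<Longrightarrow> J \<subseteq> colon J f"
  by (auto simp: colon_def ideal_mult')

lemma colon_colon: "colon (colon J f) g = colon J (f * g)"
  by (auto simp: colon_def mult_ac)

lemma ideal_gen_ideal: "is_ideal (ideal_gen G)"
  unfolding is_ideal_def ideal_gen_def by auto

lemma ideal_gen_superset: "G \<subseteq> ideal_gen G"
  unfolding ideal_gen_def by auto

lemma ideal_gen_least: "is_ideal J \<Longrightarrow> G \<subseteq> J \<Longrightarrow> ideal_gen G \<subseteq> J"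
  unfolding ideal_gen_def by auto

lemma ideal_gen_insert:
  assumes J: "is_ideal J"
  shows "ideal_gen (insert f J) = {j + h * f | j h. j \<in> J}"
proof
  have "is_ideal {j + h * f | j h. j \<in> J}" (is "is_ideal ?R")
    unfolding is_ideal_def
  proof (intro conjI ballI allI)
    show "0 \<in> ?R" using ideal_zero[OF J] by (auto intro!: exI[of _ 0])
  next
    fix x y assume "x \<in> ?R" "y \<in> ?R"
    then obtain i g j h where "x = i + g * f" "y = j + h * f" "i \<in> J" "j \<in> J" by blast
    then have "x + y = (i + j) + (g + h) * f" "i + j \<in> J"
      by (auto simp: algebra_simps ideal_add[OF J])
    then show "x + y \<in> ?R" by blast
  next
    fix x y assume "x \<in> ?R"
    then obtain i g where "x = i + g * f" "i \<in> J" by blast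
    then have "y * x = y * i + (y * g) * f" "y * i \<in> J"
      by (auto simp: algebra_simps ideal_mult'[OF J])
    then show "y * x \<in> ?R" by blast
  qed
  moreover have "insert f J \<subseteq> ?R"
  proof
    fix x assume "x \<in> insert f J"
    then consider "x = 0 + 1 * f" | "x = x + 0 * f" "x \<in> J" by auto
    then show "x \<in> ?R" using ideal_zero[OF J] by cases blast+
  qed
  ultimately show "ideal_gen (insert f J) \<subseteq> ?R" by (rule ideal_gen_least)
  show "?R \<subseteq> ideal_gen (insert f J)"
    using ideal_gen_superset[of "insert f J"] ideal_gen_ideal[of "insert f J"]
    by (auto intro!: ideal_add ideal_mult)
qed

lemma prime_colon: "prime_ideal P \<Longrightarrow> f \<notin> P \<Longrightarrow> colon P f = P"
  by (auto simp: colon_def prime_ideal_def intro: ideal_mult')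

section \<open>Leading terms\<close>

text \<open>One notion for two index monoids, exponent vectors under the monomial order and degrees
  in \<open>nat\<close>; both index coefficients in \<open>coef_prime\<close>.\<close>

definition add_linorder :: "('g::comm_monoid_add \<Rightarrow> 'g \<Rightarrow> bool) \<Rightarrow> bool" where
  "add_linorder le \<longleftrightarrow> (\<forall>a. le a a) \<and> (\<forall>a b. le a b \<and> le b a \<longrightarrow> a = b) \<and>
     (\<forall>a b c. le a b \<and> le b c \<longrightarrow> le a c) \<and> (\<forall>a b. le a b \<or> le b a) \<and>
     (\<forall>a b c. le a b \<longrightarrow> le (a + c) (b + c))"

lemma add_linorderD:
  assumes "add_linorder le"
  shows add_linorder_refl: "le a a" and add_linorder_antisym: "le a b \<Longrightarrow> le b a \<Longrightarrow> a = b"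
    and add_linorder_trans: "le a b \<Longrightarrow> le b c \<Longrightarrow> le a c"
    and add_linorder_total: "le a b \<or> le b a"
    and add_linorder_add: "le a b \<Longrightarrow> le (a + c) (b + c)"
  using assms unfolding add_linorder_def by blast+

lemma add_linorder_nat: "add_linorder ((\<le>) :: nat \<Rightarrow> nat \<Rightarrow> bool)"
  by (auto simp: add_linorder_def)

lemma add_linorder_max:
  assumes "add_linorder le" "finite X" "X \<noteq> {}"
  obtains m where "m \<in> X" "\<And>x. x \<in> X \<Longrightarrow> le x m"
proof -
  have "\<exists>m\<in>X. \<forall>x\<in>X. le x m"
    using assms(2,3)
  proof (induction X rule: finite_ne_induct)
    case (singleton x)
    then show ?case using add_linorder_refl[OF assms(1)] by blast
  next
    case (insert x F)
    then obtain m where m: "m \<in> F" "\<forall>y\<in>F. le y m" by blast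
    consider "le x m" | "le m x" using add_linorder_total[OF assms(1)] by blast
    then show ?case
    proof cases
      case 1
      then show ?thesis using m by auto
    next
      case 2
      then have "\<forall>y\<in>insert x F. le y x"
        using m add_linorder_refl[OF assms(1)] add_linorder_trans[OF assms(1)] by blast
      then show ?thesis by blast
    qed
  qed
  then show ?thesis using that by blast
qed

text \<open>Among exponents l below a and q below b, only l = a and q = b add up to a + b: raising l
  to a and q to b can only increase the sum, and cancellation excludes any other pair. So one
  product survives in the convolution.\<close>

lemma lookup_mult_top:
  fixes F G :: "'g::cancel_comm_monoid_add \<Rightarrow>\<^sub>0 'r::comm_semiring_0"
  assumes le: "add_linorder le"
    and F: "\<And>x. x \<in> keys F \<Longrightarrow> le x a" and G: "\<And>y. y \<in> keys G \<Longrightarrow> le y b"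
  shows "lookup (F * G) (a + b) = lookup F a * lookup G b"
proof -
  have "lookup F l * (\<Sum>q. lookup G q when a + b = l + q)
      = (lookup F a * lookup G b when l = a)" for l
  proof (cases "l = a")
    case True
    then show ?thesis by simp
  next
    case False
    have "(lookup G q when a + b = l + q) = 0" if l: "l \<in> keys F" for q
    proof (rule ccontr)
      assume "(lookup G q when a + b = l + q) \<noteq> 0"
      then have q: "q \<in> keys G" "a + b = l + q" by (auto simp: in_keys_iff)
      have 1: "le (l + q) (a + q)" using F[OF l] by (rule add_linorder_add[OF le])
      have 2: "le (q + a) (b + a)" using G[OF q(1)] by (rule add_linorder_add[OF le])
      have "a + q = a + b"
        using 1 2 q(2) by (intro add_linorder_antisym[OF le]) (simp_all add: add.commute)
      then show False using q(2) False by simp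
    qed
    then show ?thesis using False by (cases "l \<in> keys F") (auto simp: in_keys_iff)
  qed
  then show ?thesis by (simp add: lookup_mult)
qed

locale mon_order =
  fixes le :: "('v::finite \<Rightarrow>\<^sub>0 nat) \<Rightarrow> ('v \<Rightarrow>\<^sub>0 nat) \<Rightarrow> bool"
  assumes mo: "monomial_order le"
begin

lemma le_add_linorder: "add_linorder le"
  using mo unfolding add_linorder_def monomial_order_def by blast

lemma le_refl [simp]: "le a a"
  and le_antisym: "le a b \<Longrightarrow> le b a \<Longrightarrow> a = b"
  and le_trans: "le a b \<Longrightarrow> le b c \<Longrightarrow> le a c"
  and le_total: "le a b \<or> le b a"
  and le_add: "le a b \<Longrightarrow> le (a + c) (b + c)"
  and le_zero: "le 0 a"
  using mo unfolding monomial_order_def by blast+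

abbreviation "lead \<equiv> lead_monom le"

lemma lead_props:
  assumes "f \<noteq> 0"
  shows lead_keys: "lead f \<in> keys f" and lead_max: "a \<in> keys f \<Longrightarrow> le a (lead f)"
proof -
  have "keys f \<noteq> {}" using assms by (metis empty_iff in_keys_iff lookup_zero poly_mapping_eqI)
  then obtain m where m: "m \<in> keys f" "\<And>x. x \<in> keys f \<Longrightarrow> le x m"
    using add_linorder_max[OF le_add_linorder, of "keys f"] by auto
  have "lead f = m"
    unfolding lead_monom_def
    by (rule the_equality) (use m in \<open>blast intro: le_antisym\<close>)+
  then show "lead f \<in> keys f" "a \<in> keys f \<Longrightarrow> le a (lead f)" using m by simp_all
qed

lemma lead_eqI: "a \<in> keys f \<Longrightarrow> (\<And>b. b \<in> keys f \<Longrightarrow> le b a) \<Longrightarrow> lead f = a"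
  by (metis keys_zero empty_iff lead_keys lead_max le_antisym)

lemma lead_monom [simp]: "lead (monom a :: ('v, 'a::field) mpoly) = a"
  by (rule lead_eqI) auto

lemma lookup_lead_mult:
  assumes "f \<noteq> 0" "g \<noteq> 0"
  shows "lookup (f * g) (lead f + lead g) = lookup f (lead f) * lookup g (lead g)"
  using assms by (intro lookup_mult_top[OF le_add_linorder] lead_max)

lemma mult_nz:
  fixes f g :: "('v, 'a::field) mpoly"
  assumes "f \<noteq> 0" "g \<noteq> 0"
  shows "f * g \<noteq> 0"
proof
  assume "f * g = 0"
  then have "lookup f (lead f) * lookup g (lead g) = 0" using lookup_lead_mult[OF assms] by simp
  then show False using assms lead_keys by (auto simp: in_keys_iff)
qed

lemma lead_mult:
  fixes f g :: "('v, 'a::field) mpoly"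
  assumes "f \<noteq> 0" "g \<noteq> 0"
  shows "lead (f * g) = lead f + lead g"
proof (rule lead_eqI)
  show "lead f + lead g \<in> keys (f * g)"
    using lookup_lead_mult[OF assms] assms lead_keys by (auto simp: in_keys_iff)
  fix b assume "b \<in> keys (f * g)"
  then obtain x y where xy: "x \<in> keys f" "y \<in> keys g" "b = x + y" using keys_mult by blast
  have "le (x + y) (lead f + y)" using lead_max[OF assms(1) xy(1)] by (rule le_add)
  moreover have "le (y + lead f) (lead g + lead f)" using lead_max[OF assms(2) xy(2)] by (rule le_add)
  ultimately show "le b (lead f + lead g)" unfolding xy(3) by (metis le_trans add.commute)
qed

definition lms :: "('v, 'a::field) mpoly set \<Rightarrow> ('v \<Rightarrow>\<^sub>0 nat) set" where
  "lms J = {lead f | f. f \<in> J \<and> f \<noteq> 0}"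

lemma lmsI: "f \<in> J \<Longrightarrow> f \<noteq> 0 \<Longrightarrow> lead f \<in> lms J"
  by (auto simp: lms_def)

lemma lmsE: "a \<in> lms J \<Longrightarrow> (\<And>f. f \<in> J \<Longrightarrow> f \<noteq> 0 \<Longrightarrow> lead f = a \<Longrightarrow> thesis) \<Longrightarrow> thesis"
  by (auto simp: lms_def)

lemma lms_mono: "J \<subseteq> J' \<Longrightarrow> lms J \<subseteq> lms J'"
  by (auto simp: lms_def)

lemma lms_polys_on: "V \<subseteq> polys_on M \<Longrightarrow> lms V \<subseteq> M"
  using lead_keys by (fastforce simp: lms_def polys_on_def)

lemma lms_polys_on_eq [simp]: "lms (polys_on M :: ('v, 'a::field) mpoly set) = M"
proof
  show "M \<subseteq> lms (polys_on M :: ('v, 'a::field) mpoly set)"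
  proof
    fix a assume "a \<in> M"
    then show "a \<in> lms (polys_on M :: ('v, 'a::field) mpoly set)"
      using lmsI[of "monom a" "polys_on M"] by simp
  qed
qed (simp add: lms_polys_on)

lemma lms_add:
  fixes J :: "('v, 'a::field) mpoly set"
  assumes "is_ideal J" "a \<in> lms J"
  shows "a + b \<in> lms J"
proof -
  obtain f where f: "f \<in> J" "f \<noteq> 0" "lead f = a" using assms(2) by (rule lmsE)
  have "lead (f * monom b) = a + b" using f by (simp add: lead_mult)
  moreover have "f * monom b \<in> J" using assms(1) f(1) by (rule ideal_mult')
  ultimately show ?thesis using lmsI[of "f * monom b" J] mult_nz[OF f(2)] by simp
qed

text \<open>The exponent 0 is least in a monomial order, so a leading exponent 0 means a nonzero
  constant.\<close>

lemma lms_zero_iff: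
  fixes J :: "('v, 'a::field) mpoly set"
  assumes "is_ideal J"
  shows "0 \<in> lms J \<longleftrightarrow> 1 \<in> J"
proof
  assume "0 \<in> lms J"
  then obtain f where f: "f \<in> J" "f \<noteq> 0" "lead f = 0" by (rule lmsE)
  then have *: "b \<in> keys f \<Longrightarrow> b = 0" for b
    using lead_max[of f b] le_zero le_antisym by metis
  have k: "lookup f 0 \<noteq> 0" using lead_keys[OF f(2)] f(3) by (simp add: in_keys_iff)
  have k': "lookup f a = 0" if "a \<noteq> 0" for a using * that by (metis in_keys_iff)
  have "kscale (inverse (lookup f 0)) f = 1"
  proof (rule poly_mapping_eqI)
    fix a
    show "lookup (kscale (inverse (lookup f 0)) f) a = lookup 1 a"
      using k k'[of a] by (cases "a = 0") (auto simp: lookup_kscale lookup_one)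
  qed
  then show "1 \<in> J" using ideal_kscale[OF assms f(1)] by metis
next
  assume "1 \<in> J"
  moreover have "lead (1 :: ('v, 'a) mpoly) = 0"
    using lead_monom[of 0, where ?'a = 'a] unfolding monom_0 .
  ultimately show "0 \<in> lms J" using lmsI[of 1 J] by simp
qed

end

section \<open>Degrees of monomials and orders that refine them\<close>

lemma mdeg_add: "mdeg (a + b) = mdeg a + mdeg b"
  by (simp add: mdeg_def lookup_add sum.distrib)

lemma mdeg_0 [simp]: "mdeg 0 = 0"
  by (simp add: mdeg_def)

lemma lookup_le_mdeg: "lookup a v \<le> mdeg (a :: 'v::finite \<Rightarrow>\<^sub>0 nat)"
  unfolding mdeg_def by (rule member_le_sum) auto

lemma mdeg_single [simp]: "mdeg (Poly_Mapping.single v n) = n"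
  by (simp add: mdeg_def lookup_single when_def)

lemma mdeg_eq_0: "mdeg a = 0 \<longleftrightarrow> a = 0"
  by (auto simp: mdeg_def intro: poly_mapping_eqI)

lemma finite_mdeg_le: "finite {a :: 'v::finite \<Rightarrow>\<^sub>0 nat. mdeg a \<le> d}"
proof -
  have "finite {f. \<forall>v :: 'v. (v \<in> UNIV \<longrightarrow> f v \<in> {..d}) \<and> (v \<notin> UNIV \<longrightarrow> f v = 0)}"
    by (rule finite_set_of_finite_funs) simp_all
  moreover have "lookup ` {a :: 'v \<Rightarrow>\<^sub>0 nat. mdeg a \<le> d}
      \<subseteq> {f. \<forall>v :: 'v. (v \<in> UNIV \<longrightarrow> f v \<in> {..d}) \<and> (v \<notin> UNIV \<longrightarrow> f v = 0)}"
    using lookup_le_mdeg le_trans by fastforce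
  ultimately have "finite (lookup ` {a :: 'v \<Rightarrow>\<^sub>0 nat. mdeg a \<le> d})"
    by (rule rev_finite_subset)
  then show ?thesis by (rule finite_imageD) (simp add: inj_on_def poly_mapping_eqI)
qed

lemma finite_mdeg_eq: "finite {a :: 'v::finite \<Rightarrow>\<^sub>0 nat. mdeg a = d}"
  by (rule finite_subset[OF _ finite_mdeg_le[of d]]) auto

text \<open>Refining the degree makes initial segments of the order finite and lets truncation by
  degree respect leading monomials.\<close>

locale deg_order = mon_order le
  for le :: "('v::finite \<Rightarrow>\<^sub>0 nat) \<Rightarrow> ('v \<Rightarrow>\<^sub>0 nat) \<Rightarrow> bool" +
  assumes deg: "le a b \<Longrightarrow> mdeg a \<le> mdeg b"
begin

text \<open>Division with remainder modulo a mere subspace: as long as the lead of f - v is the lead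
  of some g in V, a scalar multiple of g cancels it and the lead drops. Initial segments are finite,
  so their size n turns termination into minimising a natural number.\<close>

lemma lead_reduce:
  fixes V :: "('v, 'a::field) mpoly set"
  assumes V: "kv.subspace V" and f: "f \<notin> V"
  obtains v where "v \<in> V" "f - v \<noteq> 0" "lead (f - v) \<notin> lms V"
proof -
  define n where "n a = card {b. le b a}" for a
  have fin: "finite {b. le b a}" for a
    by (rule finite_subset[OF _ finite_mdeg_le[of "mdeg a"]]) (auto dest: deg)
  have n: "n a < n b" if "le a b" "a \<noteq> b" for a b
    unfolding n_def
  proof (rule psubset_card_mono[OF fin])
    have "b \<notin> {c. le c a}" using that le_antisym by blast
    then show "{c. le c a} \<subset> {c. le c b}" using that le_trans le_refl by blast
  qed
  define v where "v = arg_min (\<lambda>v. n (lead (f - v))) (\<lambda>v. v \<in> V)"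
  have "0 \<in> V" using V by (simp add: kv.subspace_def)
  then have v: "v \<in> V" and vmin: "\<And>w. w \<in> V \<Longrightarrow> n (lead (f - v)) \<le> n (lead (f - w))"
    unfolding v_def using arg_min_nat_lemma[of "\<lambda>v. v \<in> V" 0 "\<lambda>v. n (lead (f - v))"] by auto
  have nz: "f - w \<noteq> 0" if "w \<in> V" for w using f that by auto
  have "lead (f - v) \<notin> lms V"
  proof
    assume "lead (f - v) \<in> lms V"
    then obtain g where g: "g \<in> V" "g \<noteq> 0" "lead g = lead (f - v)" by (rule lmsE)
    define c where "c = lookup (f - v) (lead g) / lookup g (lead g)"
    define w where "w = v + kscale c g"
    have w: "w \<in> V" using V v g unfolding w_def by (simp add: kv.subspace_def)
    have fw: "f - w = f - v - kscale c g" by (simp add: w_def)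
    have "lookup g (lead g) \<noteq> 0" using lead_keys[OF g(2)] by (simp add: in_keys_iff)
    then have "lookup (f - w) (lead g) = 0"
      unfolding fw by (simp add: lookup_minus lookup_kscale c_def)
    then have ne: "lead (f - w) \<noteq> lead g" using lead_keys[OF nz[OF w]] by (auto simp: in_keys_iff)
    have "lead (f - w) \<in> keys (f - v) \<union> keys g"
      using lead_keys[OF nz[OF w]] keys_diff[of "f - v" "kscale c g"] keys_kscale[of c g]
      unfolding fw by blast
    then have "le (lead (f - w)) (lead g)" using lead_max[OF g(2)] lead_max[OF nz[OF v]] g(3) by auto
    then have "n (lead (f - w)) < n (lead (f - v))" using n ne g(3) by simp
    then show False using vmin[OF w] by simp
  qed
  then show ?thesis using that v nz by blast
qed

text \<open>An element of W outside V could be reduced by V to a lead outside \<open>lms V\<close>,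
  although the remainder stays in W. This is how stabilising leads make ideals stabilise.\<close>

lemma subspace_eq_lms:
  fixes V W :: "('v, 'a::field) mpoly set"
  assumes "kv.subspace V" "kv.subspace W" "V \<subseteq> W" "lms W \<subseteq> lms V"
  shows "V = W"
proof (rule ccontr)
  assume "V \<noteq> W"
  then obtain f where f: "f \<in> W" "f \<notin> V" using assms(3) by blast
  obtain v where v: "v \<in> V" "f - v \<noteq> 0" "lead (f - v) \<notin> lms V"
    using lead_reduce[OF assms(1) f(2)] .
  have "f - v \<in> W" using f v assms by (auto intro: kv.subspace_diff)
  then show False using v assms(4) lmsI by blast
qed

text \<open>In a vanishing combination the greatest lead among the terms with nonzero coefficient
  belongs to only one of them, so nothing can cancel it.\<close>

lemma independent_leads:
  fixes B :: "('v, 'a::field) mpoly set"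
  assumes "finite B" "0 \<notin> B" "inj_on lead B"
  shows "kv.independent B"
proof (rule kv.independent_if_scalars_zero[OF assms(1)])
  fix c x assume s: "(\<Sum>x\<in>B. kscale (c x) x) = 0" and x: "x \<in> B"
  show "c x = 0"
  proof (rule ccontr)
    assume nz: "c x \<noteq> 0"
    define X where "X = {y \<in> B. c y \<noteq> 0}"
    have "finite X" "X \<noteq> {}" using assms(1) x nz by (auto simp: X_def)
    then obtain a where "a \<in> lead ` X" and amax: "\<And>b. b \<in> lead ` X \<Longrightarrow> le b a"
      using add_linorder_max[OF le_add_linorder, of "lead ` X"] by blast
    then obtain y where y: "y \<in> X" "a = lead y" by blast
    have "c z * lookup z a = 0" if "z \<in> B" "z \<noteq> y" for z
    proof (rule ccontr)
      assume "c z * lookup z a \<noteq> 0"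
      then have z: "z \<in> X" "a \<in> keys z" using that by (auto simp: X_def in_keys_iff)
      then have "le a (lead z)" using assms(2) that by (intro lead_max) auto
      then have "lead z = lead y" using amax[of "lead z"] z(1) y(2) le_antisym by blast
      then show False using assms(3) that y(1) by (auto simp: inj_on_def X_def)
    qed
    then have "(\<Sum>z\<in>B - {y}. c z * lookup z a) = 0" by (intro sum.neutral) auto
    moreover have "(\<Sum>z\<in>B. c z * lookup z a) = 0"
      using arg_cong[OF s, of "\<lambda>f. lookup f a"] by (simp add: lookup_sum lookup_kscale)
    ultimately have "c y * lookup y a = 0"
      using assms(1) y(1) by (simp add: sum.remove[of B y] X_def)
    moreover have "lookup y a \<noteq> 0"
      using lead_keys[of y] assms(2) y by (auto simp: in_keys_iff X_def)
    ultimately show False using y(1) by (simp add: X_def)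
  qed
qed

lemma basis_lms:
  fixes V :: "('v, 'a::field) mpoly set"
  assumes V: "kv.subspace V" and M: "V \<subseteq> polys_on M" "finite M"
  obtains B where "finite B" "kv.independent B" "B \<subseteq> V" "kv.span B = V" "card B = card (lms V)"
proof -
  have "\<exists>g. \<forall>a\<in>lms V. g a \<in> V \<and> g a \<noteq> 0 \<and> lead (g a) = a"
    by (rule bchoice) (auto elim: lmsE)
  then obtain g where g: "\<And>a. a \<in> lms V \<Longrightarrow> g a \<in> V \<and> g a \<noteq> 0 \<and> lead (g a) = a" by blast
  define B where "B = g ` lms V"
  have fin: "finite (lms V)" using lms_polys_on[OF M(1)] M(2) finite_subset by blast
  have inj: "inj_on g (lms V)" using g by (metis inj_onI)
  have B: "finite B" "B \<subseteq> V" "card B = card (lms V)" "0 \<notin> B" "inj_on lead B"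
    unfolding B_def using fin g inj by (auto simp: card_image inj_on_def)
  have sp: "kv.span B \<subseteq> V" using B(2) V by (rule kv.span_minimal)
  have "lms V \<subseteq> lms (kv.span B)"
  proof
    fix a assume a: "a \<in> lms V"
    then have "g a \<in> kv.span B" by (auto simp: B_def intro: kv.span_base)
    then show "a \<in> lms (kv.span B)" using g[OF a] lmsI by metis
  qed
  then have "kv.span B = V"
    using sp V by (intro subspace_eq_lms) (auto intro: kv.subspace_span)
  then show ?thesis using that[of B] B independent_leads by blast
qed

lemma kdim_lms:
  fixes V :: "('v, 'a::field) mpoly set"
  assumes "kv.subspace V" "V \<subseteq> polys_on M" "finite M"
  shows "kdim V = card (lms V)"
  using basis_lms[OF assms] unfolding kdim_def by (metis kv.dim_span_eq_card_independent)

end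

section \<open>Dimension counts\<close>

lemma subspace_window: "is_ideal J \<Longrightarrow> kv.subspace (J \<inter> polys_on M)"
  by (intro kv.subspace_inter ideal_subspace polys_on_subspace)

lemma independent_Un:
  fixes A B :: "('v, 'a::field) mpoly set"
  assumes A: "kv.independent A" and B: "kv.independent B" and AB: "kv.span A \<inter> kv.span B \<subseteq> {0}"
  shows "A \<inter> B = {}" and "kv.independent (A \<union> B)"
proof -
  have z: "0 \<notin> A" "0 \<notin> B" using A B kv.dependent_zero by auto
  show disj: "A \<inter> B = {}"
    using AB z kv.span_superset[of A] kv.span_superset[of B] by blast
  have *: False
    if C: "kv.independent C" and CD: "kv.span C \<inter> kv.span D \<subseteq> {0}" "C \<inter> D = {}"
      and x: "x \<in> C" "x \<in> kv.span (C \<union> D - {x})" for C D x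
  proof -
    have "C \<union> D - {x} = (C - {x}) \<union> D" using CD x by blast
    then obtain c d where cd: "x = c + d" "c \<in> kv.span (C - {x})" "d \<in> kv.span D"
      using x(2) by (auto simp: kv.span_Un)
    have "c \<in> kv.span C" using cd(2) kv.span_mono[of "C - {x}" C] by blast
    then have "d \<in> kv.span C" using cd(1) x(1) by (metis kv.span_base kv.span_diff add_diff_cancel_left')
    then have "d = 0" using CD(1) cd(3) by blast
    then show False using cd C x(1) unfolding kv.dependent_def by auto
  qed
  show "kv.independent (A \<union> B)"
    unfolding kv.dependent_def
  proof
    assume "\<exists>a\<in>A \<union> B. a \<in> kv.span (A \<union> B - {a})"
    then obtain a where a: "a \<in> A \<union> B" "a \<in> kv.span (A \<union> B - {a})" by blast
    show False
    proof (cases "a \<in> A")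
      case True
      then show ?thesis using *[OF A AB disj] a by blast
    next
      case False
      then show ?thesis using *[OF B, of A a] AB disj a by (auto simp: Int_commute Un_commute)
    qed
  qed
qed

section \<open>Homogeneous components and graded ideals\<close>

lemma lookup_hcomp: "lookup (hcomp d f) a = (if mdeg a = d then lookup f a else 0)"
  by (auto simp: hcomp_def lookup_mapp when_def in_keys_iff)

lemma keys_hcomp: "keys (hcomp d f) = {a \<in> keys f. mdeg a = d}"
  by (auto simp: in_keys_iff lookup_hcomp split: if_splits)

lemma hcomp_homog [simp]: "hcomp d f \<in> homog d"
  by (simp add: homog_def keys_hcomp)

lemma hcomp_add: "hcomp d (f + g) = hcomp d f + hcomp d g"
  by (rule poly_mapping_eqI) (simp add: lookup_hcomp lookup_add)

lemma hcomp_minus: "hcomp d (f - g) = hcomp d f - hcomp d g"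
  by (rule poly_mapping_eqI) (simp add: lookup_hcomp lookup_minus)

lemma hcomp_0 [simp]: "hcomp d 0 = 0"
  by (rule poly_mapping_eqI) (simp add: lookup_hcomp)

lemma hcomp_of_homog: "f \<in> homog e \<Longrightarrow> hcomp d f = (if d = e then f else 0)"
  by (rule poly_mapping_eqI) (auto simp: lookup_hcomp homog_def in_keys_iff)

text \<open>Only the component of h in degree d can reach degree d + e after multiplication by a
  form of degree e. Components of multiples of f are thus multiples of f, which makes (J,f) and
  (J:f) graded.\<close>

lemma hcomp_mult_homog:
  assumes f: "f \<in> homog e"
  shows "hcomp (d + e) (h * f) = hcomp d h * f"
    and "i < e \<Longrightarrow> hcomp i (h * f) = 0"
proof -
  have k: "mdeg a \<noteq> d + e" if "a \<in> keys ((h - hcomp d h) * f)" for a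
  proof -
    obtain x y where xy: "x \<in> keys (h - hcomp d h)" "y \<in> keys f" "a = x + y"
      using keys_mult \<open>a \<in> _\<close> by blast
    have "mdeg x \<noteq> d" using xy(1) by (auto simp: in_keys_iff lookup_minus lookup_hcomp)
    then show ?thesis using xy homogD[OF f xy(2)] by (simp add: mdeg_add)
  qed
  have "hcomp (d + e) ((h - hcomp d h) * f) = 0"
    using k by (intro poly_mapping_eqI) (auto simp: lookup_hcomp in_keys_iff)
  moreover have "hcomp d h * f \<in> homog (d + e)"
    using f unfolding homog_eq
    by (intro polys_on_mult[of _ "{a. mdeg a = d}" _ "{a. mdeg a = e}"])
      (auto simp: mdeg_add polys_on_def keys_hcomp)
  ultimately show "hcomp (d + e) (h * f) = hcomp d h * f"
    by (simp add: left_diff_distrib hcomp_minus hcomp_of_homog)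
  show "hcomp i (h * f) = 0" if "i < e"
  proof -
    have "mdeg a \<noteq> i" if "a \<in> keys (h * f)" for a
      using keys_mult[of h f] that homogD[OF f] \<open>i < e\<close> by (fastforce simp: mdeg_add)
    then show ?thesis by (intro poly_mapping_eqI) (auto simp: lookup_hcomp in_keys_iff)
  qed
qed

lemma hcomp_sum_expand:
  assumes "\<And>a. a \<in> keys f \<Longrightarrow> mdeg a \<le> n"
  shows "f = (\<Sum>d\<le>n. hcomp d f)"
proof (rule poly_mapping_eqI)
  fix a
  show "lookup f a = lookup (\<Sum>d\<le>n. hcomp d f) a"
    using assms[of a] by (auto simp: lookup_sum lookup_hcomp in_keys_iff)
qed

lemma poly_mdeg_bound:
  fixes f :: "('v::finite, 'a::field) mpoly"
  obtains n where "\<And>a. a \<in> keys f \<Longrightarrow> mdeg a \<le> n"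
proof -
  have "mdeg a \<le> Max (mdeg ` keys f)" if "a \<in> keys f" for a using that by simp
  then show ?thesis by (rule that)
qed

lemma hcomp_in_ideal:
  assumes "is_ideal J" "\<And>d. hcomp d f \<in> J"
  shows "f \<in> J"
proof -
  obtain n where "\<And>a. a \<in> keys f \<Longrightarrow> mdeg a \<le> n" using poly_mdeg_bound[of f] by blast
  then have "f = (\<Sum>d\<le>n. hcomp d f)" by (rule hcomp_sum_expand)
  then show ?thesis using assms ideal_sum by metis
qed

lemma graded_ideal_is_ideal: "graded_ideal J \<Longrightarrow> is_ideal J"
  by (simp add: graded_ideal_def)

lemma graded_hcomp: "graded_ideal J \<Longrightarrow> f \<in> J \<Longrightarrow> hcomp d f \<in> J"
  by (simp add: graded_ideal_def)

lemma graded_insert: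
  assumes J: "graded_ideal J" and f: "f \<in> homog e"
  shows "graded_ideal (ideal_gen (insert f J))"
  unfolding graded_ideal_def
proof (intro conjI ballI allI ideal_gen_ideal)
  fix g d assume "g \<in> ideal_gen (insert f J)"
  then obtain j h where g: "g = j + h * f" "j \<in> J"
    using ideal_gen_insert[OF graded_ideal_is_ideal[OF J]] by blast
  have "\<exists>h'. hcomp d (h * f) = h' * f"
  proof (cases "d < e")
    case True
    then have "hcomp d (h * f) = 0 * f" using hcomp_mult_homog(2)[OF f] by simp
    then show ?thesis by blast
  next
    case False
    then have "hcomp d (h * f) = hcomp (d - e) h * f" using hcomp_mult_homog(1)[OF f, of "d - e" h] by simp
    then show ?thesis by blast
  qed
  then show "hcomp d g \<in> ideal_gen (insert f J)"
    unfolding g(1) hcomp_add ideal_gen_insert[OF graded_ideal_is_ideal[OF J]]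
    using graded_hcomp[OF J g(2), of d] by force
qed

lemma graded_colon:
  assumes J: "graded_ideal J" and f: "f \<in> homog e"
  shows "graded_ideal (colon J f)"
  unfolding graded_ideal_def
proof (intro conjI ballI allI colon_ideal graded_ideal_is_ideal[OF J])
  fix g d assume "g \<in> colon J f"
  then have "hcomp (d + e) (g * f) \<in> J" using graded_hcomp[OF J] by (simp add: colon_def)
  then show "hcomp d g \<in> colon J f" by (simp add: colon_def hcomp_mult_homog(1)[OF f])
qed

context deg_order
begin

lemma kdim_direct_sum:
  fixes U R :: "('v, 'a::field) mpoly set"
  assumes U: "kv.subspace U" "U \<subseteq> polys_on M" and R: "kv.subspace R" "R \<subseteq> polys_on M"
    and M: "finite M" and UR: "U \<inter> R \<subseteq> {0}"
  shows "kdim {u + r | u r. u \<in> U \<and> r \<in> R} = kdim U + kdim R"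
proof -
  obtain A where A: "finite A" "kv.independent A" "A \<subseteq> U" "kv.span A = U" "card A = card (lms U)"
    using basis_lms[OF U M] by blast
  obtain B where B: "finite B" "kv.independent B" "B \<subseteq> R" "kv.span B = R" "card B = card (lms R)"
    using basis_lms[OF R M] by blast
  have disj: "A \<inter> B = {}" and ind: "kv.independent (A \<union> B)"
    using independent_Un[of A B] A B UR by auto
  have "{u + r | u r. u \<in> U \<and> r \<in> R} = kv.span (A \<union> B)"
    using A(4) B(4) by (auto simp: kv.span_Un)
  then have "kdim {u + r | u r. u \<in> U \<and> r \<in> R} = card (A \<union> B)"
    unfolding kdim_def using ind by (metis kv.dim_span_eq_card_independent)
  then show ?thesis
    using A B disj kdim_lms[OF U M] kdim_lms[OF R M] by (simp add: card_Un_disjoint)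
qed

lemma kdim_polys_on:
  "finite M \<Longrightarrow> kdim (polys_on M :: ('v, 'a::field) mpoly set) = card M"
  using kdim_lms[of "polys_on M :: ('v, 'a) mpoly set" M] by (simp add: polys_on_subspace)

lemma kdim_mono:
  fixes V W :: "('v, 'a::field) mpoly set"
  assumes "kv.subspace V" "kv.subspace W" "V \<subseteq> W" "W \<subseteq> polys_on M" "finite M"
  shows "kdim V \<le> kdim W"
proof -
  have "V \<subseteq> polys_on M" using assms by blast
  moreover have "finite (lms W)" using lms_polys_on[OF assms(4)] assms(5) finite_subset by blast
  ultimately show ?thesis
    using assms by (auto simp: kdim_lms intro!: card_mono lms_mono)
qed

text \<open>Macaulay's basis theorem inside a window: the monomials of M that are not leads of C
  span a complement of C. A common nonzero element would have a forbidden lead, and the sum realises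
  every lead in M.\<close>

lemma polys_on_complement:
  fixes C :: "('v, 'a::field) mpoly set"
  assumes C: "kv.subspace C" "C \<subseteq> polys_on M"
  shows "C \<inter> polys_on (M - lms C) \<subseteq> {0}"
    and "polys_on M = {c + t | c t. c \<in> C \<and> t \<in> polys_on (M - lms C)}" (is "_ = ?S")
proof -
  show "C \<inter> polys_on (M - lms C) \<subseteq> {0}"
  proof (rule ccontr)
    assume "\<not> C \<inter> polys_on (M - lms C) \<subseteq> {0}"
    then obtain f where f: "f \<in> C" "f \<in> polys_on (M - lms C)" "f \<noteq> 0" by blast
    then have "lead f \<in> M - lms C" using lead_keys[OF f(3)] by (auto simp: polys_on_def)
    then show False using lmsI[OF f(1,3)] by blast
  qed
  have S: "kv.subspace ?S" using C(1) polys_on_subspace by (rule kv.subspace_sums)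
  have CS: "C \<subseteq> ?S"
  proof
    fix c assume "c \<in> C"
    moreover have "c = c + 0" "0 \<in> polys_on (M - lms C)" by (auto simp: polys_on_def)
    ultimately show "c \<in> ?S" by blast
  qed
  have TS: "polys_on (M - lms C) \<subseteq> ?S"
  proof
    fix t :: "('v, 'a) mpoly" assume "t \<in> polys_on (M - lms C)"
    moreover have "t = 0 + t" "0 \<in> C" using C(1) by (auto simp: kv.subspace_def)
    ultimately show "t \<in> ?S" by blast
  qed
  have SM: "?S \<subseteq> polys_on M"
    using C(2) polys_on_mono[of "M - lms C" M, where ?'b = 'a]
      kv.subspace_add[OF polys_on_subspace[of M]] by blast
  have "M \<subseteq> lms ?S"
  proof -
    have "lms C \<subseteq> lms ?S" "M - lms C \<subseteq> lms ?S"
      using lms_mono[OF CS] lms_mono[OF TS] by auto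
    then show ?thesis by blast
  qed
  then have "?S = polys_on M"
    by (intro subspace_eq_lms S SM polys_on_subspace) simp
  then show "polys_on M = ?S" by simp
qed

text \<open>The leads of the products are the leads of V translated by \<open>lead f\<close>, so
  their number is unchanged.\<close>

lemma kdim_mult:
  fixes V :: "('v, 'a::field) mpoly set"
  assumes V: "kv.subspace V" "V \<subseteq> polys_on N" "finite N" and f: "f \<noteq> 0"
    and M: "(\<lambda>h. h * f) ` V \<subseteq> polys_on M" "finite M"
  shows "kv.subspace ((\<lambda>h. h * f) ` V)" and "kdim ((\<lambda>h. h * f) ` V) = kdim V"
proof -
  show sub: "kv.subspace ((\<lambda>h. h * f) ` V)"
    unfolding kv.subspace_def
  proof (intro conjI ballI allI)
    show "0 \<in> (\<lambda>h. h * f) ` V" using V(1) by (auto simp: kv.subspace_def intro!: image_eqI[of _ _ 0])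
  next
    fix x y assume "x \<in> (\<lambda>h. h * f) ` V" "y \<in> (\<lambda>h. h * f) ` V"
    then show "x + y \<in> (\<lambda>h. h * f) ` V"
      using kv.subspace_add[OF V(1)] by (auto simp: distrib_right[symmetric])
  next
    fix c x assume "x \<in> (\<lambda>h. h * f) ` V"
    then show "kscale c x \<in> (\<lambda>h. h * f) ` V"
      using kv.subspace_scale[OF V(1)] by (auto simp: kscale_eq mult.assoc[symmetric])
  qed
  have "lms ((\<lambda>h. h * f) ` V) = (\<lambda>a. a + lead f) ` lms V"
  proof (intro subset_antisym subsetI)
    fix a assume "a \<in> lms ((\<lambda>h. h * f) ` V)"
    then obtain h where h: "h \<in> V" "h * f \<noteq> 0" "lead (h * f) = a" by (auto simp: lms_def)
    then have "h \<noteq> 0" by auto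
    then show "a \<in> (\<lambda>a. a + lead f) ` lms V" using h f lmsI[of h V] by (auto simp: lead_mult)
  next
    fix a assume "a \<in> (\<lambda>a. a + lead f) ` lms V"
    then obtain h where h: "h \<in> V" "h \<noteq> 0" "a = lead h + lead f" by (auto elim: lmsE)
    then show "a \<in> lms ((\<lambda>h. h * f) ` V)"
      using f mult_nz[of h f] lead_mult[of h f] lmsI[of "h * f" "(\<lambda>h. h * f) ` V"] by auto
  qed
  then have "card (lms ((\<lambda>h. h * f) ` V)) = card (lms V)"
    by (simp add: card_image inj_on_def)
  then show "kdim ((\<lambda>h. h * f) ` V) = kdim V"
    using kdim_lms[OF sub M] kdim_lms[OF V] by simp
qed

text \<open>The exact sequence 0 \<rightarrow> S/(J:f) \<rightarrow> S/J \<rightarrow> S/(J,f) \<rightarrow> 0, cut down to two finite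
  windows N and M of monomials with f S_N contained in S_M.\<close>

lemma colon_kdim:
  fixes J :: "('v, 'a::field) mpoly set"
  assumes J: "is_ideal J" and f: "f \<noteq> 0" and M: "finite M" and N: "finite N"
    and NM: "\<And>h. h \<in> polys_on N \<Longrightarrow> h * f \<in> polys_on M"
  defines "W \<equiv> {j + h * f | j h. j \<in> J \<inter> polys_on M \<and> h \<in> polys_on N}"
  shows "kv.subspace W" and "W \<subseteq> ideal_gen (insert f J) \<inter> polys_on M"
    and "kdim W + kdim (colon J f \<inter> polys_on N) = kdim (J \<inter> polys_on M) + card N"
proof -
  define C where "C = colon J f \<inter> polys_on N"
  \<comment> \<open>T is a complement of the window of (J:f), so multiplication by f is injective on
    T even modulo J; W is then the direct sum of U and R.\<close>
  define T where "T = (polys_on (N - lms C) :: ('v, 'a) mpoly set)"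
  define R where "R = (\<lambda>h. h * f) ` T"
  define U where "U = J \<inter> polys_on M"
  have C: "kv.subspace C" "C \<subseteq> polys_on N"
    unfolding C_def using subspace_window[OF colon_ideal[OF J]] by auto
  have U: "kv.subspace U" "U \<subseteq> polys_on M"
    unfolding U_def using subspace_window[OF J] by auto
  have TN: "T \<subseteq> polys_on N" unfolding T_def by (auto simp: polys_on_def)
  have T: "kv.subspace T" unfolding T_def by (rule polys_on_subspace)
  have RM: "R \<subseteq> polys_on M" unfolding R_def using TN NM by blast
  have R: "kv.subspace R" "kdim R = kdim T"
    using kdim_mult[OF T TN N f, of M] RM M by (auto simp: R_def)
  have UR: "U \<inter> R \<subseteq> {0}"
  proof
    fix g assume "g \<in> U \<inter> R"
    then obtain h where h: "h \<in> T" "g = h * f" "g \<in> J" by (auto simp: U_def R_def)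
    then have "h \<in> C" using TN by (auto simp: C_def colon_def)
    then have "h = 0" using polys_on_complement(1)[OF C] h(1) by (auto simp: T_def)
    then show "g \<in> {0}" using h by simp
  qed
  have W: "W = {u + r | u r. u \<in> U \<and> r \<in> R}"
  proof (intro subset_antisym subsetI)
    fix g assume "g \<in> W"
    then obtain j h where g: "g = j + h * f" "j \<in> U" "h \<in> polys_on N" by (auto simp: W_def U_def)
    then obtain c t where ct: "h = c + t" "c \<in> C" "t \<in> T"
      using polys_on_complement(2)[OF C] by (auto simp: T_def)
    have "c * f \<in> U" using ct(2) NM by (auto simp: U_def C_def colon_def)
    then have "j + c * f \<in> U" using kv.subspace_add[OF U(1) g(2)] by simp
    moreover have "g = (j + c * f) + t * f" by (simp add: g ct algebra_simps)
    ultimately show "g \<in> {u + r | u r. u \<in> U \<and> r \<in> R}" using ct(3) by (auto simp: R_def)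
  next
    fix g assume "g \<in> {u + r | u r. u \<in> U \<and> r \<in> R}"
    then show "g \<in> W" using TN by (auto simp: W_def U_def R_def)
  qed
  show "kv.subspace W" unfolding W by (rule kv.subspace_sums[OF U(1) R(1)])
  show "W \<subseteq> ideal_gen (insert f J) \<inter> polys_on M"
    unfolding W_def ideal_gen_insert[OF J]
    using NM kv.subspace_add[OF polys_on_subspace[of M]] by blast
  have lC: "lms C \<subseteq> N" by (rule lms_polys_on[OF C(2)])
  have "kdim W = kdim U + kdim T"
    unfolding W using kdim_direct_sum[OF U R(1) RM M UR] R(2) by simp
  moreover have "kdim T = card N - card (lms C)"
    unfolding T_def using N lC by (simp add: kdim_polys_on card_Diff_subset finite_subset)
  moreover have "kdim C = card (lms C)" using kdim_lms[OF C N] .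
  moreover have "card (lms C) \<le> card N" using lC N by (rule card_mono[rotated])
  ultimately show "kdim W + kdim (colon J f \<inter> polys_on N) = kdim (J \<inter> polys_on M) + card N"
    by (simp add: C_def U_def)
qed

text \<open>The Hilbert function of J when J is graded (\<open>hilbert_fun_scount\<close>).\<close>

definition scount :: "('v, 'a::field) mpoly set \<Rightarrow> nat \<Rightarrow> nat" where
  "scount J d = card ({a. mdeg a = d} - lms J)"

text \<open>The affine Hilbert function: the dimension of the polynomials of degree at most d modulo
  those in J, for any ideal J.\<close>

definition ccount :: "('v, 'a::field) mpoly set \<Rightarrow> nat \<Rightarrow> nat" where
  "ccount J d = card ({a. mdeg a \<le> d} - lms J)"

text \<open>Here the order has to refine the degree: a lead of degree at most d bounds the degrees
  of all other terms.\<close>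

lemma lms_le_window:
  "lms (J \<inter> polys_on {a. mdeg a \<le> d} :: ('v, 'a::field) mpoly set) = lms J \<inter> {a. mdeg a \<le> d}"
proof (intro subset_antisym subsetI)
  fix a assume "a \<in> lms J \<inter> {a. mdeg a \<le> d}"
  then obtain f where f: "f \<in> J" "f \<noteq> 0" "lead f = a" "mdeg a \<le> d" by (auto elim: lmsE)
  then have "f \<in> polys_on {a. mdeg a \<le> d}"
    using deg[OF lead_max[OF f(2)]] by (fastforce simp: polys_on_def)
  then show "a \<in> lms (J \<inter> polys_on {a. mdeg a \<le> d})" using f lmsI by blast
next
  fix a assume "a \<in> lms (J \<inter> polys_on {a. mdeg a \<le> d} :: ('v, 'a) mpoly set)"
  then show "a \<in> lms J \<inter> {a. mdeg a \<le> d}"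
    using lms_mono[of "J \<inter> polys_on {a. mdeg a \<le> d}" J]
      lms_polys_on[of "J \<inter> polys_on {a. mdeg a \<le> d}" "{a. mdeg a \<le> d}"] by blast
qed

text \<open>The component of f in the degree of its lead keeps that lead, and gradedness keeps it in
  J.\<close>

lemma lms_eq_window:
  fixes J :: "('v, 'a::field) mpoly set"
  assumes J: "graded_ideal J"
  shows "lms (J \<inter> polys_on {a. mdeg a = d}) = lms J \<inter> {a. mdeg a = d}"
proof (intro subset_antisym subsetI)
  fix a assume "a \<in> lms J \<inter> {a. mdeg a = d}"
  then obtain f where f: "f \<in> J" "f \<noteq> 0" "lead f = a" "mdeg a = d" by (auto elim: lmsE)
  have k: "keys (hcomp d f) = {b \<in> keys f. mdeg b = d}" by (rule keys_hcomp)
  then have "a \<in> keys (hcomp d f)" using lead_keys[OF f(2)] f by simp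
  then have "hcomp d f \<noteq> 0" "lead (hcomp d f) = a"
    using k lead_max[OF f(2)] f(3) lead_eqI[of a "hcomp d f"] by auto
  moreover have "hcomp d f \<in> J \<inter> polys_on {a. mdeg a = d}"
    using graded_hcomp[OF J f(1)] hcomp_homog[of d f] by (simp add: homog_eq)
  ultimately show "a \<in> lms (J \<inter> polys_on {a. mdeg a = d})" using lmsI by metis
next
  fix a assume "a \<in> lms (J \<inter> polys_on {a. mdeg a = d})"
  then show "a \<in> lms J \<inter> {a. mdeg a = d}"
    using lms_mono[of "J \<inter> polys_on {a. mdeg a = d}" J]
      lms_polys_on[of "J \<inter> polys_on {a. mdeg a = d}" "{a. mdeg a = d}"] by blast
qed

lemma kdim_le_window:
  fixes J :: "('v, 'a::field) mpoly set"
  assumes "is_ideal J"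
  shows "kdim (J \<inter> polys_on {a. mdeg a \<le> d}) + ccount J d = card {a :: 'v \<Rightarrow>\<^sub>0 nat. mdeg a \<le> d}"
proof -
  have "kdim (J \<inter> polys_on {a. mdeg a \<le> d}) = card (lms J \<inter> {a. mdeg a \<le> d})"
    unfolding lms_le_window[symmetric]
    by (rule kdim_lms[OF _ _ finite_mdeg_le[of d]])
      (auto intro!: subspace_window assms)
  moreover have "card {a :: 'v \<Rightarrow>\<^sub>0 nat. mdeg a \<le> d} = card ({a. mdeg a \<le> d} \<inter> lms J) + ccount J d"
    unfolding ccount_def by (rule card_Int_Diff[OF finite_mdeg_le])
  ultimately show ?thesis by (simp add: Int_commute)
qed

lemma kdim_eq_window:
  fixes J :: "('v, 'a::field) mpoly set"
  assumes "graded_ideal J"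
  shows "kdim (J \<inter> polys_on {a. mdeg a = d}) + scount J d = card {a :: 'v \<Rightarrow>\<^sub>0 nat. mdeg a = d}"
proof -
  have "kdim (J \<inter> polys_on {a. mdeg a = d}) = card (lms J \<inter> {a. mdeg a = d})"
    unfolding lms_eq_window[OF assms, symmetric]
    by (rule kdim_lms[OF _ _ finite_mdeg_eq[of d]])
      (auto intro!: subspace_window graded_ideal_is_ideal assms)
  moreover have "card {a :: 'v \<Rightarrow>\<^sub>0 nat. mdeg a = d} = card ({a. mdeg a = d} \<inter> lms J) + scount J d"
    unfolding scount_def by (rule card_Int_Diff[OF finite_mdeg_eq])
  ultimately show ?thesis by (simp add: Int_commute)
qed

lemma hilbert_fun_scount:
  fixes J :: "('v, 'a::field) mpoly set"
  assumes "graded_ideal J"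
  shows "hilbert_fun J d = scount J d"
  using kdim_eq_window[OF assms, of d]
  by (simp add: hilbert_fun_def homog_eq kdim_polys_on[OF finite_mdeg_eq])

text \<open>Only an inequality: an element of (J,f) of degree at most d + e need not be j + h f with
  j and h in the two windows, since top terms may cancel.\<close>

lemma ccount_colon:
  fixes J :: "('v, 'a::field) mpoly set"
  assumes J: "is_ideal J" and f: "f \<noteq> 0" and e: "\<And>a. a \<in> keys f \<Longrightarrow> mdeg a \<le> e"
  shows "ccount (ideal_gen (insert f J)) (d + e) + ccount (colon J f) d \<le> ccount J (d + e)"
proof -
  let ?M = "{a :: 'v \<Rightarrow>\<^sub>0 nat. mdeg a \<le> d + e}" and ?N = "{a :: 'v \<Rightarrow>\<^sub>0 nat. mdeg a \<le> d}"
  define W where "W = {j + h * f | j h. j \<in> J \<inter> polys_on ?M \<and> h \<in> polys_on ?N}"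
  have NM: "h * f \<in> polys_on ?M" if "h \<in> polys_on ?N" for h
    using that e by (intro polys_on_mult[of h ?N f "keys f"]) (auto simp: polys_on_def mdeg_add add_mono)
  have c: "kv.subspace W" "W \<subseteq> ideal_gen (insert f J) \<inter> polys_on ?M"
    "kdim W + kdim (colon J f \<inter> polys_on ?N) = kdim (J \<inter> polys_on ?M) + card ?N"
    unfolding W_def
    by (rule colon_kdim[OF J f finite_mdeg_le finite_mdeg_le], erule NM)+
  have "kdim W \<le> kdim (ideal_gen (insert f J) \<inter> polys_on ?M)"
    by (rule kdim_mono[OF c(1) _ c(2) _ finite_mdeg_le[of "d + e"]])
      (auto intro!: subspace_window ideal_gen_ideal)
  then show ?thesis
    using c(3) kdim_le_window[OF J, of "d + e"] kdim_le_window[OF colon_ideal[OF J], of f d]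
      kdim_le_window[OF ideal_gen_ideal, of "insert f J" "d + e"] by linarith
qed

text \<open>Components of j + h f can be taken separately in the graded case, so W is the whole
  window of (J,f) and equality holds.\<close>

lemma scount_colon:
  fixes J :: "('v, 'a::field) mpoly set"
  assumes J: "graded_ideal J" and f: "f \<noteq> 0" "f \<in> homog e"
  shows "scount (ideal_gen (insert f J)) (d + e) + scount (colon J f) d = scount J (d + e)"
    and "i < e \<Longrightarrow> scount (ideal_gen (insert f J)) i = scount J i"
proof -
  let ?M = "{a :: 'v \<Rightarrow>\<^sub>0 nat. mdeg a = d + e}" and ?N = "{a :: 'v \<Rightarrow>\<^sub>0 nat. mdeg a = d}"
  note J' = graded_ideal_is_ideal[OF J]
  define W where "W = {j + h * f | j h. j \<in> J \<inter> polys_on ?M \<and> h \<in> polys_on ?N}"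
  have NM: "h * f \<in> polys_on ?M" if "h \<in> polys_on ?N" for h
    using that homogD[OF f(2)]
    by (intro polys_on_mult[of h ?N f "keys f"]) (auto simp: polys_on_def mdeg_add)
  have c: "W \<subseteq> ideal_gen (insert f J) \<inter> polys_on ?M"
    "kdim W + kdim (colon J f \<inter> polys_on ?N) = kdim (J \<inter> polys_on ?M) + card ?N"
    unfolding W_def
    by (rule colon_kdim[OF J' f(1) finite_mdeg_eq finite_mdeg_eq], erule NM)+
  have "ideal_gen (insert f J) \<inter> polys_on ?M \<subseteq> W"
  proof
    fix g assume g: "g \<in> ideal_gen (insert f J) \<inter> polys_on ?M"
    then obtain j h where jh: "g = j + h * f" "j \<in> J" using ideal_gen_insert[OF J'] by blast
    have "g = hcomp (d + e) g" using g hcomp_of_homog[of g "d + e"] by (simp add: homog_eq)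
    then have "g = hcomp (d + e) j + hcomp d h * f"
      unfolding jh(1) hcomp_add hcomp_mult_homog(1)[OF f(2)] .
    moreover have "hcomp (d + e) j \<in> J \<inter> polys_on ?M" "hcomp d h \<in> polys_on ?N"
      using graded_hcomp[OF J jh(2)] hcomp_homog by (auto simp: homog_eq[symmetric])
    ultimately show "g \<in> W" unfolding W_def by blast
  qed
  then have "W = ideal_gen (insert f J) \<inter> polys_on ?M" using c(1) by blast
  note c(2)[unfolded this]
  then show "scount (ideal_gen (insert f J)) (d + e) + scount (colon J f) d = scount J (d + e)"
    using kdim_eq_window[OF J, of "d + e"] kdim_eq_window[OF graded_colon[OF J f(2)], of d]
      kdim_eq_window[OF graded_insert[OF J f(2)], of "d + e"] by linarith
  assume i: "i < e"
  have "ideal_gen (insert f J) \<inter> homog i = J \<inter> homog i"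
  proof (intro subset_antisym subsetI)
    fix g assume g: "g \<in> ideal_gen (insert f J) \<inter> homog i"
    then obtain j h where jh: "g = j + h * f" "j \<in> J" using ideal_gen_insert[OF J'] by blast
    have "g = hcomp i g" using g hcomp_of_homog[of g i] by simp
    then have "g = hcomp i j" unfolding jh(1) hcomp_add hcomp_mult_homog(2)[OF f(2) i] by simp
    then show "g \<in> J \<inter> homog i" using graded_hcomp[OF J jh(2)] g by auto
  next
    fix g assume "g \<in> J \<inter> homog i"
    then show "g \<in> ideal_gen (insert f J) \<inter> homog i" using ideal_gen_superset by blast
  qed
  then show "scount (ideal_gen (insert f J)) i = scount J i"
    using kdim_eq_window[OF J, of i] kdim_eq_window[OF graded_insert[OF J f(2)], of i]
    by (simp add: homog_eq)
qed

lemma ccount_sum: "ccount J d = (\<Sum>i\<le>d. scount J i)"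
proof -
  have "{a. mdeg a \<le> d} - lms J = (\<Union>i\<le>d. {a. mdeg a = i} - lms J)" by auto
  then have "ccount J d = card (\<Union>i\<le>d. {a. mdeg a = i} - lms J)" by (simp add: ccount_def)
  also have "\<dots> = (\<Sum>i\<le>d. card ({a. mdeg a = i} - lms J))"
    by (rule card_UN_disjoint) (auto intro: finite_mdeg_eq)
  finally show ?thesis by (simp add: scount_def)
qed

end

section \<open>Complements of upward closed sets of monomials\<close>

definition upset :: "('v \<Rightarrow>\<^sub>0 nat) set \<Rightarrow> bool" where
  "upset E \<longleftrightarrow> (\<forall>a\<in>E. \<forall>b. a + b \<in> E)"

lemma upsetD: "upset E \<Longrightarrow> a \<in> E \<Longrightarrow> a + b \<in> E"
  by (simp add: upset_def)

lemma monomial_diff: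
  fixes a b :: "'v \<Rightarrow>\<^sub>0 nat"
  assumes "\<And>v. lookup a v \<le> lookup b v"
  shows "a + (b - a) = b"
  using assms by (intro poly_mapping_eqI) (simp add: lookup_add lookup_minus)

text \<open>A subsequence monotone in every coordinate is found one variable at a time; its first
  two terms are then comparable.\<close>

lemma Dickson:
  fixes f :: "nat \<Rightarrow> ('v::finite \<Rightarrow>\<^sub>0 nat)"
  shows "\<exists>i j c. i < j \<and> f j = f i + c"
proof -
  have "\<exists>g :: nat \<Rightarrow> nat. strict_mono g \<and> (\<forall>v\<in>X. mono (\<lambda>n. lookup (f (g n)) v))" if "finite X" for X
    using that
  proof (induction X)
    case empty
    then show ?case by (auto intro: exI[of _ id] simp: strict_mono_def)
  next
    case (insert v X)
    then obtain g :: "nat \<Rightarrow> nat" where g: "strict_mono g" "\<forall>v\<in>X. mono (\<lambda>n. lookup (f (g n)) v)" by blast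
    define s where "s n = lookup (f (g n)) v" for n
    obtain h where h: "strict_mono h" "monoseq (\<lambda>n. s (h n))" using seq_monosub by blast
    \<comment> \<open>The monotone subsequence may be decreasing; in the naturals it is then
      constant from the index N of its minimum on.\<close>
    have "\<exists>N. mono (\<lambda>n. s (h (n + N)))"
    proof (cases "incseq (\<lambda>n. s (h n))")
      case True
      then show ?thesis by (auto intro!: exI[of _ 0])
    next
      case False
      then have dec: "decseq (\<lambda>n. s (h n))" using h(2) by (simp add: monoseq_iff)
      define N where "N = arg_min (\<lambda>n. s (h n)) (\<lambda>_. True)"
      have "s (h N) \<le> s (h n)" for n
        unfolding N_def using arg_min_nat_lemma[of "\<lambda>_. True" n "\<lambda>n. s (h n)"] by blast
      then have "s (h (n + N)) = s (h N)" for n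
        using dec by (intro antisym) (simp_all add: decseq_def)
      then have "mono (\<lambda>n. s (h (n + N)))" by (simp add: mono_def)
      then show ?thesis by blast
    qed
    then obtain N where N: "mono (\<lambda>n. s (h (n + N)))" by blast
    define h' where "h' n = h (n + N)" for n
    have h': "strict_mono h'" using h(1) by (simp add: strict_mono_def h'_def)
    have "mono (\<lambda>n. lookup (f ((g \<circ> h') n)) w)" if "w \<in> insert v X" for w
    proof (cases "w = v")
      case True
      then show ?thesis using N by (simp add: s_def h'_def)
    next
      case False
      then have "mono (\<lambda>n. lookup (f (g n)) w)" using g(2) that by blast
      then show ?thesis using h' by (simp add: mono_def strict_mono_less_eq)
    qed
    moreover have "strict_mono (g \<circ> h')" using g(1) h' by (simp add: strict_mono_def)
    ultimately show ?case by blast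
  qed
  from this[OF finite_UNIV] obtain g :: "nat \<Rightarrow> nat" where g: "strict_mono g"
    and m: "\<And>v. mono (\<lambda>n. lookup (f (g n)) v)" by blast
  have "f (g 1) = f (g 0) + (f (g 1) - f (g 0))"
    by (rule monomial_diff[symmetric]) (use m in \<open>simp add: mono_def\<close>)
  moreover have "g 0 < g 1" using g by (simp add: strict_mono_def)
  ultimately show ?thesis by blast
qed

text \<open>Ascending chain condition for up-sets: a strictly increasing sequence would provide
  elements a n of S (n + 1) outside S n, and Dickson finds one that divides a later one.\<close>

lemma upset_maximal:
  fixes EE :: "('v::finite \<Rightarrow>\<^sub>0 nat) set set"
  assumes "EE \<noteq> {}" and up: "\<And>E. E \<in> EE \<Longrightarrow> upset E"
  obtains E where "E \<in> EE" "\<And>E'. E' \<in> EE \<Longrightarrow> E \<subseteq> E' \<Longrightarrow> E' = E"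
proof (rule ccontr)
  assume no: "\<not> thesis"
  have step: "\<And>E n. E \<in> EE \<Longrightarrow> \<exists>E'. E' \<in> EE \<and> E \<subset> E'" using that no by blast
  have "\<exists>S. \<forall>n. S n \<in> EE \<and> S n \<subset> S (Suc n)"
    by (rule dependent_nat_choice[of "\<lambda>_ E. E \<in> EE" "\<lambda>_ E E'. E \<subset> E'"]) (use assms(1) step in blast)+
  then obtain S :: "nat \<Rightarrow> ('v \<Rightarrow>\<^sub>0 nat) set" where S: "\<And>n. S n \<in> EE" "\<And>n. S n \<subset> S (Suc n)" by blast
  have mono: "S i \<subseteq> S j" if "i \<le> j" for i j
    using lift_Suc_mono_le[of S, OF _ that] S(2) by blast
  have "\<forall>n. \<exists>a. a \<in> S (Suc n) \<and> a \<notin> S n" using S(2) by blast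
  then obtain a where a: "\<And>n. a n \<in> S (Suc n) \<and> a n \<notin> S n" by metis
  obtain i j c where ij: "i < j" "a j = a i + c" using Dickson by blast
  have "a i \<in> S j" using a[of i] mono[of "Suc i" j] ij(1) by auto
  then have "a j \<in> S j" unfolding ij(2) using up[OF S(1)] by (rule upsetD[rotated])
  then show False using a by blast
qed

text \<open>The pair (b, A) encodes b + N^A.\<close>

definition cone :: "('v \<Rightarrow>\<^sub>0 nat) \<times> 'v set \<Rightarrow> ('v \<Rightarrow>\<^sub>0 nat) set" where
  "cone p = {a. \<forall>v. lookup (fst p) v \<le> lookup a v \<and> (v \<notin> snd p \<longrightarrow> lookup a v = lookup (fst p) v)}"

text \<open>The set V of variables in play serves the induction; later uses take
  \<open>V = UNIV\<close>.\<close>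

definition decomp :: "'v set \<Rightarrow> ('v \<Rightarrow>\<^sub>0 nat) set \<Rightarrow> (('v \<Rightarrow>\<^sub>0 nat) \<times> 'v set) set \<Rightarrow> bool" where
  "decomp V E F \<longleftrightarrow> finite F \<and> (\<Union>p\<in>F. cone p) = {a. keys a \<subseteq> V \<and> a \<notin> E}
    \<and> (\<forall>p\<in>F. \<forall>q\<in>F. p \<noteq> q \<longrightarrow> cone p \<inter> cone q = {})"

lemma cone_self: "fst p \<in> cone p"
  by (simp add: cone_def)

lemma cone_add: "keys c \<subseteq> snd p \<Longrightarrow> fst p + c \<in> cone p"
  by (auto simp: cone_def lookup_add in_keys_iff)

text \<open>Slicing along one variable; the slices form an increasing sequence of up-sets, hence are
  eventually constant.\<close>

lemma decomp_exists:
  fixes E :: "('v::finite \<Rightarrow>\<^sub>0 nat) set"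
  assumes "upset E"
  shows "\<exists>F. decomp V E F"
  using finite[of V] assms
proof (induction V arbitrary: E)
  case empty
  show ?case
  proof (cases "0 \<in> E")
    case True
    then have "{a. keys a \<subseteq> {} \<and> a \<notin> E} = {}" by auto
    then show ?thesis by (auto simp: decomp_def intro!: exI[of _ "{}"])
  next
    case False
    have "cone (0, {}) = {a. keys a \<subseteq> {} \<and> a \<notin> E}"
    proof (intro subset_antisym subsetI)
      fix a :: "'v \<Rightarrow>\<^sub>0 nat" assume "a \<in> cone (0, {})"
      then have "a = 0" by (intro poly_mapping_eqI) (simp add: cone_def)
      then show "a \<in> {a. keys a \<subseteq> {} \<and> a \<notin> E}" using False by simp
    qed (simp add: cone_def)
    then show ?thesis by (auto simp: decomp_def intro!: exI[of _ "{(0, {})}"])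
  qed
next
  case (insert x V)
  define En where "En n = {a. a + Poly_Mapping.single x n \<in> E}" for n
  have up: "upset (En n)" for n
    unfolding upset_def En_def
  proof (intro ballI allI CollectI)
    fix a b assume "a \<in> {a. a + Poly_Mapping.single x n \<in> E}"
    then have "(a + Poly_Mapping.single x n) + b \<in> E" using insert.prems by (auto simp: upset_def)
    then show "a + b + Poly_Mapping.single x n \<in> E" by (simp add: add_ac)
  qed
  have mono: "En n \<subseteq> En (n + m)" for n m
  proof
    fix a assume "a \<in> En n"
    then have "a + Poly_Mapping.single x n + Poly_Mapping.single x m \<in> E"
      using insert.prems by (simp add: En_def upset_def)
    then show "a \<in> En (n + m)" by (simp add: En_def single_add add.assoc)
  qed
  obtain n0 where n0: "\<And>E'. E' \<in> range En \<Longrightarrow> En n0 \<subseteq> E' \<Longrightarrow> E' = En n0"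
    using upset_maximal[of "range En"] up by (metis empty_not_UNIV image_is_empty rangeE)
  have stab: "En n = En n0" if "n0 \<le> n" for n
    using n0[of "En n"] mono[of n0 "n - n0"] that by simp
  have "\<forall>n. \<exists>F. decomp V (En n) F" using insert.IH up by blast
  then obtain F where F: "\<And>n. decomp V (En n) (F n)" by metis
  \<comment> \<open>A slice with n < n0 is lifted to exponent exactly n of x. At n0 the direction x
    becomes free, since all later slices equal that one; \<open>idx\<close> and \<open>rm\<close>
    recover the slice and the point in it.\<close>
  define T where "T n p = (fst p + Poly_Mapping.single x n, if n = n0 then insert x (snd p) else snd p)"
    for n and p :: "('v \<Rightarrow>\<^sub>0 nat) \<times> 'v set"
  define idx where "idx a = min (lookup a x) n0" for a :: "'v \<Rightarrow>\<^sub>0 nat"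
  define rm where "rm a = a - Poly_Mapping.single x (lookup a x)" for a :: "'v \<Rightarrow>\<^sub>0 nat"
  have rm: "lookup (rm a) v = (if v = x then 0 else lookup a v)" for a v
    by (simp add: rm_def lookup_minus lookup_single when_def)
  have rm_eq: "rm a + Poly_Mapping.single x (lookup a x) = a" for a
    by (intro poly_mapping_eqI) (simp add: lookup_add rm lookup_single when_def)
  have rm_keys: "keys (rm a) \<subseteq> V \<longleftrightarrow> keys a \<subseteq> insert x V" for a
    by (auto simp: in_keys_iff rm subset_iff)
  have FV: "x \<notin> snd p" "lookup (fst p) x = 0" if "p \<in> F n" for p n
  proof -
    have cV: "keys a \<subseteq> V" if "a \<in> cone p" for a
      using F[of n] \<open>p \<in> F n\<close> that by (auto simp: decomp_def)
    show "lookup (fst p) x = 0"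
      using cV[OF cone_self] insert.hyps(2) by (meson in_keys_iff subsetD)
    show "x \<notin> snd p"
    proof
      assume "x \<in> snd p"
      then have "keys (fst p + Poly_Mapping.single x 1) \<subseteq> V" by (intro cV cone_add) simp
      moreover have "x \<in> keys (fst p + Poly_Mapping.single x 1)" by (simp add: in_keys_iff lookup_add)
      ultimately show False using insert.hyps(2) by blast
    qed
  qed
  have T: "a \<in> cone (T n p) \<longleftrightarrow> idx a = n \<and> rm a \<in> cone p" if "p \<in> F n" "n \<le> n0" for a n p
  proof
    assume a: "a \<in> cone (T n p)"
    then have ax: "n \<le> lookup a x" "n \<noteq> n0 \<Longrightarrow> lookup a x = n"
      using FV[OF that(1)] unfolding cone_def T_def
      by (auto simp: lookup_add dest!: spec[of _ x])
    have "lookup (fst p) v \<le> lookup (rm a) v \<and> (v \<notin> snd p \<longrightarrow> lookup (rm a) v = lookup (fst p) v)" for v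
      using a FV[OF that(1)] unfolding cone_def T_def
      by (cases "v = x") (auto simp: rm lookup_add lookup_single when_def split: if_splits dest!: spec[of _ v])
    then show "idx a = n \<and> rm a \<in> cone p"
      using ax that(2) unfolding cone_def idx_def by (cases "n = n0") auto
  next
    assume a: "idx a = n \<and> rm a \<in> cone p"
    show "a \<in> cone (T n p)"
      unfolding cone_def
    proof (intro CollectI allI)
      fix v
      have "lookup (fst p) v \<le> lookup (rm a) v \<and> (v \<notin> snd p \<longrightarrow> lookup (rm a) v = lookup (fst p) v)"
        using a by (auto simp: cone_def)
      then show "lookup (fst (T n p)) v \<le> lookup a v
          \<and> (v \<notin> snd (T n p) \<longrightarrow> lookup a v = lookup (fst (T n p)) v)"
        using a FV[OF that(1)]
        by (cases "v = x") (auto simp: T_def lookup_add lookup_single when_def rm idx_def)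
    qed
  qed
  define G where "G = (\<Union>n\<le>n0. T n ` F n)"
  have "finite G" using F by (simp add: G_def decomp_def)
  moreover have "(\<Union>p\<in>G. cone p) = {a. keys a \<subseteq> insert x V \<and> a \<notin> E}"
  proof (rule set_eqI)
    fix a
    have "a \<in> (\<Union>p\<in>G. cone p) \<longleftrightarrow> (\<exists>n\<le>n0. \<exists>p\<in>F n. a \<in> cone (T n p))"
      by (auto simp: G_def)
    also have "\<dots> \<longleftrightarrow> (\<exists>p\<in>F (idx a). rm a \<in> cone p)"
      using T by (metis idx_def min.cobounded2)
    also have "\<dots> \<longleftrightarrow> rm a \<in> (\<Union>p\<in>F (idx a). cone p)" by blast
    also have "\<dots> \<longleftrightarrow> keys (rm a) \<subseteq> V \<and> rm a \<notin> En (idx a)"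
      using F[of "idx a"] by (simp add: decomp_def)
    also have "En (idx a) = En (lookup a x)"
      using stab[of "lookup a x"] by (simp add: idx_def min_def)
    finally show "a \<in> (\<Union>p\<in>G. cone p) \<longleftrightarrow> a \<in> {a. keys a \<subseteq> insert x V \<and> a \<notin> E}"
      using rm_keys rm_eq by (simp add: En_def)
  qed
  moreover have "cone p \<inter> cone q = {}" if pq: "p \<in> G" "q \<in> G" "p \<noteq> q" for p q
  proof (rule ccontr)
    assume "cone p \<inter> cone q \<noteq> {}"
    then obtain a where a: "a \<in> cone p" "a \<in> cone q" by blast
    obtain n s where s: "p = T n s" "s \<in> F n" "n \<le> n0" using pq(1) by (auto simp: G_def)
    obtain m t where t: "q = T m t" "t \<in> F m" "m \<le> n0" using pq(2) by (auto simp: G_def)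
    have "n = m" "rm a \<in> cone s \<inter> cone t" using a T[OF s(2,3)] T[OF t(2,3)] s t by auto
    then have "s = t" using F[of n] s t unfolding decomp_def by blast
    then show False using pq(3) s t \<open>n = m\<close> by simp
  qed
  ultimately have "decomp (insert x V) E G" unfolding decomp_def by blast
  then show ?case by blast
qed

section \<open>Counting monomials and the growth of cones\<close>

definition mons :: "'v::finite set \<Rightarrow> nat \<Rightarrow> ('v \<Rightarrow>\<^sub>0 nat) set" where
  "mons A m = {c. keys c \<subseteq> A \<and> mdeg c = m}"

lemma finite_mons: "finite (mons A m)"
  by (rule finite_subset[OF _ finite_mdeg_eq[of m]]) (auto simp: mons_def)

text \<open>Stars and bars: splitting off the exponent m - j of one variable leaves a hockey-stick
  sum.\<close>

lemma card_mons:
  assumes "A \<noteq> {}"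
  shows "card (mons A m) = (card A - 1 + m) choose (card A - 1)"
  using finite[of A] assms
proof (induction A arbitrary: m rule: finite_ne_induct)
  case (singleton v)
  have "mons {v} m = {Poly_Mapping.single v m}"
  proof (intro subset_antisym subsetI)
    fix c assume "c \<in> mons {v} m"
    then have c: "keys c \<subseteq> {v}" "mdeg c = m" by (auto simp: mons_def)
    have 1: "c = Poly_Mapping.single v (lookup c v)"
      using c(1) by (intro poly_mapping_eqI) (auto simp: lookup_single when_def in_keys_iff)
    then have "m = lookup c v" using c(2) mdeg_single by metis
    then show "c \<in> {Poly_Mapping.single v m}" using 1 by simp
  qed (auto simp: mons_def)
  then show ?case by simp
next
  case (insert v A)
  have k: "keys (c + Poly_Mapping.single v i) \<subseteq> insert v A" if "keys c \<subseteq> A" for c i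
    using that keys_add[of c "Poly_Mapping.single v i"] by (auto split: if_splits)
  have "mons (insert v A) m = (\<Union>j\<le>m. (\<lambda>c. c + Poly_Mapping.single v (m - j)) ` mons A j)"
  proof (intro subset_antisym subsetI)
    fix a assume "a \<in> mons (insert v A) m"
    then have a: "keys a \<subseteq> insert v A" "mdeg a = m" by (auto simp: mons_def)
    define c where "c = a - Poly_Mapping.single v (lookup a v)"
    have ac: "a = c + Poly_Mapping.single v (lookup a v)"
      by (intro poly_mapping_eqI) (simp add: c_def lookup_add lookup_minus lookup_single when_def)
    have "keys c \<subseteq> A"
      using a(1) by (auto simp: c_def in_keys_iff lookup_minus lookup_single when_def subset_iff split: if_splits)
    moreover have m: "m = mdeg c + lookup a v" using arg_cong[OF ac, of mdeg] a(2) by (simp add: mdeg_add)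
    ultimately have "c \<in> mons A (mdeg c)" "mdeg c \<le> m" "lookup a v = m - mdeg c" by (auto simp: mons_def)
    then show "a \<in> (\<Union>j\<le>m. (\<lambda>c. c + Poly_Mapping.single v (m - j)) ` mons A j)" using ac by auto
  next
    fix a assume "a \<in> (\<Union>j\<le>m. (\<lambda>c. c + Poly_Mapping.single v (m - j)) ` mons A j)"
    then show "a \<in> mons (insert v A) m" using k by (auto simp: mons_def mdeg_add)
  qed
  also have "card \<dots> = (\<Sum>j\<le>m. card ((\<lambda>c. c + Poly_Mapping.single v (m - j)) ` mons A j))"
  proof (rule card_UN_disjoint)
    show "\<forall>i\<in>{..m}. \<forall>j\<in>{..m}. i \<noteq> j \<longrightarrow>
      (\<lambda>c. c + Poly_Mapping.single v (m - i)) ` mons A i \<inter> (\<lambda>c. c + Poly_Mapping.single v (m - j)) ` mons A j = {}"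
    proof (intro ballI impI equals0I)
      fix i j a assume ij: "i \<in> {..m}" "j \<in> {..m}" "i \<noteq> j"
        and a: "a \<in> (\<lambda>c. c + Poly_Mapping.single v (m - i)) ` mons A i
          \<inter> (\<lambda>c. c + Poly_Mapping.single v (m - j)) ` mons A j"
      have *: "lookup a v = m - k" if "a \<in> (\<lambda>c. c + Poly_Mapping.single v (m - k)) ` mons A k" for k
        using that insert.hyps(3) by (auto simp: mons_def lookup_add in_keys_iff subset_iff)
      then have "m - i = m - j" using a by (metis IntD1 IntD2)
      then show False using ij by auto
    qed
  qed (simp_all add: finite_mons)
  also have "\<dots> = (\<Sum>j\<le>m. (card A - 1 + j) choose (card A - 1))"
    by (simp add: card_image inj_on_def insert.IH)
  also have "\<dots> = (card A - 1 + m + 1) choose (card A - 1 + 1)" by (rule choose_rising_sum)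
  also have "card A - 1 + 1 = card A" using insert.hyps by (simp add: card_gt_0_iff Suc_leI)
  finally show ?case using insert.hyps by (simp add: card_gt_0_iff Suc_leI add.commute)
qed

lemma card_cone_eq:
  "card {a \<in> cone p. mdeg a = d} = (if mdeg (fst p) \<le> d then card (mons (snd p) (d - mdeg (fst p))) else 0)"
proof -
  have eq: "{a \<in> cone p. mdeg a = d} = (\<lambda>c. fst p + c) ` {c. keys c \<subseteq> snd p \<and> mdeg (fst p) + mdeg c = d}"
  proof (intro subset_antisym subsetI)
    fix a assume a: "a \<in> {a \<in> cone p. mdeg a = d}"
    then have ac: "fst p + (a - fst p) = a" by (intro monomial_diff) (auto simp: cone_def)
    have "keys (a - fst p) \<subseteq> snd p" using a by (auto simp: cone_def in_keys_iff lookup_minus)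
    moreover have "mdeg (fst p) + mdeg (a - fst p) = d" using a ac by (metis (mono_tags, lifting) mdeg_add mem_Collect_eq)
    ultimately show "a \<in> (\<lambda>c. fst p + c) ` {c. keys c \<subseteq> snd p \<and> mdeg (fst p) + mdeg c = d}"
      using ac by (metis (mono_tags, lifting) imageI mem_Collect_eq)
  qed (auto simp: cone_add mdeg_add)
  show ?thesis
  proof (cases "mdeg (fst p) \<le> d")
    case True
    then have "{c. keys c \<subseteq> snd p \<and> mdeg (fst p) + mdeg c = d} = mons (snd p) (d - mdeg (fst p))"
      by (auto simp: mons_def)
    then show ?thesis unfolding eq using True by (simp add: card_image)
  next
    case False
    then have "{c. keys c \<subseteq> snd p \<and> mdeg (fst p) + mdeg c = d} = {}" by auto
    then show ?thesis unfolding eq using False by simp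
  qed
qed

lemma tendsto_shift: "(\<lambda>d. real (d - b + c) / real d) \<longlonglongrightarrow> 1"
proof -
  have "(\<lambda>d. 1 + (real c - real b) / real d) \<longlonglongrightarrow> 1 + 0"
    by (intro tendsto_add tendsto_const lim_const_over_n)
  moreover have "eventually (\<lambda>d. 1 + (real c - real b) / real d = real (d - b + c) / real d) sequentially"
    using eventually_ge_at_top[of "b + 1"]
    by eventually_elim (auto simp: field_simps of_nat_diff)
  ultimately show ?thesis using tendsto_cong by force
qed

text \<open>The absorption identity contributes one factor (d - b + n + 1)/((n + 1) d) per induction
  step, which tends to 1/(n + 1).\<close>

lemma binomial_limit: "(\<lambda>d. real ((n + (d - b)) choose n) / real d ^ n) \<longlonglongrightarrow> 1 / fact n"
proof (induction n)
  case 0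
  then show ?case by simp
next
  case (Suc n)
  have "(\<lambda>d. (real (d - b + Suc n) / real d) / real (Suc n) * (real ((n + (d - b)) choose n) / real d ^ n))
      \<longlonglongrightarrow> 1 / real (Suc n) * (1 / fact n)"
    by (intro tendsto_mult Suc tendsto_divide tendsto_const tendsto_shift) simp
  moreover have "(real (d - b + Suc n) / real d) / real (Suc n) * (real ((n + (d - b)) choose n) / real d ^ n)
      = real ((Suc n + (d - b)) choose Suc n) / real d ^ Suc n" for d
  proof -
    have "Suc n * (Suc (n + (d - b)) choose Suc n) = Suc (n + (d - b)) * ((n + (d - b)) choose n)"
      using Suc_times_binomial_eq[of "n + (d - b)" n] by (simp only: mult.commute)
    then have "real (Suc n) * real (Suc (n + (d - b)) choose Suc n)
        = real (d - b + Suc n) * real ((n + (d - b)) choose n)"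
      by (metis of_nat_mult add_Suc_right add.commute)
    then have "real (Suc (n + (d - b)) choose Suc n)
        = real (d - b + Suc n) / real (Suc n) * real ((n + (d - b)) choose n)"
      by (simp add: field_simps del: of_nat_Suc binomial_Suc_Suc)
    then show ?thesis by (simp del: of_nat_Suc binomial_Suc_Suc)
  qed
  ultimately show ?case by (simp add: mult.commute)
qed

text \<open>A cone with j < k free directions keeps a factor (1/d)^(k-j), so only cones of dimension
  k survive. A cone without free directions is a single point, whose count vanishes for large d; the
  binomial formula does not cover it.\<close>

lemma cone_limit:
  assumes "card (snd p) \<le> k" "1 \<le> k"
  shows "(\<lambda>d. real (card {a \<in> cone p. mdeg a = d}) / real d ^ (k - 1))
    \<longlonglongrightarrow> (if card (snd p) = k then 1 / fact (k - 1) else 0)"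
proof (cases "snd p = {}")
  case True
  have mons: "mons (snd p) m = {}" if "m > 0" for m
  proof -
    have "m = 0" if "c \<in> mons (snd p) m" for c
      using that True mdeg_eq_0[of c] by (auto simp: mons_def poly_mapping_eq_iff fun_eq_iff in_keys_iff)
    then show ?thesis using that by auto
  qed
  have "eventually (\<lambda>d. real (card {a \<in> cone p. mdeg a = d}) / real d ^ (k - 1) = 0) sequentially"
    using eventually_gt_at_top[of "mdeg (fst p)"] by eventually_elim (simp add: card_cone_eq mons)
  then show ?thesis using True assms(2) by (auto intro: tendsto_eventually)
next
  case False
  define j where "j = card (snd p)"
  have j: "1 \<le> j" "j \<le> k" using False assms by (auto simp: j_def Suc_le_eq card_gt_0_iff)
  define b where "b = mdeg (fst p)"
  have "eventually (\<lambda>d. real ((j - 1 + (d - b)) choose (j - 1)) / real d ^ (j - 1)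
      = real (card {a \<in> cone p. mdeg a = d}) / real d ^ (j - 1)) sequentially"
    using eventually_ge_at_top[of b]
    by eventually_elim (simp add: card_cone_eq card_mons[OF False] j_def b_def)
  from tendsto_cong[OF this] have lim: "(\<lambda>d. real (card {a \<in> cone p. mdeg a = d}) / real d ^ (j - 1)) \<longlonglongrightarrow> 1 / fact (j - 1)"
    using binomial_limit[of "j - 1" b] by simp
  show ?thesis
  proof (cases "j = k")
    case True
    then show ?thesis using lim by (simp add: j_def)
  next
    case False
    have "(\<lambda>d. (1 / real d) ^ (k - j)) \<longlonglongrightarrow> 0 ^ (k - j)"
      by (intro tendsto_power lim_const_over_n)
    then have "(\<lambda>d. (1 / real d) ^ (k - j)) \<longlonglongrightarrow> 0" using False j by (simp add: power_0_left)
    from tendsto_mult[OF lim this]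
    have "(\<lambda>d. real (card {a \<in> cone p. mdeg a = d}) / real d ^ (j - 1) * (1 / real d) ^ (k - j)) \<longlonglongrightarrow> 0"
      by simp
    moreover have "real (card {a \<in> cone p. mdeg a = d}) / real d ^ (j - 1) * (1 / real d) ^ (k - j)
        = real (card {a \<in> cone p. mdeg a = d}) / real d ^ (k - 1)" for d
    proof -
      have "k - 1 = (j - 1) + (k - j)" using j by simp
      then show ?thesis by (simp add: power_add power_divide)
    qed
    ultimately show ?thesis using False by (simp add: j_def)
  qed
qed

section \<open>Dimension of monomial ideals\<close>

definition free :: "('v::finite \<Rightarrow>\<^sub>0 nat) set \<Rightarrow> 'v set \<Rightarrow> bool" where
  "free E A \<longleftrightarrow> (\<forall>a\<in>E. \<not> keys a \<subseteq> A)"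

text \<open>If 0 is in E, no A is free and \<open>Max\<close> is taken of the empty set; hence the
  recurring hypothesis \<open>0 \<notin> E\<close>.\<close>

definition udim :: "('v::finite \<Rightarrow>\<^sub>0 nat) set \<Rightarrow> nat" where
  "udim E = Max (card ` {A. free E A})"

lemma free_empty: "0 \<notin> E \<Longrightarrow> free E {}"
  unfolding free_def by (metis mdeg_eq_0 mdeg_def in_keys_iff empty_iff subset_empty sum.neutral)

lemma udim_ge: "free E A \<Longrightarrow> card A \<le> udim E"
  unfolding udim_def by (rule Max_ge) auto

lemma udim_attained:
  assumes "0 \<notin> E"
  obtains A where "free E A" "card A = udim E"
proof -
  have "Max (card ` {A. free E A}) \<in> card ` {A. free E A}"
    using free_empty[OF assms] by (intro Max_in) auto
  then show ?thesis using that by (auto simp: udim_def)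
qed

lemma udim_mono:
  assumes "E \<subseteq> E'" "0 \<notin> E'"
  shows "udim E' \<le> udim E"
proof -
  obtain A where "free E' A" "card A = udim E'" using udim_attained[OF assms(2)] .
  then show ?thesis using assms(1) udim_ge[of E A] by (auto simp: free_def)
qed

text \<open>No cone is larger than a free set: an a in E supported on the free directions of p would
  put \<open>fst p + a\<close> both into the cone and into E.\<close>

lemma decomp_card:
  assumes E: "upset E" "0 \<notin> E" and F: "decomp UNIV E F"
  shows "p \<in> F \<Longrightarrow> card (snd p) \<le> udim E"
    and "\<exists>p\<in>F. card (snd p) = udim E"
proof -
  have U: "(\<Union>p\<in>F. cone p) = - E" and fin: "finite F" using F by (auto simp: decomp_def)
  show le: "card (snd p) \<le> udim E" if "p \<in> F" for p
  proof (rule udim_ge, unfold free_def, intro ballI notI)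
    fix a assume a: "a \<in> E" "keys a \<subseteq> snd p"
    then have "fst p + a \<in> - E" using cone_add[of a p] that U by blast
    moreover have "a + fst p \<in> E" using E(1) a(1) by (rule upsetD)
    ultimately show False by (simp add: add.commute)
  qed
  obtain A where A: "free E A" "card A = udim E" using udim_attained[OF E(2)] .
  \<comment> \<open>Diagonal points of N^A for a free A of maximal size. One cone contains
    infinitely many of them, and beyond the degree of its base only free directions can carry the
    exponent n.\<close>
  define m where "m n = (\<Sum>v\<in>A. Poly_Mapping.single v n)" for n :: nat
  have m: "lookup (m n) v = (if v \<in> A then n else 0)" for n v
    by (auto simp: m_def lookup_sum lookup_single when_def)
  have "\<exists>p\<in>F. m n \<in> cone p" for n
  proof -
    have "keys (m n) \<subseteq> A" by (auto simp: in_keys_iff m split: if_splits)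
    then have "m n \<in> - E" using A(1) by (auto simp: free_def)
    then show ?thesis using U by blast
  qed
  then obtain q where q: "\<And>n. q n \<in> F" "\<And>n. m n \<in> cone (q n)" by metis
  have "\<exists>n0\<in>UNIV. infinite {n\<in>UNIV. q n = q n0}"
    by (rule pigeonhole_infinite) (use q(1) fin in \<open>auto intro: finite_subset[of _ F]\<close>)
  then obtain n0 where n0: "infinite {n. q n = q n0}" by auto
  then have "\<not> {n. q n = q n0} \<subseteq> {..mdeg (fst (q n0))}" using finite_subset by blast
  then obtain n where "n \<in> {n. q n = q n0}" "n \<notin> {..mdeg (fst (q n0))}" by blast
  then have n: "n > mdeg (fst (q n0))" "q n = q n0" by simp_all
  have "A \<subseteq> snd (q n0)"
  proof
    fix v assume v: "v \<in> A"
    show "v \<in> snd (q n0)"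
    proof (rule ccontr)
      assume "v \<notin> snd (q n0)"
      then have "n = lookup (fst (q n0)) v" using q(2)[of n] n(2) m[of n v] v by (auto simp: cone_def)
      then show False using lookup_le_mdeg[of "fst (q n0)" v] n(1) by simp
    qed
  qed
  then have "udim E \<le> card (snd (q n0))" using A(2) card_mono[of "snd (q n0)" A] by simp
  then show "\<exists>p\<in>F. card (snd p) = udim E" using le[OF q(1)] q(1) by (metis le_antisym)
qed

text \<open>N is the number of top-dimensional cones, which is why degrees in positive dimension are
  positive integers.\<close>

lemma count_limit:
  assumes E: "upset E" "0 \<notin> E" and k: "1 \<le> udim E"
  obtains N :: nat where "1 \<le> N"
    "(\<lambda>d. real (card ({a. mdeg a = d} - E)) / real d ^ (udim E - 1)) \<longlonglongrightarrow> real N / fact (udim E - 1)"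
proof -
  obtain F where F: "decomp UNIV E F" using decomp_exists[OF E(1)] by blast
  then have U: "(\<Union>p\<in>F. cone p) = - E" and fin: "finite F"
    and disj: "\<And>p q. p \<in> F \<Longrightarrow> q \<in> F \<Longrightarrow> p \<noteq> q \<Longrightarrow> cone p \<inter> cone q = {}"
    by (auto simp: decomp_def)
  define N where "N = card {p \<in> F. card (snd p) = udim E}"
  have "{p \<in> F. card (snd p) = udim E} \<noteq> {}" using decomp_card(2)[OF E F] by blast
  then have N: "1 \<le> N" using fin by (simp add: N_def Suc_le_eq card_gt_0_iff)
  have "card ({a. mdeg a = d} - E) = (\<Sum>p\<in>F. card {a \<in> cone p. mdeg a = d})" for d
  proof -
    have "{a. mdeg a = d} - E = (\<Union>p\<in>F. {a \<in> cone p. mdeg a = d})" using U by blast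
    also have "card \<dots> = (\<Sum>p\<in>F. card {a \<in> cone p. mdeg a = d})"
      using fin disj
      by (intro card_UN_disjoint) (blast intro: finite_subset[OF _ finite_mdeg_eq[of d]])+
    finally show ?thesis .
  qed
  then have "(\<lambda>d. real (card ({a. mdeg a = d} - E)) / real d ^ (udim E - 1))
    = (\<lambda>d. \<Sum>p\<in>F. real (card {a \<in> cone p. mdeg a = d}) / real d ^ (udim E - 1))"
    by (simp add: sum_divide_distrib)
  moreover have "(\<lambda>d. \<Sum>p\<in>F. real (card {a \<in> cone p. mdeg a = d}) / real d ^ (udim E - 1))
    \<longlonglongrightarrow> (\<Sum>p\<in>F. if card (snd p) = udim E then 1 / fact (udim E - 1) else 0)"
    by (intro tendsto_sum cone_limit decomp_card(1)[OF E F] k)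
  moreover have "(\<Sum>p\<in>F. if card (snd p) = udim E then 1 / fact (udim E - 1) else 0)
      = real N / fact (udim E - 1)"
    using fin by (simp add: N_def sum.If_cases Int_def)
  ultimately show ?thesis using that[OF N] by simp
qed

lemma card_cone_le: "card {a \<in> cone p. mdeg a \<le> d} \<le> (d + 1) ^ card (snd p)"
proof -
  let ?X = "{a \<in> cone p. mdeg a \<le> d}" and ?r = "\<lambda>a. restrict (lookup a) (snd p)"
  have "inj_on ?r ?X"
  proof (rule inj_onI)
    fix a b assume ab: "a \<in> ?X" "b \<in> ?X" "?r a = ?r b"
    show "a = b"
    proof (rule poly_mapping_eqI)
      fix v
      show "lookup a v = lookup b v"
        using ab(1,2) fun_cong[OF ab(3), of v] by (cases "v \<in> snd p") (simp_all add: cone_def)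
    qed
  qed
  moreover have "?r ` ?X \<subseteq> snd p \<rightarrow>\<^sub>E {..d}"
    using lookup_le_mdeg order_trans by fastforce
  ultimately have "card ?X \<le> card (snd p \<rightarrow>\<^sub>E {..d})"
    by (intro card_inj_on_le[of ?r]) (auto intro: finite_PiE)
  then show ?thesis by (simp add: card_PiE)
qed

text \<open>The box {0..d}^A consists of monomials outside E; exponents at most d in every variable
  give the degree bound.\<close>

lemma card_box_le:
  assumes "free E A"
  shows "(d + 1) ^ card A \<le> card ({a :: 'v::finite \<Rightarrow>\<^sub>0 nat. mdeg a \<le> card (UNIV :: 'v set) * d} - E)"
proof -
  let ?Y = "{a. mdeg a \<le> card (UNIV :: 'v set) * d} - E" and ?r = "\<lambda>a. restrict (lookup a) A"
  have "A \<rightarrow>\<^sub>E {..d} \<subseteq> ?r ` ?Y"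
  proof
    fix f assume f: "f \<in> A \<rightarrow>\<^sub>E {..d}"
    define a where "a = Abs_poly_mapping (\<lambda>v. if v \<in> A then f v else 0)"
    have a: "lookup a v = (if v \<in> A then f v else 0)" for v by (simp add: a_def)
    have "keys a \<subseteq> A" by (auto simp: in_keys_iff a split: if_splits)
    then have "a \<notin> E" using assms by (auto simp: free_def)
    moreover have "mdeg a \<le> card (UNIV :: 'v set) * d"
      unfolding mdeg_def using f by (intro sum_bounded_above[of UNIV _ d, simplified]) (auto simp: a PiE_def Pi_def)
    moreover have "?r a = f" using f by (auto simp: a fun_eq_iff PiE_def extensional_def)
    ultimately show "f \<in> ?r ` ?Y" by blast
  qed
  then have "card (A \<rightarrow>\<^sub>E {..d}) \<le> card ?Y"
    by (intro surj_card_le) (auto intro: finite_subset[OF _ finite_mdeg_le])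
  then show ?thesis by (simp add: card_PiE)
qed

lemma count_bound:
  assumes E: "upset E" "0 \<notin> E"
  obtains M where "\<And>d. card ({a. mdeg a \<le> d} - E) \<le> M * (d + 1) ^ udim E"
proof -
  obtain F where F: "decomp UNIV E F" using decomp_exists[OF E(1)] by blast
  then have U: "(\<Union>p\<in>F. cone p) = - E" and fin: "finite F" by (auto simp: decomp_def)
  have "card ({a. mdeg a \<le> d} - E) \<le> card F * (d + 1) ^ udim E" for d
  proof -
    have "{a. mdeg a \<le> d} - E = (\<Union>p\<in>F. {a \<in> cone p. mdeg a \<le> d})" using U by blast
    also have "card \<dots> \<le> (\<Sum>p\<in>F. card {a \<in> cone p. mdeg a \<le> d})" using fin by (rule card_UN_le)
    also have "\<dots> \<le> (\<Sum>p\<in>F. (d + 1) ^ udim E)"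
      by (intro sum_mono order_trans[OF card_cone_le] power_increasing decomp_card(1)[OF E F]) auto
    finally show ?thesis by simp
  qed
  then show ?thesis by (rule that)
qed

section \<open>Growth of Hilbert functions and dimension\<close>

text \<open>The choice d = C makes d + 1 exceed C, which a larger exponent on the left does not
  allow.\<close>

lemma growth_exponent:
  assumes "\<And>d :: nat. (d + 1) ^ j \<le> C * (d + 1) ^ k"
  shows "j \<le> k"
proof (rule ccontr)
  assume "\<not> j \<le> k"
  then have "(C + 1) ^ Suc k \<le> (C + 1) ^ j" by (intro power_increasing) auto
  also have "\<dots> \<le> C * (C + 1) ^ k" by (rule assms)
  finally show False by simp
qed

context deg_order
begin

lemma upset_lms: "is_ideal J \<Longrightarrow> upset (lms (J :: ('v, 'a::field) mpoly set))"
  by (simp add: upset_def lms_add)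

definition gdim :: "('v, 'a::field) mpoly set \<Rightarrow> nat" where
  "gdim J = udim (lms J)"

definition indep :: "('v, 'a::field) mpoly set \<Rightarrow> 'v set \<Rightarrow> bool" where
  "indep J A \<longleftrightarrow> J \<inter> polys_on {a. keys a \<subseteq> A} \<subseteq> {0}"

lemma indepD: "indep J A \<Longrightarrow> f \<in> J \<Longrightarrow> (\<And>a. a \<in> keys f \<Longrightarrow> keys a \<subseteq> A) \<Longrightarrow> f = 0"
  by (auto simp: indep_def polys_on_def)

lemma gdim_mono:
  fixes J :: "('v, 'a::field) mpoly set"
  assumes "J \<subseteq> J'" "is_ideal J'" "1 \<notin> J'"
  shows "gdim J' \<le> gdim J"
  unfolding gdim_def using assms by (intro udim_mono lms_mono) (simp_all add: lms_zero_iff)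

lemma gdim_attained:
  fixes J :: "('v, 'a::field) mpoly set"
  assumes J: "is_ideal J" "1 \<notin> J"
  obtains A where "indep J A" "card A = gdim J"
proof -
  obtain A where A: "free (lms J) A" "card A = udim (lms J)"
    using udim_attained[of "lms J"] J lms_zero_iff by blast
  have "indep J A"
    unfolding indep_def
  proof
    fix f assume f: "f \<in> J \<inter> polys_on {a. keys a \<subseteq> A}"
    have "False" if "f \<noteq> 0"
      using lmsI[of f J] lead_keys[OF that] f A(1) that by (auto simp: free_def polys_on_def)
    then show "f \<in> {0}" by blast
  qed
  then show ?thesis using that A(2) by (simp add: gdim_def)
qed

lemma ccount_mono: "d \<le> d' \<Longrightarrow> ccount J d \<le> ccount J d'"
  unfolding ccount_def by (intro card_mono) (auto intro: finite_subset[OF _ finite_mdeg_le[of d']])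

lemma ccount_antimono: "J \<subseteq> J' \<Longrightarrow> ccount J' d \<le> ccount J d"
  unfolding ccount_def using lms_mono[of J J']
  by (intro card_mono) (auto intro: finite_subset[OF _ finite_mdeg_le[of d]])

lemma ccount_upper:
  fixes J :: "('v, 'a::field) mpoly set"
  assumes "is_ideal J" "1 \<notin> J"
  obtains M where "\<And>d. ccount J d \<le> M * (d + 1) ^ gdim J"
  using count_bound[of "lms J"] upset_lms[OF assms(1)] lms_zero_iff[OF assms(1)] assms(2)
  unfolding ccount_def gdim_def by blast

lemma ccount_lower:
  fixes J :: "('v, 'a::field) mpoly set"
  assumes "is_ideal J" "1 \<notin> J"
  shows "(d + 1) ^ gdim J \<le> ccount J (card (UNIV :: 'v set) * d)"
proof -
  obtain A where A: "free (lms J) A" "card A = udim (lms J)"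
    using udim_attained[of "lms J"] assms lms_zero_iff by blast
  then show ?thesis using card_box_le[OF A(1), of d] by (simp add: ccount_def gdim_def)
qed

text \<open>An independent A need not be free for \<open>lms J\<close>: the lead of an element of J
  may lie in K[A] while other terms do not. So sizes are compared through growth: K[A] embeds into
  S/J, hence (d+1)^|A| is bounded by a multiple of (d+1)^gdim J.\<close>

lemma indep_card_le:
  fixes J :: "('v, 'a::field) mpoly set"
  assumes J: "is_ideal J" and A: "indep J A"
  shows "card A \<le> gdim J"
proof -
  define s where "s = card (UNIV :: 'v set)"
  have 1: "1 \<notin> J" using indepD[OF A, of 1] by auto
  obtain M where M: "\<And>d. ccount J d \<le> M * (d + 1) ^ gdim J" using ccount_upper[OF J 1] by blast
  have "(d + 1) ^ card A \<le> (M * (s + 1) ^ gdim J) * (d + 1) ^ gdim J" for d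
  proof -
    define n where "n = s * d"
    define X where "X = {a :: 'v \<Rightarrow>\<^sub>0 nat. mdeg a \<le> n} - {a. \<not> keys a \<subseteq> A}"
    let ?M = "{a :: 'v \<Rightarrow>\<^sub>0 nat. mdeg a \<le> n}"
    have "free {a. \<not> keys a \<subseteq> A} A" by (simp add: free_def)
    from card_box_le[OF this, of d] have "(d + 1) ^ card A \<le> card X"
      by (simp add: X_def n_def s_def)
    also have "card X \<le> ccount J n"
    proof -
      let ?U = "J \<inter> polys_on ?M" and ?R = "polys_on X :: ('v, 'a) mpoly set"
      have XM: "X \<subseteq> ?M" by (auto simp: X_def)
      have R: "?R \<subseteq> polys_on ?M" using XM by (rule polys_on_mono)
      have "?U \<inter> ?R \<subseteq> {0}" using A by (auto simp: indep_def polys_on_def X_def)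
      then have "kdim {u + r | u r. u \<in> ?U \<and> r \<in> ?R} = kdim ?U + kdim ?R"
        by (intro kdim_direct_sum[OF subspace_window[OF J] _ polys_on_subspace R finite_mdeg_le]) auto
      moreover have "kdim {u + r | u r. u \<in> ?U \<and> r \<in> ?R} \<le> kdim (polys_on ?M :: ('v, 'a) mpoly set)"
      proof (rule kdim_mono[OF _ polys_on_subspace _ subset_refl finite_mdeg_le])
        show "kv.subspace {u + r | u r. u \<in> ?U \<and> r \<in> ?R}"
          by (rule kv.subspace_sums[OF subspace_window[OF J] polys_on_subspace])
        show "{u + r | u r. u \<in> ?U \<and> r \<in> ?R} \<subseteq> polys_on ?M"
          using R kv.subspace_add[OF polys_on_subspace[of ?M]] by blast
      qed
      moreover have "finite X" by (rule finite_subset[OF XM finite_mdeg_le])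
      ultimately show ?thesis
        using kdim_le_window[OF J, of n] by (simp add: kdim_polys_on finite_mdeg_le)
    qed
    also have "\<dots> \<le> M * (n + 1) ^ gdim J" by (rule M)
    also have "\<dots> \<le> M * ((s + 1) * (d + 1)) ^ gdim J"
      by (intro mult_left_mono power_mono) (auto simp: n_def)
    finally show ?thesis by (simp add: power_mult_distrib mult.assoc del: mult_Suc mult_Suc_right)
  qed
  then show ?thesis by (rule growth_exponent)
qed

text \<open>For f in Q outside P, multiplication by f is injective on S/P, so S/P up to degree d + e
  has room for S/Q and a copy of S/P up to degree d. Iteration packs about d copies of S/Q into S/P,
  which takes one more power of d.\<close>

lemma prime_strict_gdim:
  fixes P Q :: "('v, 'a::field) mpoly set"
  assumes P: "prime_ideal P" and Q: "is_ideal Q" "1 \<notin> Q" and PQ: "P \<subset> Q"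
  shows "gdim Q < gdim P"
proof -
  have Pi: "is_ideal P" "1 \<notin> P" using P by (auto simp: prime_ideal_def)
  define s where "s = card (UNIV :: 'v set)"
  obtain f where f: "f \<in> Q" "f \<notin> P" using PQ by blast
  then have f0: "f \<noteq> 0" using ideal_zero[OF Pi(1)] by blast
  obtain e where e: "\<And>a. a \<in> keys f \<Longrightarrow> mdeg a \<le> e" using poly_mdeg_bound[of f] by blast
  have "ideal_gen (insert f P) \<subseteq> Q" using PQ f by (intro ideal_gen_least[OF Q(1)]) auto
  then have step: "ccount Q (d + e) + ccount P d \<le> ccount P (d + e)" for d
    using ccount_colon[OF Pi(1) f0 e, of d] ccount_antimono[of "ideal_gen (insert f P)" Q "d + e"]
    unfolding prime_colon[OF P f(2)] by linarith
  have iter: "m * ccount Q d \<le> ccount P (d + m * e)" for m d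
  proof (induction m)
    case (Suc m)
    have "ccount Q d \<le> ccount Q (d + m * e + e)" by (intro ccount_mono) simp
    then show ?case using step[of "d + m * e"] Suc by (simp add: add_ac)
  qed simp
  obtain M where M: "\<And>d. ccount P d \<le> M * (d + 1) ^ gdim P" using ccount_upper[OF Pi] by blast
  \<comment> \<open>Packing t + 1 copies at degree s t gives the factor t + 1, while the degree s t
    + (t + 1) e stays linear in t.\<close>
  have "(t + 1) ^ Suc (gdim Q) \<le> (M * (s + e + 1) ^ gdim P) * (t + 1) ^ gdim P" for t
  proof -
    have "(t + 1) ^ Suc (gdim Q) = (t + 1) * (t + 1) ^ gdim Q" by simp
    also have "\<dots> \<le> (t + 1) * ccount Q (s * t)"
      using ccount_lower[OF Q, of t] by (intro mult_left_mono) (auto simp: s_def)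
    also have "\<dots> \<le> ccount P (s * t + (t + 1) * e)" by (rule iter)
    also have "\<dots> \<le> M * (s * t + (t + 1) * e + 1) ^ gdim P" by (rule M)
    also have "\<dots> \<le> M * ((s + e + 1) * (t + 1)) ^ gdim P"
      by (intro mult_left_mono power_mono) (auto simp: algebra_simps)
    finally show ?thesis by (simp only: power_mult_distrib mult.assoc)
  qed
  from growth_exponent[OF this] show ?thesis by simp
qed

lemma ideal_gen_insert_0: "is_ideal J \<Longrightarrow> ideal_gen (insert 0 J) = J"
  by (auto simp: ideal_gen_insert)

lemma scount_antimono: "lms J \<subseteq> lms J' \<Longrightarrow> scount J' d \<le> scount J d"
  unfolding scount_def by (intro card_mono) (auto intro: finite_subset[OF _ finite_mdeg_eq[of d]])

text \<open>The dimension half of the principal ideal theorem. Since (J:f) contains J, S/J up to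
  degree d + e is at most S/(J,f) there plus S/J up to degree d; m such steps leave m copies of
  S/(J,f) and a constant, one more power of d.\<close>

lemma gdim_insert_homog:
  fixes J :: "('v, 'a::field) mpoly set"
  assumes J: "graded_ideal J" and f: "f \<in> homog e" "1 \<le> e"
    and K: "1 \<notin> ideal_gen (insert f J)"
  shows "gdim J \<le> gdim (ideal_gen (insert f J)) + 1"
proof (cases "f = 0")
  case True
  then show ?thesis using graded_ideal_is_ideal[OF J] by (simp add: ideal_gen_insert_0)
next
  case False
  define K where "K = ideal_gen (insert f J)"
  note Ji = graded_ideal_is_ideal[OF J]
  have K1: "is_ideal K" "1 \<notin> K" using K ideal_gen_ideal by (auto simp: K_def)
  have JK: "J \<subseteq> K" unfolding K_def using ideal_gen_superset by blast
  have J1: "1 \<notin> J" using K1 JK by blast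
  define s where "s = card (UNIV :: 'v set)"
  have split: "(\<Sum>i\<le>d + e. g i) = (\<Sum>i<e. g i) + (\<Sum>i\<le>d. g (i + e))" for d and g :: "nat \<Rightarrow> nat"
  proof (induction d)
    case 0
    then show ?case by (simp add: lessThan_Suc_atMost[symmetric])
  qed simp
  have step: "ccount J (d + e) \<le> ccount K (d + e) + ccount J d" for d
  proof -
    have "ccount J (d + e) = (\<Sum>i<e. scount K i) + (\<Sum>i\<le>d. scount K (i + e) + scount (colon J f) i)"
      unfolding ccount_sum split K_def
      by (intro arg_cong2[of _ _ _ _ "(+)"] sum.cong refl) (simp_all add: scount_colon[OF J False f(1)])
    also have "\<dots> = ccount K (d + e) + ccount (colon J f) d"
      unfolding ccount_sum split by (simp add: sum.distrib)
    also have "\<dots> \<le> ccount K (d + e) + ccount J d"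
      using ccount_antimono[OF colon_superset[OF Ji]] by simp
    finally show ?thesis .
  qed
  have iter: "ccount J (m * e) \<le> m * ccount K (m * e) + ccount J 0" for m
  proof (induction m)
    case (Suc m)
    have "ccount K (m * e) \<le> ccount K (m * e + e)" by (intro ccount_mono) simp
    then have "m * ccount K (m * e) \<le> m * ccount K (m * e + e)" by (rule mult_left_mono) simp
    with step[of "m * e"] Suc have "ccount J (m * e + e) \<le> ccount K (m * e + e)
        + m * ccount K (m * e + e) + ccount J 0" by linarith
    then show ?case by (simp add: add_ac)
  qed simp
  obtain M where M: "\<And>d. ccount K d \<le> M * (d + 1) ^ gdim K" using ccount_upper[OF K1] by blast
  define C where "C = s * (M * (s * e + 1) ^ gdim K) + ccount J 0"
  have "(t + 1) ^ gdim J \<le> C * (t + 1) ^ Suc (gdim K)" for t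
  proof -
    have "(t + 1) ^ gdim J \<le> ccount J (s * t)" using ccount_lower[OF Ji J1, of t] by (simp add: s_def)
    also have "\<dots> \<le> ccount J ((s * t) * e)" using f(2) by (intro ccount_mono) simp
    also have "\<dots> \<le> (s * t) * ccount K ((s * t) * e) + ccount J 0" by (rule iter)
    also have "\<dots> \<le> (s * (t + 1)) * (M * ((s * e + 1) * (t + 1)) ^ gdim K) + ccount J 0 * (t + 1) ^ Suc (gdim K)"
    proof (rule add_mono)
      have "ccount K ((s * t) * e) \<le> M * ((s * t) * e + 1) ^ gdim K" by (rule M)
      also have "\<dots> \<le> M * ((s * e + 1) * (t + 1)) ^ gdim K"
        by (intro mult_left_mono power_mono) (auto simp: algebra_simps)
      finally show "(s * t) * ccount K ((s * t) * e)
          \<le> (s * (t + 1)) * (M * ((s * e + 1) * (t + 1)) ^ gdim K)"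
        by (intro mult_mono) auto
      show "ccount J 0 \<le> ccount J 0 * (t + 1) ^ Suc (gdim K)"
        using one_le_power[of "t + 1" "Suc (gdim K)"] by (simp del: power_Suc)
    qed
    also have "\<dots> = C * (t + 1) ^ Suc (gdim K)"
      unfolding C_def power_mult_distrib power_Suc by (simp only: algebra_simps)
    finally show ?thesis .
  qed
  from growth_exponent[OF this] show ?thesis by (simp add: K_def)
qed

section \<open>Prime ideals\<close>

text \<open>Noetherianity without generators: a maximal \<open>lms J\<close> comes from a maximal
  J.\<close>

lemma ideal_maximal:
  fixes JJ :: "('v, 'a::field) mpoly set set"
  assumes "JJ \<noteq> {}" "\<And>J. J \<in> JJ \<Longrightarrow> is_ideal J"
  obtains J where "J \<in> JJ" "\<And>J'. J' \<in> JJ \<Longrightarrow> J \<subseteq> J' \<Longrightarrow> J' = J"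
proof -
  have "upset E" if "E \<in> lms ` JJ" for E using that assms(2) upset_lms by blast
  then obtain E where E: "E \<in> lms ` JJ" "\<And>E'. E' \<in> lms ` JJ \<Longrightarrow> E \<subseteq> E' \<Longrightarrow> E' = E"
    using upset_maximal[of "lms ` JJ"] assms(1) by blast
  then obtain J where J: "J \<in> JJ" "E = lms J" by blast
  have "J' = J" if "J' \<in> JJ" "J \<subseteq> J'" for J'
  proof -
    have "lms J' = lms J" using E(2)[of "lms J'"] that lms_mono[OF that(2)] J(2) by blast
    then show ?thesis using that assms(2) J(1) by (intro subspace_eq_lms[symmetric] ideal_subspace) auto
  qed
  then show ?thesis using that J(1) by blast
qed

text \<open>Krull's argument: an ideal maximal among those avoiding a multiplicative set is
  prime.\<close>

lemma prime_avoiding: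
  fixes J :: "('v, 'a::field) mpoly set"
  assumes J: "is_ideal J" and S: "1 \<in> S" "\<And>x y. x \<in> S \<Longrightarrow> y \<in> S \<Longrightarrow> x * y \<in> S" and JS: "J \<inter> S = {}"
  obtains P where "prime_ideal P" "J \<subseteq> P" "P \<inter> S = {}"
proof -
  define JJ where "JJ = {P. is_ideal P \<and> J \<subseteq> P \<and> P \<inter> S = {}}"
  have ne: "JJ \<noteq> {}" "\<And>P. P \<in> JJ \<Longrightarrow> is_ideal P" using J JS by (auto simp: JJ_def)
  obtain P where P: "P \<in> JJ" "\<And>P'. P' \<in> JJ \<Longrightarrow> P \<subseteq> P' \<Longrightarrow> P' = P"
    using ideal_maximal[OF ne] by blast
  then have Pi: "is_ideal P" "J \<subseteq> P" "P \<inter> S = {}" by (auto simp: JJ_def)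
  have ext: "\<exists>p\<in>P. \<exists>h. p + h * f \<in> S" if "f \<notin> P" for f
  proof (rule ccontr)
    assume no: "\<not> (\<exists>p\<in>P. \<exists>h. p + h * f \<in> S)"
    have "ideal_gen (insert f P) \<inter> S = {}" unfolding ideal_gen_insert[OF Pi(1)] using no by blast
    then have "ideal_gen (insert f P) \<in> JJ"
      using Pi ideal_gen_superset[of "insert f P"] ideal_gen_ideal unfolding JJ_def by blast
    then have "ideal_gen (insert f P) = P" using P(2) ideal_gen_superset[of "insert f P"] by blast
    then show False using that ideal_gen_superset[of "insert f P"] by blast
  qed
  have "f \<in> P \<or> g \<in> P" if fg: "f * g \<in> P" for f g
  proof (rule ccontr)
    assume "\<not> (f \<in> P \<or> g \<in> P)"
    then obtain p h q k where *: "p \<in> P" "p + h * f \<in> S" "q \<in> P" "q + k * g \<in> S"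
      using ext[of f] ext[of g] by blast
    have "(p + h * f) * (q + k * g) = p * (q + k * g) + (h * f) * q + (h * k) * (f * g)"
      by (simp add: algebra_simps)
    also have "\<dots> \<in> P"
      by (intro ideal_add[OF Pi(1)] ideal_mult'[OF Pi(1) *(1)] ideal_mult[OF Pi(1) *(3)]
        ideal_mult[OF Pi(1) fg])
    finally show False using S(2)[OF *(2,4)] Pi(3) by blast
  qed
  then have "prime_ideal P" using Pi S(1) unfolding prime_ideal_def by blast
  then show ?thesis using that Pi by blast
qed

text \<open>Independence of A says that J avoids the nonzero elements of K[A], a multiplicative set
  since S is a domain.\<close>

lemma prime_over_indep:
  fixes J :: "('v, 'a::field) mpoly set"
  assumes J: "is_ideal J" and A: "indep J A"
  obtains P where "prime_ideal P" "J \<subseteq> P" "indep P A"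
proof -
  define S where "S = polys_on {a. keys a \<subseteq> A} - {0 :: ('v, 'a) mpoly}"
  have "1 \<in> S" by (auto simp: S_def polys_on_def)
  moreover have "x * y \<in> S" if "x \<in> S" "y \<in> S" for x y
  proof -
    have "keys (a + b) \<subseteq> A" if "keys a \<subseteq> A" "keys b \<subseteq> A" for a b :: "'v \<Rightarrow>\<^sub>0 nat"
      using that keys_add[of a b] by blast
    then show ?thesis
      using that mult_nz[of x y] polys_on_mult[of x "{a. keys a \<subseteq> A}" y "{a. keys a \<subseteq> A}" "{a. keys a \<subseteq> A}"]
      by (simp add: S_def)
  qed
  moreover have "J \<inter> S = {}" using A by (auto simp: S_def indep_def)
  ultimately obtain P where "prime_ideal P" "J \<subseteq> P" "P \<inter> S = {}"
    using prime_avoiding[OF J, of S] by metis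
  then show ?thesis using that[of P] by (auto simp: S_def indep_def)
qed

end

section \<open>Primes defined through coefficients\<close>

lemma coef_ideal_mult:
  fixes H F :: "'g::cancel_comm_monoid_add \<Rightarrow>\<^sub>0 ('v, 'a::field) mpoly"
  assumes p: "is_ideal p" and F: "\<And>c. lookup F c \<in> p"
  shows "lookup (H * F) c \<in> p"
proof -
  have "H * F = (\<Sum>l\<in>keys H. Poly_Mapping.single l (lookup H l)) * (\<Sum>q\<in>keys F. Poly_Mapping.single q (lookup F q))"
    by (intro arg_cong2[of _ _ _ _ "(*)"] poly_expand)
  also have "\<dots> = (\<Sum>l\<in>keys H. \<Sum>q\<in>keys F. Poly_Mapping.single (l + q) (lookup H l * lookup F q))"
    by (simp add: sum_product mult_single)
  finally have "lookup (H * F) c = (\<Sum>l\<in>keys H. \<Sum>q\<in>keys F. lookup (Poly_Mapping.single (l + q) (lookup H l * lookup F q)) c)"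
    by (simp add: lookup_sum)
  also have "\<dots> \<in> p"
    by (intro ideal_sum[OF p]) (auto simp: lookup_single when_def ideal_zero[OF p] ideal_mult[OF p] F)
  finally show ?thesis .
qed

text \<open>Gauss's lemma for p[G]. Discarding the coefficients in p leaves F1 and G1 with top
  coefficients outside p, and modulo p the top coefficient of F1 G1 is a coefficient of F G.\<close>

lemma coef_prime:
  fixes F G :: "'g::cancel_comm_monoid_add \<Rightarrow>\<^sub>0 ('v, 'a::field) mpoly"
  assumes p: "prime_ideal p" and le: "add_linorder (le :: 'g \<Rightarrow> 'g \<Rightarrow> bool)"
    and FG: "\<And>c. lookup (F * G) c \<in> p"
  shows "(\<forall>c. lookup F c \<in> p) \<or> (\<forall>c. lookup G c \<in> p)"
proof (rule ccontr)
  assume no: "\<not> ((\<forall>c. lookup F c \<in> p) \<or> (\<forall>c. lookup G c \<in> p))"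
  have pi: "is_ideal p" using p by (simp add: prime_ideal_def)
  have part: "\<exists>F1 c. (\<forall>x. lookup (F - F1) x \<in> p) \<and> (\<forall>x\<in>keys F1. le x c) \<and> lookup F1 c \<notin> p"
    if nF: "\<not> (\<forall>c. lookup F c \<in> p)" for F :: "'g \<Rightarrow>\<^sub>0 ('v, 'a) mpoly"
  proof -
    define X where "X = {c \<in> keys F. lookup F c \<notin> p}"
    have inX: "c \<in> X" if "lookup F c \<notin> p" for c
      using that ideal_zero[OF pi] by (auto simp: X_def in_keys_iff)
    have "finite X" "X \<noteq> {}" using nF inX by (auto simp: X_def)
    then obtain c where c: "c \<in> X" "\<And>x. x \<in> X \<Longrightarrow> le x c" using add_linorder_max[OF le, of X] by blast
    define F1 where "F1 = (\<Sum>c\<in>X. Poly_Mapping.single c (lookup F c))"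
    have F1: "lookup F1 x = (if x \<in> X then lookup F x else 0)" for x
      using \<open>finite X\<close> by (simp add: F1_def lookup_sum lookup_single when_def)
    have "keys F1 \<subseteq> X" by (auto simp: in_keys_iff F1 split: if_splits)
    moreover have "lookup (F - F1) x \<in> p" for x
      using inX[of x] ideal_zero[OF pi] by (auto simp: lookup_minus F1)
    moreover have "lookup F1 c \<notin> p" using c(1) F1 by (simp add: X_def)
    ultimately show ?thesis using c(2) by blast
  qed
  obtain F1 c where F1: "\<And>x. lookup (F - F1) x \<in> p" "\<And>x. x \<in> keys F1 \<Longrightarrow> le x c" "lookup F1 c \<notin> p"
    using part[of F] no by blast
  obtain G1 b where G1: "\<And>x. lookup (G - G1) x \<in> p" "\<And>x. x \<in> keys G1 \<Longrightarrow> le x b" "lookup G1 b \<notin> p"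
    using part[of G] no by blast
  have "F1 * G1 = F * G - G * (F - F1) - F1 * (G - G1)" by (simp add: algebra_simps)
  then have "lookup (F1 * G1) (c + b)
      = lookup (F * G) (c + b) - lookup (G * (F - F1)) (c + b) - lookup (F1 * (G - G1)) (c + b)"
    by (simp add: lookup_minus)
  also have "\<dots> \<in> p"
    by (intro ideal_diff[OF pi] FG coef_ideal_mult[OF pi] F1 G1)
  finally have "lookup F1 c * lookup G1 b \<in> p"
    using lookup_mult_top[OF le, of F1 c G1 b] F1(2) G1(2) by simp
  then show False using F1(3) G1(3) p by (auto simp: prime_ideal_def)
qed

text \<open>A pair of additive maps w, rho on monomials gives a ring homomorphism from S to the
  semigroup ring S[G], sending the monomial x^a to x^(rho a) in degree w a. It yields both the
  homogeneous components (w the degree) and the coefficients with respect to a subset of the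
  variables.\<close>

locale coef_map =
  fixes w :: "('v::finite \<Rightarrow>\<^sub>0 nat) \<Rightarrow> 'g::cancel_comm_monoid_add"
    and rho :: "('v \<Rightarrow>\<^sub>0 nat) \<Rightarrow> ('v \<Rightarrow>\<^sub>0 nat)"
  assumes w_add: "w (a + b) = w a + w b" and rho_add: "rho (a + b) = rho a + rho b"
    and w_0: "w 0 = 0" and rho_0: "rho 0 = 0"
begin

definition Phi :: "('v, 'a::field) mpoly \<Rightarrow> 'g \<Rightarrow>\<^sub>0 ('v, 'a) mpoly" where
  "Phi f = (\<Sum>a\<in>keys f. Poly_Mapping.single (w a) (Poly_Mapping.single (rho a) (lookup f a)))"

lemma Phi_superset:
  assumes "finite X" "keys f \<subseteq> X"
  shows "Phi f = (\<Sum>a\<in>X. Poly_Mapping.single (w a) (Poly_Mapping.single (rho a) (lookup f a)))"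
  unfolding Phi_def using assms by (intro sum.mono_neutral_left) (auto simp: in_keys_iff)

lemma Phi_add: "Phi (f + g) = Phi f + Phi g"
  using keys_add[of f g]
  by (simp add: Phi_superset[of "keys f \<union> keys g"] sum.distrib[symmetric] lookup_add single_add)

lemma Phi_zero [simp]: "Phi 0 = 0"
  by (simp add: Phi_def)

lemma Phi_sum: "Phi (sum f X) = (\<Sum>x\<in>X. Phi (f x))"
  by (induction X rule: infinite_finite_induct) (auto simp: Phi_add)

lemma Phi_single: "Phi (Poly_Mapping.single a x) = Poly_Mapping.single (w a) (Poly_Mapping.single (rho a) x)"
  by (subst Phi_superset[of "{a}"]) auto

lemma Phi_one: "Phi 1 = 1"
  using Phi_single[of 0 1] by (simp add: w_0 rho_0)

lemma Phi_mult: "Phi (f * g) = Phi f * Phi g"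
proof -
  let ?s = "\<lambda>f. \<Sum>a\<in>keys f. Poly_Mapping.single a (lookup f a)"
  have "Phi (f * g) = Phi (?s f * ?s g)"
    by (intro arg_cong[of _ _ Phi] arg_cong2[of _ _ _ _ "(*)"] poly_expand)
  also have "\<dots> = (\<Sum>a\<in>keys f. \<Sum>b\<in>keys g. Phi (Poly_Mapping.single a (lookup f a)) * Phi (Poly_Mapping.single b (lookup g b)))"
    by (simp add: sum_product mult_single Phi_sum Phi_single w_add rho_add)
  also have "\<dots> = Phi f * Phi g"
    unfolding Phi_def[of f] Phi_def[of g] by (simp add: sum_product Phi_single)
  finally show ?thesis .
qed

lemma lookup_Phi: "lookup (Phi f) c = (\<Sum>a\<in>{a \<in> keys f. w a = c}. Poly_Mapping.single (rho a) (lookup f a))"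
  by (simp add: Phi_def lookup_sum lookup_single when_def sum.If_cases Int_def)

text \<open>Pullback along \<open>Phi\<close> of the extended ideal p[G], hence prime when p is
  prime and G is ordered.\<close>

definition ext :: "('v, 'a::field) mpoly set \<Rightarrow> ('v, 'a) mpoly set" where
  "ext p = {f. \<forall>c. lookup (Phi f) c \<in> p}"

lemma ext_ideal: "is_ideal p \<Longrightarrow> is_ideal (ext p)"
  unfolding is_ideal_def[of "ext p"]
  by (auto simp: ext_def ideal_zero Phi_add lookup_add ideal_add Phi_mult coef_ideal_mult)

lemma ext_prime:
  assumes "prime_ideal p" "add_linorder (le :: 'g \<Rightarrow> 'g \<Rightarrow> bool)"
  shows "prime_ideal (ext p)"
proof -
  have "lookup (Phi 1) 0 \<notin> p" using assms(1) by (simp add: Phi_one prime_ideal_def)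
  then have "1 \<notin> ext p" unfolding ext_def by blast
  moreover have "is_ideal (ext p)" using assms(1) by (intro ext_ideal) (simp add: prime_ideal_def)
  moreover have "f \<in> ext p \<or> g \<in> ext p" if "f * g \<in> ext p" for f g
    using coef_prime[OF assms, of "Phi f" "Phi g"] that by (simp add: ext_def Phi_mult)
  ultimately show ?thesis unfolding prime_ideal_def by blast
qed

end

text \<open>The largest graded ideal inside Q. With the degree as index it is an instance of
  \<open>ext\<close>, which makes it prime along with Q.\<close>

definition hpart :: "('v::finite, 'a::field) mpoly set \<Rightarrow> ('v, 'a) mpoly set" where
  "hpart Q = {f. \<forall>n. hcomp n f \<in> Q}"

lemma hpart_props:
  fixes Q :: "('v::finite, 'a::field) mpoly set"
  assumes Q: "prime_ideal Q"
  shows "prime_ideal (hpart Q)" "graded_ideal (hpart Q)" "hpart Q \<subseteq> Q"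
    and "graded_ideal J \<Longrightarrow> J \<subseteq> Q \<Longrightarrow> J \<subseteq> hpart Q"
proof -
  interpret coef_map "mdeg :: ('v \<Rightarrow>\<^sub>0 nat) \<Rightarrow> nat" "\<lambda>a. a"
    by unfold_locales (auto simp: mdeg_add)
  have "lookup (Phi f) n = hcomp n f" for f :: "('v, 'a) mpoly" and n
  proof (rule poly_mapping_eqI)
    fix a
    show "lookup (lookup (Phi f) n) a = lookup (hcomp n f) a"
      by (simp add: lookup_Phi lookup_sum lookup_hcomp lookup_single when_def in_keys_iff)
  qed
  then have eq: "hpart Q = ext Q" by (simp add: hpart_def ext_def)
  show pr: "prime_ideal (hpart Q)" unfolding eq using Q add_linorder_nat by (rule ext_prime)
  have z: "0 \<in> Q" using Q by (auto simp: prime_ideal_def ideal_zero)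
  have "hcomp m (hcomp n f) = (if m = n then hcomp n f else 0)" for m n and f :: "('v, 'a) mpoly"
    by (rule hcomp_of_homog) simp
  then show "graded_ideal (hpart Q)"
    using pr z by (auto simp: graded_ideal_def prime_ideal_def hpart_def)
  show "hpart Q \<subseteq> Q" using Q hcomp_in_ideal[of Q] by (auto simp: hpart_def prime_ideal_def)
  show "J \<subseteq> hpart Q" if "graded_ideal J" "J \<subseteq> Q"
    using that by (auto simp: hpart_def graded_ideal_def)
qed

definition rst :: "'v set \<Rightarrow> ('v \<Rightarrow>\<^sub>0 nat) \<Rightarrow> ('v \<Rightarrow>\<^sub>0 nat)" where
  "rst A a = Poly_Mapping.mapp (\<lambda>v n. if v \<in> A then n else 0) a"

lemma lookup_rst: "lookup (rst A a) v = (if v \<in> A then lookup a v else 0)"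
  by (auto simp: rst_def lookup_mapp when_def in_keys_iff)

lemma rst_add: "rst A (a + b) = rst A a + rst A b"
  by (rule poly_mapping_eqI) (simp add: lookup_rst lookup_add)

lemma rst_0: "rst A 0 = 0"
  by (rule poly_mapping_eqI) (simp add: lookup_rst)

lemma rst_sum: "rst (- A) a + rst A a = a"
  by (rule poly_mapping_eqI) (simp add: lookup_rst lookup_add)

lemma keys_rst: "keys (rst A a) = keys a \<inter> A"
  by (auto simp: in_keys_iff lookup_rst split: if_splits)

text \<open>The variables outside A form the index monoid, those in A the coefficients.\<close>

lemma coef_map_rst: "coef_map (rst (- A)) (rst A)"
  by unfold_locales (auto simp: rst_add rst_0)

text \<open>The extension to S of the prime p \<inter> K[A]. Letting A grow from a maximal independent
  set of variables to the set of all variables gives a chain of primes below p that bounds its height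
  from below.\<close>

definition extW :: "'v::finite set \<Rightarrow> ('v, 'a::field) mpoly set \<Rightarrow> ('v, 'a) mpoly set" where
  "extW A p = coef_map.ext (rst (- A)) (rst A) p"

context mon_order
begin

lemma extW_prime: "prime_ideal p \<Longrightarrow> prime_ideal (extW A (p :: ('v, 'a::field) mpoly set))"
  unfolding extW_def using coef_map.ext_prime[OF coef_map_rst _ le_add_linorder] by blast

end

text \<open>Both parts together identify \<open>extW A p\<close> as the ideal generated by p
  \<inter> K[A]: f is a sum of monomials in the other variables times coefficients that lie in p and
  in K[A].\<close>

lemma extW_generated:
  fixes p :: "('v::finite, 'a::field) mpoly set"
  assumes p: "is_ideal p"
  shows "p \<inter> polys_on {a. keys a \<subseteq> A} \<subseteq> extW A p"
    and "is_ideal Q \<Longrightarrow> p \<inter> polys_on {a. keys a \<subseteq> A} \<subseteq> Q \<Longrightarrow> extW A p \<subseteq> Q"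
proof -
  interpret coef_map "rst (- A)" "rst A" by (rule coef_map_rst)
  show "p \<inter> polys_on {a. keys a \<subseteq> A} \<subseteq> extW A p"
  proof
    fix f assume f: "f \<in> p \<inter> polys_on {a. keys a \<subseteq> A}"
    have 1: "rst (- A) a = 0" "rst A a = a" if "a \<in> keys f" for a
    proof -
      have *: "v \<in> A \<or> lookup a v = 0" for v using f that by (auto simp: polys_on_def in_keys_iff subset_iff)
      have "lookup (rst (- A) a) v = lookup 0 v" "lookup (rst A a) v = lookup a v" for v
        using *[of v] by (auto simp: lookup_rst)
      then show "rst (- A) a = 0" "rst A a = a" by (auto intro: poly_mapping_eqI)
    qed
    have "lookup (Phi f) c \<in> p" for c
    proof (cases "c = 0")
      case True
      then have "lookup (Phi f) c = (\<Sum>a\<in>keys f. Poly_Mapping.single a (lookup f a))"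
        unfolding lookup_Phi using 1 by (intro sum.cong) auto
      then have "lookup (Phi f) c = f" using poly_expand[of f] by simp
      then show ?thesis using f by simp
    next
      case False
      then have "{a \<in> keys f. rst (- A) a = c} = {}" using 1 by auto
      then have "lookup (Phi f) c = 0" unfolding lookup_Phi by (simp only: sum.empty)
      then show ?thesis using ideal_zero[OF p] by simp
    qed
    then show "f \<in> extW A p" by (simp add: extW_def ext_def)
  qed
  assume Q: "is_ideal Q" "p \<inter> polys_on {a. keys a \<subseteq> A} \<subseteq> Q"
  show "extW A p \<subseteq> Q"
  proof
    fix f assume f: "f \<in> extW A p"
    let ?w = "rst (- A) :: ('v \<Rightarrow>\<^sub>0 nat) \<Rightarrow> _"
    have "monom c * lookup (Phi f) c = (\<Sum>a\<in>{a \<in> keys f. ?w a = c}. Poly_Mapping.single a (lookup f a))" for c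
      unfolding lookup_Phi sum_distrib_left monom_def mult_single
      by (intro sum.cong) (auto simp: rst_sum)
    then have "(\<Sum>c\<in>?w ` keys f. monom c * lookup (Phi f) c) = (\<Sum>a\<in>keys f. Poly_Mapping.single a (lookup f a))"
      by (simp add: sum.group)
    then have "f = (\<Sum>c\<in>?w ` keys f. monom c * lookup (Phi f) c)" using poly_expand[of f] by simp
    also have "\<dots> \<in> Q"
    proof (intro ideal_sum[OF Q(1)] ideal_mult[OF Q(1)])
      fix c
      have "keys (lookup (Phi f) c) \<subseteq> (\<Union>a\<in>{a \<in> keys f. ?w a = c}. keys (Poly_Mapping.single (rst A a) (lookup f a)))"
        unfolding lookup_Phi by (rule keys_sum)
      also have "\<dots> \<subseteq> {a. keys a \<subseteq> A}" by (auto simp: keys_rst)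
      finally have "lookup (Phi f) c \<in> polys_on {a. keys a \<subseteq> A}" by (simp add: polys_on_def)
      moreover have "lookup (Phi f) c \<in> p" using f by (simp add: extW_def ext_def)
      ultimately show "lookup (Phi f) c \<in> Q" using Q(2) by blast
    qed
    finally show "f \<in> Q" .
  qed
qed

lemma extW_UNIV:
  fixes p :: "('v::finite, 'a::field) mpoly set"
  assumes "is_ideal p"
  shows "extW UNIV p = p"
  using extW_generated(1)[OF assms, of UNIV] extW_generated(2)[OF assms assms, of UNIV]
  by (auto simp: polys_on_def)

lemma extW_mono:
  fixes p :: "('v::finite, 'a::field) mpoly set"
  assumes p: "is_ideal p" and "A \<subseteq> B"
  shows "extW A p \<subseteq> extW B p"
proof (rule extW_generated(2)[OF p])
  show "is_ideal (extW B p)"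
    unfolding extW_def by (rule coef_map.ext_ideal[OF coef_map_rst p])
  show "p \<inter> polys_on {a. keys a \<subseteq> A} \<subseteq> extW B p"
    using extW_generated(1)[OF p, of B] polys_on_mono[of "{a. keys a \<subseteq> A}" "{a. keys a \<subseteq> B}"] assms(2) by blast
qed

context deg_order
begin

text \<open>A nonzero g of p in K[A, x] separates the two. Over W, which lacks x, its coefficients
  lie in K[A]; if they were in p, independence of A would make them vanish, and g with them.\<close>

lemma extW_strict:
  fixes p :: "('v, 'a::field) mpoly set"
  assumes p: "is_ideal p" and A: "indep p A" and x: "\<not> indep p (insert x A)"
    and W: "A \<subseteq> W" "x \<notin> W"
  shows "extW W p \<subset> extW (insert x W) p"
proof -
  obtain g where g: "g \<in> p" "g \<noteq> 0" "g \<in> polys_on {a. keys a \<subseteq> insert x A}"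
    using x by (auto simp: indep_def)
  interpret coef_map "rst (- W)" "rst W" by (rule coef_map_rst)
  have "g \<in> polys_on {a. keys a \<subseteq> insert x W}" using g(3) W(1) by (auto simp: polys_on_def)
  then have "g \<in> extW (insert x W) p" using g(1) extW_generated(1)[OF p, of "insert x W"] by blast
  moreover have "g \<notin> extW W p"
  proof
    assume "g \<in> extW W p"
    obtain a where a: "a \<in> keys g" using lead_keys[OF g(2)] by blast
    define c where "c = rst (- W) a"
    define q where "q = lookup (Phi g) c"
    have "q \<in> p" using \<open>g \<in> extW W p\<close> by (simp add: q_def extW_def ext_def)
    have "keys q \<subseteq> (\<Union>b\<in>{b \<in> keys g. rst (- W) b = c}. keys (Poly_Mapping.single (rst W b) (lookup g b)))"
      unfolding q_def lookup_Phi by (rule keys_sum)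
    also have "\<dots> \<subseteq> {b. keys b \<subseteq> A}" 
    proof clarify
      fix b x' v assume "b \<in> keys g" "x' \<in> keys (Poly_Mapping.single (rst W b) (lookup g b))" "v \<in> keys x'"
      then have "v \<in> keys b" "v \<in> W" "keys b \<subseteq> insert x A"
        using g(3) by (auto simp: keys_rst polys_on_def split: if_splits)
      then show "v \<in> A" using W by blast
    qed
    finally have "q = 0" using A \<open>q \<in> p\<close> by (auto simp: indep_def polys_on_def)
    moreover have "lookup q (rst W a) = lookup g a"
    proof -
      have "lookup q (rst W a) = (\<Sum>b\<in>{b \<in> keys g. rst (- W) b = c}. lookup g b when rst W b = rst W a)"
        by (simp add: q_def lookup_Phi lookup_sum lookup_single)
      also have "\<dots> = (\<Sum>b\<in>{b \<in> keys g. rst (- W) b = c}. lookup g b when b = a)"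
      proof (intro sum.cong refl)
        fix b assume "b \<in> {b \<in> keys g. rst (- W) b = c}"
        then have "rst W b = rst W a \<longleftrightarrow> b = a" unfolding c_def by (metis (mono_tags, lifting) mem_Collect_eq rst_sum)
        then show "(lookup g b when rst W b = rst W a) = (lookup g b when b = a)" by simp
      qed
      also have "\<dots> = lookup g a" using a by (simp add: when_def c_def)
      finally show ?thesis .
    qed
    ultimately show False using a by (simp add: in_keys_iff)
  qed
  ultimately show ?thesis using extW_mono[OF p, of W "insert x W"] by blast
qed

section \<open>Height and Krull dimension\<close>

lemma prime_chain_gdim:
  fixes P :: "nat \<Rightarrow> ('v, 'a::field) mpoly set"
  assumes "prime_chain n P"
  shows "gdim (P n) + n \<le> gdim (P 0)"
  using assms
proof (induction n)
  case (Suc n)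
  then have "gdim (P n) + n \<le> gdim (P 0)" by (simp add: prime_chain_def)
  moreover have "gdim (P (Suc n)) < gdim (P n)"
    using Suc.prems by (intro prime_strict_gdim) (auto simp: prime_chain_def prime_ideal_def)
  ultimately show ?case by simp
qed simp

lemma gdim_le_card: "gdim J \<le> card (UNIV :: 'v set)" if "is_ideal J" "1 \<notin> J" for J :: "('v, 'a::field) mpoly set"
  using gdim_attained[OF that] card_mono[of "UNIV :: 'v set"] by (metis finite subset_UNIV)

text \<open>The strict drop of \<open>gdim\<close> bounds chains from above. For the chain of
  \<open>extW\<close> ideals, A is independent of maximal size, so adding any variable destroys
  independence and every step is strict.\<close>

lemma height_eq:
  fixes p :: "('v, 'a::field) mpoly set"
  assumes p: "prime_ideal p"
  shows "height p = card (UNIV :: 'v set) - gdim p"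
  unfolding height_def
proof (rule cSup_eq_maximum)
  have pi: "is_ideal p" "1 \<notin> p" using p by (auto simp: prime_ideal_def)
  obtain A where A: "indep p A" "card A = gdim p" using gdim_attained[OF pi] .
  obtain xs where xs: "set xs = - A" "distinct xs" using finite_distinct_list[of "- A"] by auto
  define P where "P i = extW (A \<union> set (take i xs)) p" for i
  have len: "length xs = card (UNIV :: 'v set) - gdim p"
    using xs A(2) distinct_card[OF xs(2)] by (simp add: Compl_eq_Diff_UNIV card_Diff_subset)
  have "P i \<subset> P (Suc i)" if "i < length xs" for i
  proof -
    have t: "set (take (Suc i) xs) = insert (xs ! i) (set (take i xs))"
      using that by (simp add: take_Suc_conv_app_nth)
    have "xs ! i \<notin> A" using xs(1) that nth_mem by blast
    moreover have "xs ! i \<notin> set (take i xs)"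
      using xs(2) that by (auto simp: in_set_conv_nth nth_eq_iff_index_eq)
    moreover have "\<not> indep p (insert (xs ! i) A)"
      using indep_card_le[OF pi(1), of "insert (xs ! i) A"] A(2) \<open>xs ! i \<notin> A\<close> by auto
    ultimately show ?thesis
      unfolding P_def t using extW_strict[OF pi(1) A(1), of "xs ! i" "A \<union> set (take i xs)"] by simp
  qed
  moreover have "prime_ideal (P i)" for i unfolding P_def using p by (rule extW_prime)
  moreover have "P (length xs) = p" unfolding P_def using xs(1) extW_UNIV[OF pi(1)] by simp
  ultimately show "card (UNIV :: 'v set) - gdim p \<in> {n. \<exists>P. prime_chain n P \<and> P n = p}"
    unfolding len[symmetric] prime_chain_def by blast
next
  fix n assume "n \<in> {n. \<exists>P. prime_chain n P \<and> P n = p}"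
  then obtain P where P: "prime_chain n P" "P n = p" by blast
  have "prime_ideal (P 0)" using P(1) by (simp add: prime_chain_def)
  then have "gdim (P 0) \<le> card (UNIV :: 'v set)" by (intro gdim_le_card) (auto simp: prime_ideal_def)
  then show "n \<le> card (UNIV :: 'v set) - gdim p" using prime_chain_gdim[OF P(1)] P(2) by simp
qed

text \<open>A largest independent set stays independent in a suitable prime over J and in the
  smaller graded part of that prime, so no dimension is lost.\<close>

lemma graded_prime_above:
  fixes J :: "('v, 'a::field) mpoly set"
  assumes J: "graded_ideal J" "1 \<notin> J"
  obtains P where "prime_ideal P" "graded_ideal P" "J \<subseteq> P" "gdim P = gdim J"
proof -
  note Ji = graded_ideal_is_ideal[OF J(1)]
  obtain A where A: "indep J A" "card A = gdim J" using gdim_attained[OF Ji J(2)] .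
  obtain Q where Q: "prime_ideal Q" "J \<subseteq> Q" "indep Q A" using prime_over_indep[OF Ji A(1)] .
  note h = hpart_props[OF Q(1)]
  have JP: "J \<subseteq> hpart Q" using h(4)[OF J(1) Q(2)] .
  have "indep (hpart Q) A" using Q(3) h(3) by (auto simp: indep_def)
  then have "gdim J \<le> gdim (hpart Q)"
    using indep_card_le[of "hpart Q" A] A(2) h(1) by (simp add: prime_ideal_def)
  moreover have "gdim (hpart Q) \<le> gdim J"
    using h(1) JP by (intro gdim_mono) (auto simp: prime_ideal_def)
  ultimately show ?thesis using that[of "hpart Q"] h JP by simp
qed

lemma one_notin_insert:
  fixes J :: "('v, 'a::field) mpoly set"
  assumes J: "graded_ideal J" "1 \<notin> J" and f: "f \<in> homog e" "1 \<le> e"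
  shows "1 \<notin> ideal_gen (insert f J)"
proof
  assume "1 \<in> ideal_gen (insert f J)"
  then obtain j h where jh: "1 = j + h * f" "j \<in> J"
    using ideal_gen_insert[OF graded_ideal_is_ideal[OF J(1)]] by blast
  have "(1 :: ('v, 'a) mpoly) \<in> homog 0" by (simp add: homog_def)
  then have "1 = hcomp 0 (1 :: ('v, 'a) mpoly)" by (simp add: hcomp_of_homog)
  also have "\<dots> = hcomp 0 j" unfolding jh(1) hcomp_add using hcomp_mult_homog(2)[OF f(1), of 0 h] f(2) by simp
  finally show False using graded_hcomp[OF J(1) jh(2), of 0] J(2) by simp
qed

lemma var_homog: "var v \<in> homog 1"
  by (simp add: var_def homog_def)

lemma var_notin:
  fixes J :: "('v, 'a::field) mpoly set"
  assumes "is_ideal J" "1 \<notin> J" "1 \<le> gdim J"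
  obtains v where "var v \<notin> J"
proof -
  obtain A where A: "indep J A" "card A = gdim J" using gdim_attained[OF assms(1,2)] .
  then have "A \<noteq> {}" using assms(3) by auto
  then obtain v where v: "v \<in> A" by blast
  have "var v \<notin> J"
  proof
    assume "var v \<in> J"
    then have "var v = (0 :: ('v, 'a) mpoly)" by (rule indepD[OF A(1)]) (use v in \<open>simp add: var_def\<close>)
    then show False by (simp add: var_def)
  qed
  then show ?thesis by (rule that)
qed

text \<open>A graded prime P over J of the same dimension misses some variable; adding it costs at
  most one dimension, and the induction continues above the enlarged ideal.\<close>

lemma prime_chain_above:
  fixes J :: "('v, 'a::field) mpoly set"
  assumes "graded_ideal J" "1 \<notin> J" "r \<le> gdim J"
  shows "\<exists>P. prime_chain r P \<and> J \<subseteq> P 0"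
  using assms
proof (induction r arbitrary: J)
  case 0
  then obtain P where "prime_ideal P" "J \<subseteq> P" using graded_prime_above by metis
  then show ?case by (intro exI[of _ "\<lambda>_. P"]) (simp add: prime_chain_def)
next
  case (Suc r)
  obtain P where P: "prime_ideal P" "graded_ideal P" "J \<subseteq> P" "gdim P = gdim J"
    using graded_prime_above[OF Suc.prems(1,2)] .
  have Pi: "is_ideal P" "1 \<notin> P" using P(1) by (auto simp: prime_ideal_def)
  obtain v where vP: "var v \<notin> P" using var_notin[OF Pi] Suc.prems(3) P(4) by auto
  let ?K = "ideal_gen (insert (var v) P)"
  have K1: "1 \<notin> ?K" by (rule one_notin_insert[OF P(2) Pi(2) var_homog]) simp
  have "gdim P \<le> gdim ?K + 1" by (rule gdim_insert_homog[OF P(2) var_homog _ K1]) simp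
  then have "r \<le> gdim ?K" using Suc.prems(3) P(4) by simp
  then obtain C where C: "prime_chain r C" "?K \<subseteq> C 0"
    using Suc.IH[OF graded_insert[OF P(2) var_homog] K1] by blast
  have "P \<subset> C 0" using C(2) vP ideal_gen_superset[of "insert (var v) P"] by blast
  then have "prime_chain (Suc r) (\<lambda>i. case i of 0 \<Rightarrow> P | Suc i \<Rightarrow> C i)"
    using C(1) P(1) by (auto simp: prime_chain_def split: nat.split)
  then show ?case using P(3) by (intro exI[of _ "\<lambda>i. case i of 0 \<Rightarrow> P | Suc i \<Rightarrow> C i"]) simp
qed

lemma krull_dim_gdim:
  fixes J :: "('v, 'a::field) mpoly set"
  assumes J: "graded_ideal J" "1 \<notin> J"
  shows "krull_dim J = gdim J"
  unfolding krull_dim_def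
proof (rule cSup_eq_maximum)
  show "gdim J \<in> {n. \<exists>P. prime_chain n P \<and> J \<subseteq> P 0}"
    using prime_chain_above[OF J] by blast
next
  fix n assume "n \<in> {n. \<exists>P. prime_chain n P \<and> J \<subseteq> P 0}"
  then obtain P where P: "prime_chain n P" "J \<subseteq> P 0" by blast
  have "gdim (P 0) \<le> gdim J"
    using P by (intro gdim_mono) (auto simp: prime_chain_def prime_ideal_def)
  then show "n \<le> gdim J" using prime_chain_gdim[OF P(1)] by simp
qed

end

section \<open>Degrees\<close>

context deg_order
begin

lemma degree_limit:
  fixes J :: "('v, 'a::field) mpoly set"
  assumes J: "graded_ideal J" "1 \<notin> J" "gdim J = k" "1 \<le> k"
  obtains N :: nat where "1 \<le> N" "degree_quot J = real N"
    "(\<lambda>d. real (scount J d) / real d ^ (k - 1)) \<longlonglongrightarrow> real N / fact (k - 1)"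
proof -
  note Ji = graded_ideal_is_ideal[OF J(1)]
  obtain N :: nat where N: "1 \<le> N"
    "(\<lambda>d. real (scount J d) / real d ^ (k - 1)) \<longlonglongrightarrow> real N / fact (k - 1)"
    using count_limit[of "lms J"] upset_lms[OF Ji] lms_zero_iff[OF Ji] J
    unfolding gdim_def scount_def by blast
  have "degree_quot J = fact (k - 1) * lim (\<lambda>d. real (scount J d) / real d ^ (k - 1))"
    using J(3,4) by (simp add: degree_quot_def krull_dim_gdim[OF J(1,2)] hilbert_fun_scount[OF J(1)])
  also have "\<dots> = real N" using limI[OF N(2)] by simp
  finally show ?thesis using that N by blast
qed

text \<open>Only leads are compared, because \<open>foot a\<close> need not lie in K even when its
  leads are leads of K.\<close>

lemma degree_le:
  fixes J K :: "('v, 'a::field) mpoly set"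
  assumes J: "graded_ideal J" "1 \<notin> J" "1 \<le> gdim J" and K: "graded_ideal K" "1 \<notin> K" "gdim K = gdim J"
    and JK: "lms J \<subseteq> lms K"
  shows "degree_quot K \<le> degree_quot J"
proof -
  obtain N where N: "degree_quot J = real N"
    "(\<lambda>d. real (scount J d) / real d ^ (gdim J - 1)) \<longlonglongrightarrow> real N / fact (gdim J - 1)"
    using degree_limit[OF J(1,2) refl J(3)] by blast
  obtain M where M: "degree_quot K = real M"
    "(\<lambda>d. real (scount K d) / real d ^ (gdim J - 1)) \<longlonglongrightarrow> real M / fact (gdim J - 1)"
    using degree_limit[OF K J(3)] by blast
  have "real M / fact (gdim J - 1) \<le> real N / fact (gdim J - 1)"
    by (rule LIMSEQ_le[OF M(2) N(2)]) (auto intro!: divide_right_mono scount_antimono JK)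
  then show ?thesis using N(1) M(1) by (simp add: divide_le_cancel)
qed

text \<open>Additivity along the exact sequence of f; all three quotients share one dimension, so
  the same power of d normalises them.\<close>

lemma degree_add:
  fixes J :: "('v, 'a::field) mpoly set"
  assumes J: "graded_ideal J" "1 \<notin> J" "1 \<le> gdim J" and f: "f \<in> homog e" "f \<noteq> 0"
    and K: "1 \<notin> ideal_gen (insert f J)" "gdim (ideal_gen (insert f J)) = gdim J"
    and C: "1 \<notin> colon J f" "gdim (colon J f) = gdim J"
  shows "degree_quot J = degree_quot (ideal_gen (insert f J)) + degree_quot (colon J f)"
proof -
  define m where "m = gdim J - 1"
  obtain N where N: "degree_quot J = real N"
    "(\<lambda>d. real (scount J d) / real d ^ m) \<longlonglongrightarrow> real N / fact m"
    using degree_limit[OF J(1,2) refl J(3)] unfolding m_def by blast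
  obtain M where M: "degree_quot (ideal_gen (insert f J)) = real M"
    "(\<lambda>d. real (scount (ideal_gen (insert f J)) d) / real d ^ m) \<longlonglongrightarrow> real M / fact m"
    using degree_limit[OF graded_insert[OF J(1) f(1)] K J(3)] unfolding m_def by blast
  obtain L where L: "degree_quot (colon J f) = real L"
    "(\<lambda>d. real (scount (colon J f) d) / real d ^ m) \<longlonglongrightarrow> real L / fact m"
    using degree_limit[OF graded_colon[OF J(1) f(1)] C J(3)] unfolding m_def by blast
  \<comment> \<open>The colon term lags by e degrees; (d/(d + e))^m tends to 1 and adjusts its
    denominator.\<close>
  have "(\<lambda>d. inverse (real (d - 0 + e) / real d)) \<longlonglongrightarrow> inverse 1"
    by (rule tendsto_inverse[OF tendsto_shift]) simp
  then have "(\<lambda>d. real d / real (d + e)) \<longlonglongrightarrow> 1" by simp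
  then have "(\<lambda>d. (real d / real (d + e)) ^ m) \<longlonglongrightarrow> 1 ^ m" by (rule tendsto_power)
  from tendsto_mult[OF L(2) this]
  have "(\<lambda>d. real (scount (colon J f) d) / real d ^ m * (real d / real (d + e)) ^ m) \<longlonglongrightarrow> real L / fact m"
    by simp
  moreover have "eventually (\<lambda>d. real (scount (colon J f) d) / real d ^ m * (real d / real (d + e)) ^ m
      = real (scount (colon J f) d) / real (d + e) ^ m) sequentially"
    using eventually_gt_at_top[of 0] by eventually_elim (simp add: power_divide)
  ultimately have L': "(\<lambda>d. real (scount (colon J f) d) / real (d + e) ^ m) \<longlonglongrightarrow> real L / fact m"
    using tendsto_cong by fast
  have "(\<lambda>d. real (scount (ideal_gen (insert f J)) (d + e)) / real (d + e) ^ m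
      + real (scount (colon J f) d) / real (d + e) ^ m) \<longlonglongrightarrow> real M / fact m + real L / fact m"
    by (intro tendsto_add L' LIMSEQ_ignore_initial_segment[OF M(2)])
  moreover have "real (scount (ideal_gen (insert f J)) (d + e)) / real (d + e) ^ m
      + real (scount (colon J f) d) / real (d + e) ^ m = real (scount J (d + e)) / real (d + e) ^ m" for d
    by (simp add: scount_colon(1)[OF J(1) f(2,1), symmetric] add_divide_distrib)
  ultimately have "real N / fact m = real M / fact m + real L / fact m"
    using LIMSEQ_unique[OF LIMSEQ_ignore_initial_segment[OF N(2), of e]] by simp
  then have "real N / fact m = (real M + real L) / fact m" by (simp only: add_divide_distrib)
  then show ?thesis using N(1) M(1) L(1) by simp
qed

section \<open>Associated primes\<close>

text \<open>A maximal proper colon ideal is prime. Restricting to multiples of f makes the resulting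
  prime contain (J:f).\<close>

lemma ass_prime_colon:
  fixes J :: "('v, 'a::field) mpoly set"
  assumes J: "is_ideal J" and f: "f \<notin> J"
  obtains g where "prime_ideal (colon J (f * g))"
proof -
  define JJ where "JJ = {colon J (f * g) | g. f * g \<notin> J}"
  have ne: "JJ \<noteq> {}" "\<And>C. C \<in> JJ \<Longrightarrow> is_ideal C"
    using f colon_ideal[OF J] unfolding JJ_def by (auto intro: exI[of _ 1])
  obtain C where C: "C \<in> JJ" "\<And>C'. C' \<in> JJ \<Longrightarrow> C \<subseteq> C' \<Longrightarrow> C' = C"
    using ideal_maximal[OF ne] by blast
  then obtain g where g: "C = colon J (f * g)" "f * g \<notin> J" by (auto simp: JJ_def)
  have "a \<in> C \<or> b \<in> C" if ab: "a * b \<in> C" for a b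
  proof (rule ccontr)
    assume no: "\<not> (a \<in> C \<or> b \<in> C)"
    have "f * (g * a) \<notin> J" using no g(1) by (simp add: colon_def mult_ac)
    then have "colon J (f * (g * a)) \<in> JJ" by (auto simp: JJ_def)
    moreover have "colon J (f * (g * a)) = colon C a" unfolding g(1) colon_colon by (simp add: mult_ac)
    moreover have "C \<subseteq> colon C a" using ne(2)[OF C(1)] by (rule colon_superset)
    ultimately have "colon C a = C" using C(2) by metis
    moreover have "b \<in> colon C a" using ab by (simp add: colon_def mult.commute)
    ultimately show False using no by blast
  qed
  moreover have "1 \<notin> C" using g by (simp add: colon_def)
  ultimately have "prime_ideal C" using ne(2)[OF C(1)] by (simp add: prime_ideal_def)
  then show ?thesis using that g(1) by blast
qed

text \<open>A colon ideal C maximal among those inside P is prime. If ab is in C but a and b are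
  not, C:a is larger and leaves P, giving u outside P with ua in C; yet C:u stays inside the prime
  P, so it equals C and contains a.\<close>

lemma ass_prime_below:
  fixes J :: "('v, 'a::field) mpoly set"
  assumes J: "is_ideal J" and P: "prime_ideal P" "J \<subseteq> P"
  obtains p where "p \<in> ass_primes J" "p \<subseteq> P"
proof -
  have Pi: "is_ideal P" "1 \<notin> P" and Pp: "\<And>a b. a * b \<in> P \<Longrightarrow> a \<in> P \<or> b \<in> P"
    using P(1) by (auto simp: prime_ideal_def)
  define JJ where "JJ = {colon J h | h. colon J h \<subseteq> P}"
  have "colon J 1 \<subseteq> P" using P(2) by (simp add: colon_def)
  then have ne: "JJ \<noteq> {}" "\<And>C. C \<in> JJ \<Longrightarrow> is_ideal C"
    using colon_ideal[OF J] unfolding JJ_def by auto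
  obtain C where C: "C \<in> JJ" "\<And>C'. C' \<in> JJ \<Longrightarrow> C \<subseteq> C' \<Longrightarrow> C' = C"
    using ideal_maximal[OF ne] by blast
  then obtain h where h: "C = colon J h" "colon J h \<subseteq> P" by (auto simp: JJ_def)
  have Ci: "is_ideal C" by (rule ne(2)[OF C(1)])
  have "a \<in> C \<or> b \<in> C" if ab: "a * b \<in> C" for a b
  proof (rule ccontr)
    assume no: "\<not> (a \<in> C \<or> b \<in> C)"
    have "b \<in> colon C a" using ab by (simp add: colon_def mult.commute)
    then have "colon C a \<noteq> C" using no by blast
    moreover have "colon C a = colon J (h * a)" unfolding h(1) colon_colon ..
    ultimately have "\<not> colon C a \<subseteq> P"
      using C(2)[of "colon C a"] colon_superset[OF Ci, of a] by (auto simp: JJ_def)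
    then obtain u where u: "u \<notin> P" "u * a \<in> C" by (auto simp: colon_def)
    have "colon C u \<subseteq> P"
    proof
      fix x assume "x \<in> colon C u"
      then have "x * u \<in> P" using h by (auto simp: colon_def)
      then show "x \<in> P" using Pp u(1) by blast
    qed
    moreover have "colon C u = colon J (h * u)" unfolding h(1) colon_colon ..
    ultimately have "colon C u = C"
      using C(2)[of "colon C u"] colon_superset[OF Ci, of u] by (auto simp: JJ_def)
    moreover have "a \<in> colon C u" using u(2) by (simp add: colon_def mult.commute)
    ultimately show False using no by blast
  qed
  moreover have "1 \<notin> C" using h Pi(2) by blast
  ultimately have "prime_ideal C" using Ci by (simp add: prime_ideal_def)
  then have "C \<in> ass_primes J" using h(1) by (auto simp: ass_primes_def)
  then show ?thesis using that h by blast
qed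

section \<open>Primes generated by linear forms\<close>

lemma gdim_zero: "gdim ({0} :: ('v, 'a::field) mpoly set) = card (UNIV :: 'v set)"
proof -
  have "lms ({0} :: ('v, 'a) mpoly set) = {}" by (auto simp: lms_def)
  then have "card (UNIV :: 'v set) \<le> gdim ({0} :: ('v, 'a) mpoly set)"
    unfolding gdim_def by (intro udim_ge) (simp add: free_def)
  moreover have "gdim ({0} :: ('v, 'a) mpoly set) \<le> card (UNIV :: 'v set)"
    by (rule gdim_le_card) (auto simp: is_ideal_def)
  ultimately show ?thesis by simp
qed

lemma ideal_gen_insert_gen: "ideal_gen (insert x (ideal_gen X)) = ideal_gen (insert x X)"
proof (rule subset_antisym)
  show "ideal_gen (insert x (ideal_gen X)) \<subseteq> ideal_gen (insert x X)"
  proof (rule ideal_gen_least[OF ideal_gen_ideal])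
    have "ideal_gen X \<subseteq> ideal_gen (insert x X)"
      using ideal_gen_superset[of "insert x X"] by (intro ideal_gen_least ideal_gen_ideal) auto
    then show "insert x (ideal_gen X) \<subseteq> ideal_gen (insert x X)"
      using ideal_gen_superset[of "insert x X"] by blast
  qed
  show "ideal_gen (insert x X) \<subseteq> ideal_gen (insert x (ideal_gen X))"
    using ideal_gen_superset[of "insert x (ideal_gen X)"] ideal_gen_superset[of X]
    by (intro ideal_gen_least ideal_gen_ideal) auto
qed

text \<open>Induction from the zero ideal: each linear form costs at most one dimension.\<close>

lemma gdim_linear_forms:
  fixes X :: "('v, 'a::field) mpoly set"
  assumes "finite X" "X \<subseteq> homog 1"
  shows "graded_ideal (ideal_gen X) \<and> 1 \<notin> ideal_gen X
    \<and> card (UNIV :: 'v set) \<le> gdim (ideal_gen X) + card X"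
  using assms
proof (induction X)
  case empty
  have "is_ideal ({0} :: ('v, 'a) mpoly set)" by (simp add: is_ideal_def)
  then have "ideal_gen {} = ({0} :: ('v, 'a) mpoly set)"
    using ideal_gen_least[of "{0}" "{}"] ideal_zero[OF ideal_gen_ideal] by blast
  then show ?case using \<open>is_ideal {0}\<close> by (simp add: graded_ideal_def gdim_zero)
next
  case (insert x X)
  then have IH: "graded_ideal (ideal_gen X)" "1 \<notin> ideal_gen X"
    "card (UNIV :: 'v set) \<le> gdim (ideal_gen X) + card X" and x: "x \<in> homog 1" by auto
  have 1: "1 \<notin> ideal_gen (insert x (ideal_gen X))" by (rule one_notin_insert[OF IH(1,2) x]) simp
  have "gdim (ideal_gen X) \<le> gdim (ideal_gen (insert x (ideal_gen X))) + 1"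
    by (rule gdim_insert_homog[OF IH(1) x _ 1]) simp
  then show ?case
    using IH(3) 1 graded_insert[OF IH(1) x] insert.hyps unfolding ideal_gen_insert_gen by simp
qed

text \<open>Let B be the variables that are leads of p. At most |B| linear forms generate p, so the
  dimension is at least the number of variables outside B. Standard monomials involve only those, so
  the Hilbert function is at most that of a polynomial ring in \<open>gdim p\<close>
  variables.\<close>

lemma degree_linear_prime:
  fixes p :: "('v, 'a::field) mpoly set"
  assumes p: "prime_ideal p" "1 \<le> gdim p" and L: "L \<subseteq> homog 1" "p = ideal_gen L"
  shows "degree_quot p = 1"
proof -
  have pi: "is_ideal p" "1 \<notin> p" using p by (auto simp: prime_ideal_def)
  note h = hpart_props[OF p(1)]
  have "L \<subseteq> hpart p"
  proof
    fix l assume l: "l \<in> L"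
    then have "l \<in> p" "l \<in> homog 1" using L ideal_gen_superset by auto
    then show "l \<in> hpart p" using ideal_zero[OF pi(1)] by (simp add: hpart_def hcomp_of_homog)
  qed
  then have "p \<subseteq> hpart p"
    unfolding L(2) using h(1) by (intro ideal_gen_least) (auto simp: prime_ideal_def L(2))
  then have gr: "graded_ideal p" using h by (metis subset_antisym)
  let ?s = "\<lambda>v. Poly_Mapping.single v (1::nat)"
  define B where "B = {v. ?s v \<in> lms p}"
  have "\<forall>v\<in>B. \<exists>g. g \<in> p \<inter> homog 1 \<and> g \<noteq> 0 \<and> lead g = ?s v"
  proof
    fix v assume "v \<in> B"
    then have "?s v \<in> lms (p \<inter> polys_on {a. mdeg a = 1})" by (simp add: B_def lms_eq_window[OF gr])
    then show "\<exists>g. g \<in> p \<inter> homog 1 \<and> g \<noteq> 0 \<and> lead g = ?s v" by (auto simp: homog_eq elim: lmsE)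
  qed
  then obtain g where g: "\<And>v. v \<in> B \<Longrightarrow> g v \<in> p \<inter> homog 1 \<and> g v \<noteq> 0 \<and> lead (g v) = ?s v" by metis
  define J where "J = ideal_gen (g ` B)"
  have "finite (g ` B)" "g ` B \<subseteq> homog 1" using g by auto
  note J = gdim_linear_forms[OF this, folded J_def]
  have Ji: "is_ideal J" by (simp add: J_def ideal_gen_ideal)
  have Jp: "J \<subseteq> p" unfolding J_def using g by (intro ideal_gen_least pi(1)) auto
  \<comment> \<open>Exponents of degree one are single variables, so the forms g v realise all leads
    of p there; degree one suffices because L consists of linear forms.\<close>
  have "J \<inter> homog 1 = p \<inter> homog 1"
  proof (rule subspace_eq_lms)
    show "lms (p \<inter> homog 1) \<subseteq> lms (J \<inter> homog 1)"
    proof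
      fix a assume "a \<in> lms (p \<inter> homog 1)"
      then have a: "a \<in> lms p" "mdeg a = 1"
        using lms_eq_window[OF gr, of 1] by (auto simp: homog_eq)
      have "a \<noteq> 0" using a(2) by auto
      then obtain v where v: "lookup a v \<noteq> 0" by (metis lookup_zero poly_mapping_eqI)
      then have "a = ?s v + (a - ?s v)"
        by (intro poly_mapping_eqI) (auto simp: lookup_add lookup_minus lookup_single when_def)
      moreover from this have "a - ?s v = 0"
        using a(2) by (metis add_left_cancel mdeg_add mdeg_eq_0 mdeg_single add_0_right)
      ultimately have "a = ?s v" by simp
      then have vB: "v \<in> B" using a(1) by (simp add: B_def)
      then have "g v \<in> J \<inter> homog 1" using g ideal_gen_superset[of "g ` B"] by (auto simp: J_def)
      then show "a \<in> lms (J \<inter> homog 1)" using g[OF vB] lmsI[of "g v" "J \<inter> homog 1"] \<open>a = ?s v\<close> by simp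
    qed
  qed (use Jp in \<open>auto simp: homog_eq intro!: subspace_window pi Ji\<close>)
  then have "L \<subseteq> J" using L ideal_gen_superset[of L] by blast
  then have "p = J" using Jp ideal_gen_least[OF Ji] L(2) by blast
  then have "card (UNIV :: 'v set) \<le> gdim p + card (g ` B)" using J by simp
  also have "card (g ` B) \<le> card B" by (rule card_image_le) simp
  finally have le: "card (- B) \<le> gdim p" by (simp add: Compl_eq_Diff_UNIV card_Diff_subset)
  have keysB: "keys a \<subseteq> - B" if "a \<notin> lms p" for a
  proof
    fix v assume "v \<in> keys a"
    then have "a = ?s v + (a - ?s v)"
      by (intro poly_mapping_eqI) (auto simp: lookup_add lookup_minus lookup_single when_def in_keys_iff)
    then show "v \<in> - B" using lms_add[OF pi(1), of "?s v" "a - ?s v"] that by (auto simp: B_def)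
  qed
  obtain A where A: "free (lms p) A" "card A = gdim p"
    using udim_attained[of "lms p"] lms_zero_iff[OF pi(1)] pi(2) by (auto simp: gdim_def)
  have "A \<subseteq> - B"
  proof
    fix v assume "v \<in> A"
    then have "keys (?s v) \<subseteq> A" by simp
    then show "v \<in> - B" using A(1) by (auto simp: free_def B_def)
  qed
  then have "card A \<le> card (- B)" by (intro card_mono) auto
  then have card: "card (- B) = gdim p" using le A(2) by simp
  then have ne: "- B \<noteq> {}" using p(2) by auto
  obtain N where N: "1 \<le> N" "degree_quot p = real N"
    "(\<lambda>d. real (scount p d) / real d ^ (gdim p - 1)) \<longlonglongrightarrow> real N / fact (gdim p - 1)"
    using degree_limit[OF gr pi(2) refl p(2)] .
  have "scount p d \<le> (gdim p - 1 + (d - 0)) choose (gdim p - 1)" for d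
  proof -
    have "scount p d \<le> card (mons (- B) d)"
      unfolding scount_def using keysB by (intro card_mono finite_mons) (auto simp: mons_def)
    then show ?thesis by (simp add: card_mons[OF ne] card)
  qed
  then have "real N / fact (gdim p - 1) \<le> 1 / fact (gdim p - 1)"
    by (intro LIMSEQ_le[OF N(3) binomial_limit[of "gdim p - 1" 0]])
      (auto intro!: divide_right_mono exI[of _ 0] simp del: diff_zero)
  then have "real N \<le> 1" by (simp add: divide_le_cancel)
  then show ?thesis using N(1,2) by simp
qed

end

lemma polys_on_ideal:
  assumes E: "upset E"
  shows "is_ideal (polys_on E :: ('v, 'a::field) mpoly set)"
  unfolding is_ideal_def
proof (intro conjI ballI allI)
  show "0 \<in> (polys_on E :: ('v, 'a) mpoly set)" by (simp add: polys_on_def)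
next
  fix f g :: "('v, 'a) mpoly" assume "f \<in> polys_on E" "g \<in> polys_on E"
  then show "f + g \<in> polys_on E" by (rule kv.subspace_add[OF polys_on_subspace])
next
  fix f h :: "('v, 'a) mpoly" assume "f \<in> polys_on E"
  then show "h * f \<in> polys_on E"
    unfolding mult.commute[of h f]
    by (rule polys_on_mult[of f E h UNIV]) (auto simp: polys_on_def intro: upsetD[OF E])
qed

section \<open>Unmixed ideals\<close>

locale unmixed_ideal = deg_order le
  for le :: "('v::finite \<Rightarrow>\<^sub>0 nat) \<Rightarrow> ('v \<Rightarrow>\<^sub>0 nat) \<Rightarrow> bool" +
  fixes I :: "('v, 'a::field) mpoly set"
  assumes gr: "graded_ideal I" and proper: "1 \<notin> I" and um: "unmixed I" and pos: "1 \<le> gdim I"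
begin

lemma Ii: "is_ideal I"
  using gr by (rule graded_ideal_is_ideal)

lemma ass_primeD:
  assumes "p \<in> ass_primes I"
  shows "prime_ideal p" "is_ideal p" "1 \<notin> p" "I \<subseteq> p"
  using assms colon_superset[OF Ii] by (auto simp: ass_primes_def prime_ideal_def)

text \<open>Some associated prime lies below a graded prime of the dimension of I and so has that
  dimension; unmixedness passes it on to the others.\<close>

lemma ass_gdim:
  assumes p: "p \<in> ass_primes I"
  shows "gdim p = gdim I"
proof -
  obtain P where P: "prime_ideal P" "I \<subseteq> P" "gdim P = gdim I"
    using graded_prime_above[OF gr proper] by blast
  obtain q where q: "q \<in> ass_primes I" "q \<subseteq> P" using ass_prime_below[OF Ii P(1,2)] .
  have "gdim P \<le> gdim q" using P(1) q(2) by (intro gdim_mono) (auto simp: prime_ideal_def)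
  moreover have "gdim q \<le> gdim I" using ass_primeD[OF q(1)] by (intro gdim_mono)
  ultimately have "gdim q = gdim I" using P(3) by simp
  moreover have "height p = height q" using um p q(1) unfolding unmixed_def by blast
  \<comment> \<open>Height is a truncated difference, so \<open>gdim_le_card\<close> is needed to
    recover \<open>gdim\<close> from it.\<close>
  ultimately show ?thesis
    using height_eq[OF ass_primeD(1)[OF p]] height_eq[OF ass_primeD(1)[OF q(1)]]
      gdim_le_card[OF ass_primeD(2,3)[OF p]] gdim_le_card[OF ass_primeD(2,3)[OF q(1)]] by simp
qed

lemma gdim_sandwich:
  assumes "p \<in> ass_primes I" "is_ideal J" "I \<subseteq> J" "J \<subseteq> p"
  shows "1 \<notin> J" "gdim J = gdim I"
proof -
  show 1: "1 \<notin> J" using assms(4) ass_primeD(3)[OF assms(1)] by blast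
  have "gdim J \<le> gdim I" using assms(2,3) 1 by (intro gdim_mono)
  moreover have "gdim p \<le> gdim J" using ass_primeD[OF assms(1)] assms(4) by (intro gdim_mono)
  ultimately show "gdim J = gdim I" using ass_gdim[OF assms(1)] by simp
qed

lemma ass_over_colon:
  assumes "f \<notin> I"
  obtains g where "colon I (f * g) \<in> ass_primes I" "colon I f \<subseteq> colon I (f * g)"
proof -
  obtain g where "prime_ideal (colon I (f * g))" using ass_prime_colon[OF Ii assms] .
  moreover have "colon I f \<subseteq> colon I (f * g)"
    unfolding colon_colon[symmetric] by (rule colon_superset[OF colon_ideal[OF Ii]])
  ultimately show ?thesis using that by (auto simp: ass_primes_def)
qed

lemma colon_props:
  assumes f: "f \<in> homog d" "f \<notin> I"
  shows "graded_ideal (colon I f)" "1 \<notin> colon I f" "gdim (colon I f) = gdim I"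
proof -
  obtain g where "colon I (f * g) \<in> ass_primes I" "colon I f \<subseteq> colon I (f * g)"
    using ass_over_colon[OF f(2)] .
  from gdim_sandwich[OF this(1) colon_ideal[OF Ii] colon_superset[OF Ii] this(2)]
  show "1 \<notin> colon I f" "gdim (colon I f) = gdim I" .
  show "graded_ideal (colon I f)" using gr f(1) by (rule graded_colon)
qed

text \<open>A zero-divisor f kills some h outside I, so (I,f) lies in (I:h) and hence in an
  associated prime.\<close>

lemma insert_props:
  assumes f: "f \<in> zero_divs_d I d"
  shows "graded_ideal (ideal_gen (insert f I))" "1 \<notin> ideal_gen (insert f I)"
    "gdim (ideal_gen (insert f I)) = gdim I"
proof -
  have fd: "f \<in> homog d" "f \<notin> I" "colon I f \<noteq> I" using f by (auto simp: zero_divs_d_def)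
  obtain h where h: "h * f \<in> I" "h \<notin> I" using fd(3) colon_superset[OF Ii, of f] by (auto simp: colon_def)
  obtain g where g: "colon I (h * g) \<in> ass_primes I" "colon I h \<subseteq> colon I (h * g)"
    using ass_over_colon[OF h(2)] .
  have "f \<in> colon I h" using h(1) by (simp add: colon_def mult.commute)
  then have "ideal_gen (insert f I) \<subseteq> colon I (h * g)"
    using g(2) ass_primeD(4)[OF g(1)] by (intro ideal_gen_least ass_primeD(2)[OF g(1)]) auto
  from gdim_sandwich[OF g(1) ideal_gen_ideal _ this] ideal_gen_superset[of "insert f I"]
  show "1 \<notin> ideal_gen (insert f I)" "gdim (ideal_gen (insert f I)) = gdim I" by auto
  show "graded_ideal (ideal_gen (insert f I))" using gr fd(1) by (rule graded_insert)
qed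

lemma degree_split:
  assumes f: "f \<in> zero_divs_d I d"
  shows "degree_quot I = degree_quot (ideal_gen (insert f I)) + degree_quot (colon I f)"
proof -
  have fd: "f \<in> homog d" "f \<notin> I" using f by (auto simp: zero_divs_d_def)
  then have "f \<noteq> 0" using ideal_zero[OF Ii] by blast
  then show ?thesis
    using degree_add[OF gr proper pos fd(1) _ insert_props(2,3)[OF f] colon_props(2,3)[OF fd]] by simp
qed

lemma degree_nat:
  assumes "graded_ideal J" "1 \<notin> J" "gdim J = gdim I"
  obtains N :: nat where "1 \<le> N" "degree_quot J = real N"
  using degree_limit[OF assms pos] by blast

text \<open>The degrees of S/(I,f) are natural numbers at most deg(S/I), so the maximum is attained;
  \<open>degree_split\<close> turns it into a minimum of colon degrees.\<close>

lemma min_dist_colon: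
  assumes ne: "zero_divs_d I d \<noteq> {}"
  obtains f where "f \<in> zero_divs_d I d" "min_dist I d = degree_quot (colon I f)"
    and "\<And>g. g \<in> zero_divs_d I d \<Longrightarrow> min_dist I d \<le> degree_quot (colon I g)"
    and "Max ((\<lambda>f. degree_quot (ideal_gen (insert f I))) ` zero_divs_d I d)
      = degree_quot (ideal_gen (insert f I))"
proof -
  let ?D = "(\<lambda>f. degree_quot (ideal_gen (insert f I))) ` zero_divs_d I d"
  obtain N where N: "degree_quot I = real N" using degree_nat[OF gr proper refl] by blast
  have "?D \<subseteq> real ` {..N}"
  proof
    fix x assume "x \<in> ?D"
    then obtain f where f: "f \<in> zero_divs_d I d" "x = degree_quot (ideal_gen (insert f I))" by blast
    obtain M where M: "degree_quot (ideal_gen (insert f I)) = real M"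
      using degree_nat[OF insert_props[OF f(1)]] by blast
    have "degree_quot (ideal_gen (insert f I)) \<le> degree_quot I"
      using ideal_gen_superset[of "insert f I"]
      by (intro degree_le gr proper pos insert_props[OF f(1)] lms_mono) auto
    then have "M \<le> N" using M N by simp
    then show "x \<in> real ` {..N}" using f(2) M by simp
  qed
  then have fin: "finite ?D" by (rule finite_subset) simp
  then have "Max ?D \<in> ?D" using ne by (intro Max_in) auto
  then obtain f where f: "f \<in> zero_divs_d I d" "Max ?D = degree_quot (ideal_gen (insert f I))" by blast
  have md: "min_dist I d = degree_quot I - Max ?D" using ne by (simp add: min_dist_def)
  have "min_dist I d \<le> degree_quot (colon I g)" if g: "g \<in> zero_divs_d I d" for g
  proof -
    have "degree_quot (ideal_gen (insert g I)) \<le> Max ?D" using fin g by (intro Max_ge) auto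
    then show ?thesis using degree_split[OF g] md by simp
  qed
  moreover have "min_dist I d = degree_quot (colon I f)" using degree_split[OF f(1)] md f(2) by simp
  ultimately show ?thesis using that f by blast
qed

lemma zero_divs_mult:
  assumes f: "f \<in> zero_divs_d I d" and l: "l \<in> homog 1" "l * f \<notin> I"
  shows "l * f \<in> zero_divs_d I (Suc d)"
proof -
  have fd: "f \<in> homog d" "f \<notin> I" "colon I f \<noteq> I" using f by (auto simp: zero_divs_d_def)
  have "l * f \<in> homog (Suc d)"
    using l(1) fd(1) unfolding homog_eq by (rule polys_on_mult) (simp add: mdeg_add)
  moreover have "colon I f \<subseteq> colon I (l * f)"
    unfolding mult.commute[of l f] colon_colon[symmetric] by (rule colon_superset[OF colon_ideal[OF Ii]])
  ultimately show ?thesis using l(2) fd(3) colon_superset[OF Ii, of f] by (auto simp: zero_divs_d_def)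
qed

text \<open>(I:f) has positive dimension, so it cannot contain every variable.\<close>

lemma zero_divs_step:
  assumes f: "f \<in> zero_divs_d I d"
  obtains v where "var v * f \<in> zero_divs_d I (Suc d)"
proof -
  have fd: "f \<in> homog d" "f \<notin> I" using f by (auto simp: zero_divs_d_def)
  obtain v where "var v \<notin> colon I f"
    using var_notin[OF colon_ideal[OF Ii] colon_props(2)[OF fd]] colon_props(3)[OF fd] pos by auto
  then have "var v * f \<in> zero_divs_d I (Suc d)"
    by (intro zero_divs_mult f var_homog) (simp add: colon_def)
  then show ?thesis by (rule that)
qed

lemma zero_divs_nonempty:
  assumes zd: "\<forall>v. colon I (var v) \<noteq> I" and d: "1 \<le> d"
  shows "zero_divs_d I d \<noteq> {}"
  using d
proof (induction d rule: dec_induct)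
  case base
  obtain v where "var v \<notin> I" using var_notin[OF Ii proper pos] .
  then have "var v \<in> zero_divs_d I 1" using zd var_homog by (auto simp: zero_divs_d_def)
  then show ?case by blast
next
  case (step n)
  then show ?case using zero_divs_step by (metis all_not_in_conv)
qed

lemma colon_mult_degree:
  assumes "g \<in> homog e" "f * g \<notin> I" "f \<in> homog d"
  shows "degree_quot (colon I (f * g)) \<le> degree_quot (colon I f)"
proof -
  have f: "f \<notin> I" using assms(2) ideal_mult'[OF Ii] by blast
  have fg: "f * g \<in> homog (d + e)"
    using assms(3,1) unfolding homog_eq by (rule polys_on_mult) (simp add: mdeg_add)
  have "colon I f \<subseteq> colon I (f * g)"
    unfolding colon_colon[symmetric] by (rule colon_superset[OF colon_ideal[OF Ii]])
  then show ?thesis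
    using colon_props[OF fg assms(2)] colon_props[OF assms(3) f] pos
    by (intro degree_le lms_mono) simp_all
qed

lemma min_dist_nat:
  assumes ne: "zero_divs_d I d \<noteq> {}"
  obtains m :: nat where "1 \<le> m" "min_dist I d = real m"
proof -
  obtain f where f: "f \<in> zero_divs_d I d" "min_dist I d = degree_quot (colon I f)"
    using min_dist_colon[OF ne] by blast
  then show ?thesis
    using degree_nat[OF colon_props, of f d] that by (auto simp: zero_divs_d_def)
qed

lemma min_dist_antimono:
  assumes ne: "zero_divs_d I d \<noteq> {}"
  shows "min_dist I (Suc d) \<le> min_dist I d"
proof -
  obtain f where f: "f \<in> zero_divs_d I d" "min_dist I d = degree_quot (colon I f)"
    using min_dist_colon[OF ne] by blast
  obtain v where v: "var v * f \<in> zero_divs_d I (Suc d)" using zero_divs_step[OF f(1)] .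
  then have "zero_divs_d I (Suc d) \<noteq> {}" by blast
  then have "min_dist I (Suc d) \<le> degree_quot (colon I (var v * f))"
    using min_dist_colon[of "Suc d"] v by metis
  also have "\<dots> \<le> degree_quot (colon I f)"
    unfolding mult.commute[of "var v" f]
    using v f(1) var_homog[of v, where ?'b = 'a]
    by (intro colon_mult_degree[of _ 1 _ d]) (auto simp: zero_divs_d_def mult.commute)
  finally show ?thesis using f(2) by simp
qed

text \<open>The colon ideal J of an optimal f is radical. If it were prime, it would be an associated
  prime of I, hence of degree one. Otherwise there are two different associated primes p, q
  containing J, and multiplying f by a linear form in p outside q lowers the degree of J.\<close>

lemma min_dist_strict:
  assumes rad: "radical_ideal I"
    and lin: "\<forall>p\<in>ass_primes I. \<exists>L. L \<subseteq> homog 1 \<and> p = ideal_gen L"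
    and ne: "zero_divs_d I d \<noteq> {}" and md: "min_dist I d \<noteq> 1"
  shows "min_dist I (Suc d) < min_dist I d"
proof -
  have rad2: "x \<in> I" if "x * x \<in> I" for x
    using rad that by (auto simp: radical_ideal_def power2_eq_square[symmetric])
  obtain f where f: "f \<in> zero_divs_d I d" "min_dist I d = degree_quot (colon I f)"
    using min_dist_colon[OF ne] by blast
  then have fd: "f \<in> homog d" "f \<notin> I" by (auto simp: zero_divs_d_def)
  define J where "J = colon I f"
  note J = colon_props[OF fd, folded J_def]
  have Ji: "is_ideal J" using J(1) by (rule graded_ideal_is_ideal)
  have "\<not> prime_ideal J"
  proof
    assume pJ: "prime_ideal J"
    then have "J \<in> ass_primes I" by (auto simp: ass_primes_def J_def)
    then obtain L where "L \<subseteq> homog 1" "J = ideal_gen L" using lin by blast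
    then show False using degree_linear_prime[OF pJ] J(3) pos md f(2) by (simp add: J_def)
  qed
  then obtain a b where ab: "a * b \<in> J" "a \<notin> J" "b \<notin> J"
    using J(2) Ji by (auto simp: prime_ideal_def)
  obtain g where g: "prime_ideal (colon J (a * g))" using ass_prime_colon[OF Ji ab(2)] .
  obtain h where h: "prime_ideal (colon J (b * h))" using ass_prime_colon[OF Ji ab(3)] .
  define p where "p = colon J (a * g)"
  define q where "q = colon J (b * h)"
  have p: "p \<in> ass_primes I" and q: "q \<in> ass_primes I"
    using g h by (auto simp: ass_primes_def p_def q_def J_def colon_colon)
  have bhf: "b * h * f \<notin> I" using h by (auto simp: prime_ideal_def J_def colon_def)
  \<comment> \<open>b separates the two associated primes. It lies in p because ab is in J; if it
    were in q, the square of b h f would be in I, against radicality. The same square keeps f out of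
    q.\<close>
  have "b \<in> p"
    using ideal_mult'[OF Ji ab(1), of g] by (simp add: p_def colon_def mult_ac)
  have "b \<notin> q"
  proof
    assume "b \<in> q"
    then have "b * (b * h) * f \<in> I" by (simp add: q_def J_def colon_def)
    then have "(b * (b * h) * f) * (f * h) \<in> I" by (rule ideal_mult'[OF Ii])
    then show False using rad2[of "b * h * f"] bhf by (simp add: mult_ac)
  qed
  have "f \<notin> q"
  proof
    assume "f \<in> q"
    then have "f * (b * h) * f \<in> I" by (simp add: q_def J_def colon_def)
    then have "(f * (b * h) * f) * (b * h) \<in> I" by (rule ideal_mult'[OF Ii])
    then show False using rad2[of "b * h * f"] bhf by (simp add: mult_ac)
  qed
  obtain L where L: "L \<subseteq> homog 1" "p = ideal_gen L" using lin p by blast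
  have "\<not> L \<subseteq> q"
    using ideal_gen_least[OF ass_primeD(2)[OF q]] L(2) \<open>b \<in> p\<close> \<open>b \<notin> q\<close> by blast
  \<comment> \<open>Since l is in p, (J,l) lies in an associated prime and has full dimension, hence
    positive degree; since l is outside q, l f is not in I and competes in degree d + 1. So (J:l)
    has strictly smaller degree than J.\<close>
  then obtain l where l: "l \<in> L" "l \<notin> q" by blast
  have l1: "l \<in> homog 1" and lp: "l \<in> p" using l(1) L ideal_gen_superset by auto
  have "l * f \<notin> q" using \<open>f \<notin> q\<close> l(2) ass_primeD(1)[OF q] by (auto simp: prime_ideal_def)
  then have lf: "l * f \<notin> I" using ass_primeD(4)[OF q] by blast
  have zlf: "l * f \<in> zero_divs_d I (Suc d)" using f(1) l1 lf by (rule zero_divs_mult)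
  have JI: "I \<subseteq> J" unfolding J_def by (rule colon_superset[OF Ii])
  have Jp: "J \<subseteq> p" unfolding p_def by (rule colon_superset[OF Ji])
  have K: "1 \<notin> ideal_gen (insert l J)" "gdim (ideal_gen (insert l J)) = gdim I"
    using gdim_sandwich[OF p ideal_gen_ideal, of "insert l J"] JI
      ideal_gen_superset[of "insert l J"] ideal_gen_least[OF ass_primeD(2)[OF p], of "insert l J"] Jp lp
    by auto
  have Jl: "colon J l = colon I (l * f)" by (simp add: J_def colon_colon mult.commute)
  have "l * f \<in> homog (Suc d)" using zlf by (simp add: zero_divs_d_def)
  note C = colon_props[OF this lf, folded Jl]
  have "l \<noteq> 0" using l(2) ideal_zero[OF ass_primeD(2)[OF q]] by blast
  then have "degree_quot J = degree_quot (ideal_gen (insert l J)) + degree_quot (colon J l)"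
    using degree_add[OF J(1,2) _ l1] J(3) pos K C by simp
  moreover obtain N where "1 \<le> N" "degree_quot (ideal_gen (insert l J)) = real N"
    using degree_nat[OF graded_insert[OF J(1) l1] K] .
  ultimately have "degree_quot (colon I (l * f)) < degree_quot J" by (simp add: Jl)
  moreover have "min_dist I (Suc d) \<le> degree_quot (colon I (l * f))"
    using min_dist_colon[of "Suc d"] zlf by (metis empty_iff)
  ultimately show ?thesis using f(2) by (simp add: J_def)
qed

section \<open>Footprints\<close>

text \<open>The ideal (in(I), t^a), written as a span of monomials.\<close>

definition foot :: "('v \<Rightarrow>\<^sub>0 nat) \<Rightarrow> ('v, 'a) mpoly set" where
  "foot a = polys_on (lms I \<union> {a + c | c. True})"

text \<open>The leads of \<open>foot a\<close> lie between those of I and of K, whose dimensions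
  agree, so \<open>degree_le\<close> applies on both sides.\<close>

lemma foot_degree:
  assumes K: "graded_ideal K" "1 \<notin> K" "gdim K = gdim I" and IK: "I \<subseteq> K" and a: "a \<in> lms K"
  shows "degree_quot K \<le> degree_quot (foot a)" "degree_quot (foot a) \<le> degree_quot I"
proof -
  note Ki = graded_ideal_is_ideal[OF K(1)]
  have lf: "lms (foot a) = lms I \<union> {a + c | c. True}" by (simp add: foot_def)
  have up: "upset (lms I \<union> {a + c | c. True})"
    using upset_lms[OF Ii] by (auto simp: upset_def add.assoc)
  have F: "graded_ideal (foot a)"
    using polys_on_ideal[OF up] unfolding graded_ideal_def foot_def
    by (auto simp: polys_on_def keys_hcomp)
  have fK: "lms (foot a) \<subseteq> lms K"
    unfolding lf using lms_mono[OF IK] lms_add[OF Ki a] by auto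
  have F1: "1 \<notin> foot a"
    using fK lms_zero_iff[OF Ki] lms_zero_iff[OF graded_ideal_is_ideal[OF F]] K(2) by blast
  have If: "lms I \<subseteq> lms (foot a)" unfolding lf by blast
  have "gdim K \<le> gdim (foot a)"
    unfolding gdim_def using fK by (rule udim_mono) (simp add: lms_zero_iff[OF Ki] K(2))
  moreover have "gdim (foot a) \<le> gdim I"
    unfolding gdim_def using If by (rule udim_mono) (simp add: lms_zero_iff[OF graded_ideal_is_ideal[OF F]] F1)
  ultimately have g: "gdim (foot a) = gdim I" using K(3) by simp
  show "degree_quot K \<le> degree_quot (foot a)"
    using F F1 g K pos fK by (intro degree_le) simp_all
  show "degree_quot (foot a) \<le> degree_quot I"
    using F F1 g pos gr proper If by (intro degree_le) simp_all
qed

text \<open>A monomial of positive degree is a multiple of a variable, and annihilators of that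
  variable carry over.\<close>

lemma monom_zero_div:
  assumes zd: "\<forall>v. colon I (var v) \<noteq> I" and a: "mdeg a = d" "1 \<le> d" "a \<notin> lms I"
  shows "monom a \<in> zero_divs_d I d"
proof -
  have "monom a \<notin> I" using a(3) lmsI[of "monom a" I] by auto
  moreover have "monom a \<in> homog d" using a(1) by (simp add: homog_def)
  moreover have "colon I (monom a) \<noteq> I"
  proof -
    have "a \<noteq> 0" using a by auto
    then obtain v where v: "lookup a v \<noteq> 0" by (metis lookup_zero poly_mapping_eqI)
    then have "a = Poly_Mapping.single v 1 + (a - Poly_Mapping.single v 1)"
      by (intro poly_mapping_eqI) (auto simp: lookup_add lookup_minus lookup_single when_def)
    then have "monom a = var v * (monom (a - Poly_Mapping.single v 1) :: ('v, 'a) mpoly)"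
      unfolding var_def monom_mult[symmetric] by simp
    then have "colon I (var v) \<subseteq> colon I (monom a)"
      using colon_superset[OF colon_ideal[OF Ii]] by (simp add: colon_colon[symmetric])
    then show ?thesis using zd colon_superset[OF Ii, of "var v"] by blast
  qed
  ultimately show ?thesis by (simp add: zero_divs_d_def)
qed

text \<open>Reducing f modulo I in degree d stays within (I,f) and produces a standard lead a of
  degree d; being a lead of (I,f), it allows the comparison with \<open>foot a\<close>.\<close>

lemma zero_div_foot:
  assumes f: "f \<in> zero_divs_d I d"
  obtains a where "mdeg a = d" "a \<notin> lms I" "degree_quot (ideal_gen (insert f I)) \<le> degree_quot (foot a)"
proof -
  have fd: "f \<in> homog d" "f \<notin> I" using f by (auto simp: zero_divs_d_def)
  let ?V = "I \<inter> homog d"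
  have V: "kv.subspace ?V" unfolding homog_eq by (rule subspace_window[OF Ii])
  obtain v where v: "v \<in> ?V" "f - v \<noteq> 0" "lead (f - v) \<notin> lms ?V"
    using lead_reduce[OF V] fd(2) by blast
  define a where "a = lead (f - v)"
  have "f - v \<in> homog d" using fd v by (auto simp: homog_eq intro: kv.subspace_diff polys_on_subspace)
  then have ad: "mdeg a = d" using lead_keys[OF v(2)] by (auto simp: a_def homog_def)
  then have aI: "a \<notin> lms I" using v(3) lms_eq_window[OF gr, of d] by (auto simp: homog_eq a_def)
  let ?K = "ideal_gen (insert f I)"
  have "I \<subseteq> ?K" "f \<in> ?K" using ideal_gen_superset[of "insert f I"] by auto
  then have "f - v \<in> ?K" using v(1) ideal_diff[OF ideal_gen_ideal, of f "insert f I" v] by blast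
  then have "a \<in> lms ?K" unfolding a_def using v(2) by (rule lmsI)
  then have "degree_quot ?K \<le> degree_quot (foot a)"
    using foot_degree(1)[OF insert_props[OF f] \<open>I \<subseteq> ?K\<close>] by blast
  then show ?thesis using that ad aI by blast
qed

lemma standard_foot:
  assumes zd: "\<forall>v. colon I (var v) \<noteq> I" and a: "mdeg a = d" "1 \<le> d" "a \<notin> lms I"
  shows "degree_quot (ideal_gen (insert (monom a) I)) \<le> degree_quot (foot a)"
    and "degree_quot (foot a) \<le> degree_quot I"
proof -
  let ?K = "ideal_gen (insert (monom a) I)"
  have "I \<subseteq> ?K" "monom a \<in> ?K" using ideal_gen_superset[of "insert (monom a) I"] by auto
  moreover have "a \<in> lms ?K" using lmsI[OF \<open>monom a \<in> ?K\<close>] by simp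
  ultimately show "degree_quot ?K \<le> degree_quot (foot a)" "degree_quot (foot a) \<le> degree_quot I"
    using foot_degree[OF insert_props[OF monom_zero_div[OF zd a]]] by auto
qed

end

text \<open>The Hilbert function of an ideal that is not graded can only be read off an order refining
  the degree. For graded ideals such a refinement has the same leading monomials as the given order.\<close>

definition deg_refine :: "(('v::finite \<Rightarrow>\<^sub>0 nat) \<Rightarrow> ('v \<Rightarrow>\<^sub>0 nat) \<Rightarrow> bool) \<Rightarrow> ('v \<Rightarrow>\<^sub>0 nat) \<Rightarrow> ('v \<Rightarrow>\<^sub>0 nat) \<Rightarrow> bool" where
  "deg_refine le a b \<longleftrightarrow> mdeg a < mdeg b \<or> (mdeg a = mdeg b \<and> le a b)"

lemma deg_order_refine:
  assumes "monomial_order le"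
  shows "deg_order (deg_refine le)"
proof -
  interpret mon_order le using assms by unfold_locales
  show ?thesis
  proof unfold_locales
    show "monomial_order (deg_refine le)"
      unfolding monomial_order_def
    proof (intro conjI allI impI)
      fix a b c
      show "deg_refine le a a" by (simp add: deg_refine_def)
      show "deg_refine le a b \<or> deg_refine le b a"
        using le_total[of a b] by (auto simp: deg_refine_def)
      show "deg_refine le 0 a" using le_zero by (auto simp: deg_refine_def)
      show "a = b" if "deg_refine le a b \<and> deg_refine le b a"
        using that le_antisym[of a b] by (auto simp: deg_refine_def)
      show "deg_refine le a c" if "deg_refine le a b \<and> deg_refine le b c"
        using that le_trans[of a b c] by (auto simp: deg_refine_def)
      show "deg_refine le (a + c) (b + c)" if "deg_refine le a b"
        using that le_add[of a b c] by (auto simp: deg_refine_def mdeg_add)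
    qed
  qed (auto simp: deg_refine_def)
qed

lemma ideal_gen_monoms:
  assumes G: "upset G"
  shows "ideal_gen (monom ` G) = (polys_on G :: ('v::finite, 'a::field) mpoly set)"
proof
  show "ideal_gen (monom ` G) \<subseteq> (polys_on G :: ('v, 'a) mpoly set)"
    by (intro ideal_gen_least polys_on_ideal[OF G]) auto
  show "polys_on G \<subseteq> (ideal_gen (monom ` G) :: ('v, 'a) mpoly set)"
  proof
    fix f :: "('v, 'a) mpoly" assume f: "f \<in> polys_on G"
    have "(\<Sum>a\<in>keys f. kscale (lookup f a) (monom a)) \<in> ideal_gen (monom ` G)"
      using f ideal_gen_superset[of "monom ` G"]
      by (intro ideal_sum ideal_kscale ideal_gen_ideal) (auto simp: polys_on_def)
    then show "f \<in> ideal_gen (monom ` G)" using poly_expand_monom[of f] by metis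
  qed
qed

text \<open>On forms the two orders pick the same lead, and every lead of a graded ideal is the lead
  of a form in it.\<close>

lemma lms_refine:
  fixes I :: "('v::finite, 'a::field) mpoly set"
  assumes mo: "monomial_order le" and gr: "graded_ideal I"
  shows "mon_order.lms le I = mon_order.lms (deg_refine le) I"
proof -
  interpret A: mon_order le using mo by unfold_locales
  interpret B: deg_order "deg_refine le" using mo by (rule deg_order_refine)
  have homog_lead: "A.lead f = B.lead f" if f: "f \<noteq> 0" "f \<in> homog d" for f :: "('v, 'a) mpoly" and d
  proof (rule A.lead_eqI)
    show "B.lead f \<in> keys f" by (rule B.lead_keys[OF f(1)])
    show "le b (B.lead f)" if b: "b \<in> keys f" for b
      using B.lead_max[OF f(1) b] homogD[OF f(2) b] homogD[OF f(2) B.lead_keys[OF f(1)]]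
      by (simp add: deg_refine_def)
  qed
  show ?thesis
  proof (intro subset_antisym subsetI)
    fix a assume "a \<in> A.lms I"
    then obtain f where f: "f \<in> I" "f \<noteq> 0" "A.lead f = a" by (rule A.lmsE)
    define g where "g = hcomp (mdeg a) f"
    have "a \<in> keys g" using A.lead_keys[OF f(2)] f(3) by (simp add: g_def keys_hcomp)
    moreover from this have "A.lead g = a"
      using A.lead_max[OF f(2)] f(3) by (intro A.lead_eqI) (auto simp: g_def keys_hcomp)
    moreover have "g \<noteq> 0" using \<open>a \<in> keys g\<close> by auto
    ultimately have "B.lead g = a" using homog_lead[of g "mdeg a"] by (simp add: g_def)
    then show "a \<in> B.lms I" using B.lmsI[of g I] graded_hcomp[OF gr f(1)] \<open>g \<noteq> 0\<close> by (simp add: g_def)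
  next
    fix a assume a: "a \<in> B.lms I"
    then have "a \<in> B.lms (I \<inter> homog (mdeg a))" unfolding homog_eq B.lms_eq_window[OF gr] by simp
    then obtain f where f: "f \<in> I" "f \<in> homog (mdeg a)" "f \<noteq> 0" "B.lead f = a" by (auto elim: B.lmsE)
    then show "a \<in> A.lms I" using A.lmsI[OF f(1,3)] homog_lead[OF f(3,2)] by simp
  qed
qed

theorem theorem4p5:
  fixes I :: "('v::finite, 'a::field) mpoly set"
    and le :: "('v \<Rightarrow>\<^sub>0 nat) \<Rightarrow> ('v \<Rightarrow>\<^sub>0 nat) \<Rightarrow> bool"
  assumes mo: "monomial_order le"
    and gr: "graded_ideal I"
    and nz: "I \<noteq> {0}"
    and um: "unmixed I"
    and dim: "krull_dim I \<ge> 1"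
    and zd: "\<forall>v. colon I (var v) \<noteq> I"
  shows "(\<forall>d\<ge>1. zero_divs_d I d \<noteq> {})
    \<and> (\<forall>d\<ge>1. min_dist I d \<ge> footprint_fun le I d)
    \<and> (\<forall>d\<ge>1. \<forall>a\<in>footprint_d le I d.
          degree_quot (ideal_gen (insert (monom a) I))
            \<le> degree_quot (ideal_gen (insert (monom a) (init_ideal le I)))
        \<and> degree_quot (ideal_gen (insert (monom a) (init_ideal le I))) \<le> degree_quot I)
    \<and> (\<forall>d\<ge>1. footprint_fun le I d \<ge> 0)
    \<and> (\<forall>d\<ge>1. min_dist I d \<ge> min_dist I (Suc d) \<and> min_dist I (Suc d) \<ge> 0)
    \<and> ((radical_ideal I \<and>
         (\<forall>p\<in>ass_primes I. \<exists>L. L \<subseteq> homog 1 \<and> p = ideal_gen L))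
        \<longrightarrow> (\<exists>r\<ge>1. (\<forall>i. 1 \<le> i \<and> i < r \<longrightarrow> min_dist I i > min_dist I (Suc i))
                   \<and> (\<forall>d\<ge>r. min_dist I d = 1)))"
proof -
  interpret A: mon_order le using mo by unfold_locales
  interpret D: deg_order "deg_refine le" using mo by (rule deg_order_refine)
  have I: "is_ideal I" using gr by (rule graded_ideal_is_ideal)
  have proper: "1 \<notin> I"
  proof
    assume "1 \<in> I"
    then have "I = UNIV" using ideal_one[OF I] by simp
    \<comment> \<open>No prime equals S, so the set is empty, and the supremum of the empty set of
      naturals is 0.\<close>
    then have "{n. \<exists>P. prime_chain n P \<and> I \<subseteq> P 0} = {}"
      by (auto simp: prime_chain_def prime_ideal_def)
    then have "krull_dim I = 0" unfolding krull_dim_def by (simp only: Sup_nat_empty)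
    then show False using dim by simp
  qed
  interpret U: unmixed_ideal "deg_refine le" I
    using gr proper um dim D.krull_dim_gdim[OF gr proper] by unfold_locales simp_all
  define E where "E = D.lms I"
  have lmsE: "A.lms I = E" unfolding E_def using mo gr by (rule lms_refine)
  have upE: "upset E" unfolding E_def using I by (rule D.upset_lms)
  have init: "init_ideal le I = polys_on E"
  proof -
    have "{monom (lead_monom le f) | f. f \<in> I \<and> f \<noteq> 0} = (monom ` A.lms I :: ('v, 'a) mpoly set)"
      by (auto simp: A.lms_def)
    then show ?thesis unfolding init_ideal_def lmsE using ideal_gen_monoms[OF upE] by simp
  qed
  have fp: "footprint_d le I d = {a. mdeg a = d \<and> a \<notin> E}" for d
    by (simp add: footprint_d_def init)
  \<comment> \<open>\<open>U.foot\<close> is built from the refined order; both orders give the same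
    exponents E, so it is the ideal of the statement.\<close>
  have foot: "ideal_gen (insert (monom a) (init_ideal le I)) = U.foot a" for a
  proof -
    let ?G = "E \<union> {a + c | c. True}"
    have up: "upset ?G" using upE by (auto simp: upset_def add.assoc)
    have "ideal_gen (insert (monom a) (polys_on E)) = (polys_on ?G :: ('v, 'a) mpoly set)"
    proof (rule subset_antisym)
      have "a \<in> ?G" by (auto intro: exI[of _ 0])
      then show "ideal_gen (insert (monom a) (polys_on E)) \<subseteq> (polys_on ?G :: ('v, 'a) mpoly set)"
        using polys_on_mono[of E ?G, where ?'b = 'a]
        by (intro ideal_gen_least polys_on_ideal[OF up]) auto
      have "monom b \<in> (ideal_gen (insert (monom a) (polys_on E)) :: ('v, 'a) mpoly set)" if "b \<in> ?G" for b
        using that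
      proof
        assume "b \<in> E"
        then show ?thesis using ideal_gen_superset by (fastforce simp: polys_on_def)
      next
        assume "b \<in> {a + c | c. True}"
        then obtain c where "b = a + c" by blast
        then show ?thesis
          using ideal_gen_superset[of "insert (monom a) (polys_on E)"]
          by (auto simp: monom_mult intro!: ideal_mult'[OF ideal_gen_ideal])
      qed
      then show "(polys_on ?G :: ('v, 'a) mpoly set) \<subseteq> ideal_gen (insert (monom a) (polys_on E))"
        unfolding ideal_gen_monoms[OF up, symmetric] by (intro ideal_gen_least ideal_gen_ideal) auto
    qed
    then show ?thesis by (simp add: U.foot_def init E_def)
  qed
  have ne: "zero_divs_d I d \<noteq> {}" if "1 \<le> d" for d
    using zd that by (rule U.zero_divs_nonempty)
  have std: "degree_quot (ideal_gen (insert (monom a) I)) \<le> degree_quot (U.foot a)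
      \<and> degree_quot (U.foot a) \<le> degree_quot I" if "1 \<le> d" "a \<in> footprint_d le I d" for a d
    using U.standard_foot[OF zd, of a d] that by (simp add: fp E_def)
  have fin: "finite (footprint_d le I d)" for d
    by (rule finite_subset[OF _ finite_mdeg_eq[of d]]) (auto simp: fp)
  have fpf: "footprint_fun le I d = (if footprint_d le I d \<noteq> {}
      then degree_quot I - Max ((\<lambda>a. degree_quot (U.foot a)) ` footprint_d le I d) else degree_quot I)" for d
    by (simp add: footprint_fun_def foot)
  have ge0: "0 \<le> degree_quot I" using U.degree_nat[OF gr proper refl] by (metis of_nat_0_le_iff)
  have p2: "footprint_fun le I d \<le> min_dist I d" if d: "1 \<le> d" for d
  proof -
    obtain f where f: "f \<in> zero_divs_d I d"
      "Max ((\<lambda>f. degree_quot (ideal_gen (insert f I))) ` zero_divs_d I d) = degree_quot (ideal_gen (insert f I))"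
      using U.min_dist_colon[OF ne[OF d]] by blast
    obtain a where a: "mdeg a = d" "a \<notin> D.lms I" "degree_quot (ideal_gen (insert f I)) \<le> degree_quot (U.foot a)"
      using U.zero_div_foot[OF f(1)] .
    have "a \<in> footprint_d le I d" using a by (simp add: fp E_def)
    then have "degree_quot (U.foot a) \<le> Max ((\<lambda>a. degree_quot (U.foot a)) ` footprint_d le I d)"
      and "footprint_d le I d \<noteq> {}"
      using fin by (auto intro!: Max_ge)
    then show ?thesis using a(3) f(2) ne[OF d] by (simp add: fpf min_dist_def)
  qed
  have p4: "0 \<le> footprint_fun le I d" if d: "1 \<le> d" for d
  proof (cases "footprint_d le I d = {}")
    case True
    then show ?thesis using ge0 by (simp add: fpf)
  next
    case False
    then have "Max ((\<lambda>a. degree_quot (U.foot a)) ` footprint_d le I d) \<le> degree_quot I"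
      using fin std[OF d] by (subst Max_le_iff) auto
    then show ?thesis using False by (simp add: fpf)
  qed
  have "\<forall>d. \<exists>m :: nat. 1 \<le> d \<longrightarrow> 1 \<le> m \<and> min_dist I d = real m"
    using U.min_dist_nat[OF ne] by metis
  then obtain m :: "nat \<Rightarrow> nat" where m: "\<And>d. 1 \<le> d \<Longrightarrow> 1 \<le> m d \<and> min_dist I d = real (m d)" by metis
  have anti: "min_dist I (Suc d) \<le> min_dist I d" if "1 \<le> d" for d
    using ne[OF that] by (rule U.min_dist_antimono)
  have p6: "\<exists>r\<ge>1. (\<forall>i. 1 \<le> i \<and> i < r \<longrightarrow> min_dist I i > min_dist I (Suc i)) \<and> (\<forall>d\<ge>r. min_dist I d = 1)"
    if rad: "radical_ideal I" "\<forall>p\<in>ass_primes I. \<exists>L. L \<subseteq> homog 1 \<and> p = ideal_gen L"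
  proof -
    have strict: "min_dist I (Suc d) < min_dist I d" if "1 \<le> d" "min_dist I d \<noteq> 1" for d
      using U.min_dist_strict[OF rad ne[OF that(1)] that(2)] .
    have "\<exists>r\<ge>1. min_dist I r = 1"
    proof (rule ccontr)
      assume no: "\<not> (\<exists>r\<ge>1. min_dist I r = 1)"
      \<comment> \<open>Without the value 1 the natural numbers m would drop at every step; at n = m
        1 nothing positive is left.\<close>
      have "m (Suc n) + n \<le> m 1" for n
      proof (induction n)
        case (Suc n)
        have "min_dist I (Suc n) \<noteq> 1" using no by auto
        then have "real (m (Suc (Suc n))) < real (m (Suc n))"
          using strict[of "Suc n"] m[of "Suc n"] m[of "Suc (Suc n)"] by simp
        then show ?case using Suc by simp
      qed simp
      from this[of "m 1"] show False using m[of "Suc (m 1)"] by simp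
    qed
    then have ex: "\<exists>r. 1 \<le> r \<and> min_dist I r = 1" by blast
    \<comment> \<open>Before the least such r the value is not 1, so the descent is strict; from r
      on it is at most 1 by monotonicity and at least 1 as a positive integer.\<close>
    define r where "r = (LEAST r. 1 \<le> r \<and> min_dist I r = 1)"
    have r: "1 \<le> r" "min_dist I r = 1" using LeastI_ex[OF ex] by (auto simp: r_def)
    have "min_dist I (Suc i) < min_dist I i" if "1 \<le> i" "i < r" for i
      using strict[of i] not_less_Least[of i "\<lambda>r. 1 \<le> r \<and> min_dist I r = 1"] that by (auto simp: r_def)
    moreover have "min_dist I d = 1" if "r \<le> d" for d
      using that
    proof (induction d rule: dec_induct)
      case (step n)
      then have "min_dist I (Suc n) \<le> 1" using anti[of n] r(1) by simp
      then show ?case using m[of "Suc n"] by simp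
    qed (rule r(2))
    ultimately show ?thesis using r(1) by blast
  qed
  have p5: "min_dist I (Suc d) \<le> min_dist I d \<and> 0 \<le> min_dist I (Suc d)" if "1 \<le> d" for d
    using anti[OF that] m[of "Suc d"] by simp
  show ?thesis
    using ne p2 std p4 p5 p6 unfolding foot by blast
qed

end
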